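(* Let $d=1$. For measurable functions $\alpha_n,\alpha$ on $[0,\infty)$ put $$n_n(dx)=|x|^{-1-\alpha_n(|x|)}dx,\quad n(dx)=|x|^{-1-\alpha(|x|)}dx,\qquad \varphi_n(x)=\int_{\mathbb R}(1-\cos(x\xi))\,n_n(d\xi),\quad \varphi(x)=\int_{\mathbb R}(1-\cos(x\xi))\,n(d\xi),$$ and let $(\mathcal E^n,\mathcal F^n)$, $(\mathcal E,\mathcal F)$ be the translation invariant symmetric Dirichlet forms on $L^2(\mathbb R)$ with characteristic exponents $\varphi_n$ and $\varphi$, i.e. $$\mathcal E^n(u,v)=\int_{\mathbb R}\widehat u(x)\overline{\widehat v}(x)\varphi_n(x)\,dx,\quad \mathcal F^n=\Bigl\{u\in L^2(\mathbb R):\int_{\mathbb R}|\widehat u(x)|^2\varphi_n(x)\,dx<\infty\Bigr\},$$ and likewise $(\mathcal E,\mathcal F)$ with $\varphi$ in place of $\varphi_n$. (i) (recurrent ones to transient one) If $\alpha_n(u)=1+1/n-\bigl(\log(u+e^2)\bigr)^{-1/2}$ and $\alpha(u)=1-\bigl(\log(u+e^2)\bigr)^{-1/2}$ for $u\ge0$ and $n\in\mathbb N$, $n\ge 1$, then $(\mathcal E^n,\mathcal F^n)$ is recurrent for any $n$ and converges in the sense of Mosco to $(\mathcal E,\mathcal F)$, which is transient. (ii) (transient ones to recurrent one) If $\alpha_n(u)=1-\bigl(\log(u+e^2)\bigr)^{-(1-1/n)}$ and $\alpha(u)=1-\bigl(\log(u+e^2)\bigr)^{-1}$ for $u\ge0$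 and $n\in\mathbb N$, $n\ge2$, then $(\mathcal E^n,\mathcal F^n)$ is transient for any $n$ and converges in the sense of Mosco to $(\mathcal E,\mathcal F)$, which is recurrent.
   Context: $L^2(\mathbb R)=L^2(\mathbb R;dx)$, $dx$ Lebesgue measure; $\widehat u$ is the (unitary) Fourier transform of $u$. Recurrence/transience of a Dirichlet form are in the usual sense: with $\{T_t\}$ the associated semigroup and $Gf=\int_0^\infty T_tf\,dt$ for nonnegative $f\in L^1$, the form is transient if $Gf<\infty$ a.e. for every nonnegative $f\in L^1$, and recurrent if $Gf\in\{0,\infty\}$ a.e. for every nonnegative $f\in L^1$. Mosco convergence: a closed form means a nonnegative definite symmetric closed form on a Hilbert space $\mathcal H$ (not necessarily densely defined), and it is extended by setting $\mathcal E(u,u)=\infty$ for $u\in\mathcal H\setminus\mathcal F$. A sequence of closed forms $\mathcal E^n$ on $\mathcal H$ converges to $\mathcal E$ in the sense of Mosco if (M1) for every $u\in\mathcal H$ and every sequence $\{u_n\}$ converging to $u$ weakly in $\mathcal H$, $\liminf_{n\to\infty}\mathcal E^n(u_n,u_n)\ge\mathcal E(u,u)$; and (M2) for every $u\in\mathcal H$ there exists a sequence $\{u_n\}$ converging to $u$ (strongly) in $\mathcal H$ such that $\limsup_{n\to\infty}\mathcal E^n(u_n,u_n)\le\mathcal E(u,u)$. Here $\mathcal H=L^2(\mathbb R)$. *)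

theory Defs
  imports "HOL-Analysis.Analysis"
begin

text \<open>
  Elements of the real Hilbert space \<open>L\<^sup>2(\<real>; dx)\<close> are represented by Borel functions; identities between
  them are meant almost everywhere, and all notions below are invariant under a.e. equality.
\<close>

definition L2 :: "(real \<Rightarrow> real) set" where
  "L2 = {u \<in> borel_measurable lborel. integrable lborel (\<lambda>x. (u x)\<^sup>2)}"

definition l2_inner :: "(real \<Rightarrow> real) \<Rightarrow> (real \<Rightarrow> real) \<Rightarrow> real" where
  "l2_inner u v = (LINT x|lborel. u x * v x)"

definition l2_norm :: "(real \<Rightarrow> real) \<Rightarrow> real" where
  "l2_norm u = sqrt (l2_inner u u)"

definition l2_tendsto :: "('i \<Rightarrow> real \<Rightarrow> real) \<Rightarrow> (real \<Rightarrow> real) \<Rightarrow> 'i filter \<Rightarrow> bool" where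
  "l2_tendsto w u F \<longleftrightarrow> ((\<lambda>i. l2_norm (\<lambda>x. w i x - u x)) \<longlongrightarrow> 0) F"

definition l2_weak_tendsto :: "('i \<Rightarrow> real \<Rightarrow> real) \<Rightarrow> (real \<Rightarrow> real) \<Rightarrow> 'i filter \<Rightarrow> bool" where
  "l2_weak_tendsto w u F \<longleftrightarrow> (\<forall>v\<in>L2. ((\<lambda>i. l2_inner (w i) v) \<longlongrightarrow> l2_inner u v) F)"

subsection \<open>The unitary Fourier transform on \<open>L\<^sup>2\<close>\<close>

definition fourier_trunc :: "real \<Rightarrow> (real \<Rightarrow> complex) \<Rightarrow> real \<Rightarrow> complex" where
  "fourier_trunc R u \<xi> =
     (LINT x:{-R..R}|lborel. exp (- (\<i> * of_real (x * \<xi>))) * u x) / of_real (sqrt (2 * pi))"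

text \<open>
  By Plancherel's theorem the truncated transforms of a square integrable \<open>u\<close> converge in \<open>L\<^sup>2\<close>; the
  limit is determined up to a null set. The distance is a nonnegative (\<open>ennreal\<close>-valued) integral, so
  that it cannot vanish merely because an integrand fails to be integrable.
\<close>

definition fourier :: "(real \<Rightarrow> complex) \<Rightarrow> real \<Rightarrow> complex" where
  "fourier u = (SOME g. g \<in> borel_measurable lborel \<and>
     integrable lborel (\<lambda>\<xi>. (cmod (g \<xi>))\<^sup>2) \<and>
     ((\<lambda>R. \<integral>\<^sup>+ \<xi>. ennreal ((cmod (fourier_trunc R u \<xi> - g \<xi>))\<^sup>2) \<partial>lborel) \<longlongrightarrow> 0) at_top)"

abbreviation fourier_real :: "(real \<Rightarrow> real) \<Rightarrow> real \<Rightarrow> complex" where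
  "fourier_real u \<equiv> fourier (\<lambda>x. complex_of_real (u x))"

subsection \<open>Forms, associated semigroups, Mosco convergence\<close>

text \<open>A form is given by its bilinear functional (relevant only on the domain) and its domain.\<close>

type_synonym l2_form = "((real \<Rightarrow> real) \<Rightarrow> (real \<Rightarrow> real) \<Rightarrow> real) \<times> (real \<Rightarrow> real) set"

definition extended_form :: "l2_form \<Rightarrow> (real \<Rightarrow> real) \<Rightarrow> ereal" where
  "extended_form \<E> u = (if u \<in> snd \<E> then ereal (fst \<E> u u) else \<infinity>)"

definition mosco_converges :: "(nat \<Rightarrow> l2_form) \<Rightarrow> l2_form \<Rightarrow> bool" where
  "mosco_converges \<E>n \<E> \<longleftrightarrow>
     (\<forall>u\<in>L2. \<forall>w. (\<forall>n. w n \<in> L2) \<and> l2_weak_tendsto w u sequentially \<longrightarrow>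
        extended_form \<E> u \<le> liminf (\<lambda>n. extended_form (\<E>n n) (w n))) \<and>
     (\<forall>u\<in>L2. \<exists>w. (\<forall>n. w n \<in> L2) \<and> l2_tendsto w u sequentially \<and>
        limsup (\<lambda>n. extended_form (\<E>n n) (w n)) \<le> extended_form \<E> u)"

type_synonym l2_semigroup = "real \<Rightarrow> (real \<Rightarrow> real) \<Rightarrow> (real \<Rightarrow> real)"

definition symmetric_contraction_semigroup :: "l2_semigroup \<Rightarrow> bool" where
  "symmetric_contraction_semigroup T \<longleftrightarrow>
     (\<forall>t>0. \<forall>u\<in>L2. T t u \<in> L2) \<and>
     (\<forall>t>0. \<forall>u\<in>L2. \<forall>v\<in>L2. \<forall>a b.
        AE x in lborel. T t (\<lambda>y. a * u y + b * v y) x = a * T t u x + b * T t v x) \<and>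
     (\<forall>t>0. \<forall>u\<in>L2. \<forall>v\<in>L2. l2_inner (T t u) v = l2_inner u (T t v)) \<and>
     (\<forall>t>0. \<forall>u\<in>L2. l2_norm (T t u) \<le> l2_norm u) \<and>
     (\<forall>s>0. \<forall>t>0. \<forall>u\<in>L2. AE x in lborel. T s (T t u) x = T (s + t) u x) \<and>
     (\<forall>u\<in>L2. l2_tendsto (\<lambda>t. T t u) u (at_right 0))"

text \<open>\<open>generator_graph T u w\<close>: \<open>u\<close> is in the domain of the infinitesimal generator \<open>A\<close> of \<open>T\<close>, and \<open>A u = w\<close>.\<close>

definition generator_graph :: "l2_semigroup \<Rightarrow> (real \<Rightarrow> real) \<Rightarrow> (real \<Rightarrow> real) \<Rightarrow> bool" where
  "generator_graph T u w \<longleftrightarrow>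
     u \<in> L2 \<and> w \<in> L2 \<and> l2_tendsto (\<lambda>t x. (T t u x - u x) / t) w (at_right 0)"

text \<open>
  The standard correspondence between closed forms and semigroups: \<open>D(A) \<subseteq> \<F>\<close> and
  \<open>\<E>(u, v) = (-A u, v)\<close> for \<open>u \<in> D(A)\<close>, \<open>v \<in> \<F>\<close>. For a densely defined closed form
  exactly one semigroup (up to a.e. equality) has this property.
\<close>

definition associated_semigroup :: "l2_form \<Rightarrow> l2_semigroup \<Rightarrow> bool" where
  "associated_semigroup \<E> T \<longleftrightarrow>
     symmetric_contraction_semigroup T \<and>
     (\<forall>u w. generator_graph T u w \<longrightarrow>
        u \<in> snd \<E> \<and> (\<forall>v\<in>snd \<E>. fst \<E> u v = - l2_inner w v))"

subsection \<open>Transience and recurrence\<close>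

text \<open>
  The extension of a Markovian semigroup to nonnegative \<open>f \<in> L\<^sup>1\<close>: the functions \<open>min f k\<close> lie in
  \<open>L\<^sup>1 \<inter> L\<^sup>2\<close> and increase to \<open>f\<close>, and their images increase a.e.
\<close>

definition semigroup_L1 :: "l2_semigroup \<Rightarrow> real \<Rightarrow> (real \<Rightarrow> real) \<Rightarrow> real \<Rightarrow> ennreal" where
  "semigroup_L1 T t f x = (SUP k::nat. ennreal (T t (\<lambda>y. min (f y) (real k)) x))"

text \<open>
  \<open>is_green T f g\<close>: \<open>g\<close> is a version of \<open>G f = \<integral>\<^sub>0\<^sup>\<infinity> T\<^sub>t f dt\<close>. Each \<open>T\<^sub>t f\<close> is only an a.e. class, so the
  integral is taken over a jointly measurable version of \<open>(t, x) \<mapsto> T\<^sub>t f(x)\<close>; by Fubini the result does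
  not depend, up to null sets, on the version.
\<close>

definition is_green :: "l2_semigroup \<Rightarrow> (real \<Rightarrow> real) \<Rightarrow> (real \<Rightarrow> ennreal) \<Rightarrow> bool" where
  "is_green T f g \<longleftrightarrow>
     (\<exists>p \<in> borel_measurable (lborel \<Otimes>\<^sub>M lborel).
        (\<forall>t>0. AE x in lborel. p (t, x) = semigroup_L1 T t f x) \<and>
        (\<forall>x. g x = (\<integral>\<^sup>+ t \<in> {0<..}. p (t, x) \<partial>lborel)))"

text \<open>
  Since the associated semigroup and the versions of \<open>G f\<close> are unique up to a.e. equality, the
  existential quantifiers below only introduce these objects (and ensure that they exist).
\<close>

definition transient_form :: "l2_form \<Rightarrow> bool" where
  "transient_form \<E> \<longleftrightarrow>
     (\<exists>T. associated_semigroup \<E> T \<and>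
       (\<forall>f. integrable lborel f \<and> (\<forall>x. 0 \<le> f x) \<longrightarrow>
          (\<exists>g. is_green T f g \<and> (AE x in lborel. g x < \<infinity>))))"

definition recurrent_form :: "l2_form \<Rightarrow> bool" where
  "recurrent_form \<E> \<longleftrightarrow>
     (\<exists>T. associated_semigroup \<E> T \<and>
       (\<forall>f. integrable lborel f \<and> (\<forall>x. 0 \<le> f x) \<longrightarrow>
          (\<exists>g. is_green T f g \<and> (AE x in lborel. g x = 0 \<or> g x = \<infinity>))))"

subsection \<open>Translation invariant forms\<close>

definition levy_measure :: "(real \<Rightarrow> real) \<Rightarrow> real measure" where
  "levy_measure \<alpha> = density lborel (\<lambda>x. ennreal (\<bar>x\<bar> powr (-1 - \<alpha> \<bar>x\<bar>)))"

definition char_exponent :: "real measure \<Rightarrow> real \<Rightarrow> real" where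
  "char_exponent \<nu> x = (LINT \<xi>|\<nu>. 1 - cos (x * \<xi>))"

text \<open>
  For real \<open>u\<close>, \<open>v\<close> and even \<open>\<phi>\<close> the integral defining the form is real (the transforms are
  Hermitian symmetric), so \<open>Re\<close> is only a type conversion.
\<close>

definition translation_invariant_form :: "(real \<Rightarrow> real) \<Rightarrow> l2_form" where
  "translation_invariant_form \<phi> =
     (\<lambda>u v. Re (LINT x|lborel. fourier_real u x * cnj (fourier_real v x) * of_real (\<phi> x)),
      {u \<in> L2. (\<integral>\<^sup>+ x. ennreal ((cmod (fourier_real u x))\<^sup>2 * \<phi> x) \<partial>lborel) < \<infinity>})"

definition stable_like_form :: "(real \<Rightarrow> real) \<Rightarrow> l2_form" where
  "stable_like_form \<alpha> = translation_invariant_form (char_exponent (levy_measure \<alpha>))"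

end

theory Submission
  imports Defs "HOL-Probability.Probability" "HOL-Real_Asymp.Real_Asymp"
begin

text \<open>
  On the Fourier side the form is multiplication by \<open>\<phi>\<close> and the semigroup is multiplication by
  \<open>exp (- t * \<phi>)\<close>, so everything is read off the exponents. If \<open>\<phi>n \<rightarrow> \<phi>\<close> pointwise and \<open>\<phi> > 0\<close> almost
  everywhere, the forms converge in the sense of Mosco: the multipliers \<open>min 1 (sqrt (\<phi> / \<phi>n))\<close>
  give recovery sequences, and the lower bound follows from weak lower semicontinuity for the bounded
  multipliers \<open>min (INF n\<in>{N..}. \<phi>n) N\<close> and Fatou's lemma. The exponents converge pointwise by dominated
  convergence.

  Transience and recurrence are decided by the convergence of the integral of \<open>1 / \<phi>\<close> at \<open>0\<close> (the
  criterion of Chung and Fuchs), hence by the tail \<open>x powr (- 2) * x powr (1 - \<alpha> x)\<close> of the Levy density.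
  If \<open>x powr (1 - \<alpha> x)\<close> stays bounded, then \<open>\<phi> \<xi> = O(\<bar>\<xi>\<bar>)\<close> and the form is recurrent. If it grows at
  least like \<open>(ln x)\<^sup>2\<close>, then \<open>1 / \<phi> \<xi> = O(1 / (\<bar>\<xi>\<bar> * (ln \<bar>\<xi>\<bar>)\<^sup>2))\<close> is integrable at \<open>0\<close> and the form is
  transient.
\<close>

subsection \<open>Complex square integrable functions\<close>

text \<open>The threshold lies at the power 1 of the logarithm: with
  \<open>L = ln (x + (exp 1)\<^sup>2)\<close> the factor \<open>x powr (L powr (- \<beta>))\<close>
  is about \<open>exp ((ln x) powr (1 - \<beta>))\<close>. For \<beta> < 1 it outgrows every power
  of \<open>ln x\<close>, for \<beta> = 1 it is at most \<open>exp 1\<close>, and adding 1/n to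
  \<alpha> sends it to 0; so recurrence and transience can switch in the limit although the
  exponents converge. Form and semigroup are read off \<phi>, but transience and recurrence concern
  the semigroup on nonnegative integrable functions, reached through increasing truncations. This
  asks for positivity of the semigroup, which is invisible in the multiplier
  \<open>exp (- t * \<phi> \<xi>)\<close>. It is obtained from translations and passes to a heat
  kernel that is defined at every point, jointly measurable and nonnegative, so that Tonelli's
  theorem applies to the Green potential. The kernel exists because \<alpha> is bounded away from 0,
  which makes \<phi> grow at least like a power at infinity. As \<open>fourier\<close> is a choice
  of an L2 limit, its identities hold almost everywhere only.\<close>

definition sqint :: "(real \<Rightarrow> complex) \<Rightarrow> bool" where
  "sqint u \<longleftrightarrow> u \<in> borel_measurable borel \<and> integrable lborel (\<lambda>x. (cmod (u x))\<^sup>2)"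

definition cinner :: "(real \<Rightarrow> complex) \<Rightarrow> (real \<Rightarrow> complex) \<Rightarrow> complex" where
  "cinner u v = (LINT x|lborel. u x * cnj (v x))"

text \<open>This is the square of the L2 norm. The Bochner integral is 0 on non-integrable
  functions, so it carries information only together with \<open>sqint\<close>.\<close>

definition sqnorm :: "(real \<Rightarrow> complex) \<Rightarrow> real" where
  "sqnorm u = (LINT x|lborel. (cmod (u x))\<^sup>2)"

lemma borel_measurable_cnj [measurable (raw)]:
  "f \<in> borel_measurable M \<Longrightarrow> (\<lambda>x. cnj (f x)) \<in> borel_measurable M"
  using measurable_compose[of f M borel cnj borel]
    borel_measurable_continuous_onI[OF continuous_on_cnj[OF continuous_on_id]] by simp

lemma sqint_meas: "sqint u \<Longrightarrow> u \<in> borel_measurable borel"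
  by (simp add: sqint_def)

lemma sqint_integrable: "sqint u \<Longrightarrow> integrable lborel (\<lambda>x. (cmod (u x))\<^sup>2)"
  by (simp add: sqint_def)

lemma sqint_bound:
  assumes "sqint u" "v \<in> borel_measurable borel" "AE x in lborel. cmod (v x) \<le> C * cmod (u x)"
  shows "sqint v"
proof -
  have "integrable lborel (\<lambda>x. C\<^sup>2 * (cmod (u x))\<^sup>2)"
    using sqint_integrable[OF assms(1)] by simp
  then have "integrable lborel (\<lambda>x. (cmod (v x))\<^sup>2)"
  proof (rule Bochner_Integration.integrable_bound)
    show "AE x in lborel. norm ((cmod (v x))\<^sup>2) \<le> norm (C\<^sup>2 * (cmod (u x))\<^sup>2)"
      using assms(3) by eventually_elim (auto simp: power_mult_distrib[symmetric] intro: power_mono)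
  qed (use assms in simp)
  with assms show ?thesis by (simp add: sqint_def)
qed

lemma sqint_add: assumes "sqint u" "sqint v" shows "sqint (\<lambda>x. u x + v x)"
proof -
  have "integrable lborel (\<lambda>x. 2 * (cmod (u x))\<^sup>2 + 2 * (cmod (v x))\<^sup>2)"
    using assms[THEN sqint_integrable] by simp
  then have "integrable lborel (\<lambda>x. (cmod (u x + v x))\<^sup>2)"
  proof (rule Bochner_Integration.integrable_bound)
    have "(cmod (u x + v x))\<^sup>2 \<le> 2 * (cmod (u x))\<^sup>2 + 2 * (cmod (v x))\<^sup>2" for x
    proof -
      have "(cmod (u x + v x))\<^sup>2 \<le> (cmod (u x) + cmod (v x))\<^sup>2"
        by (intro power_mono norm_triangle_ineq) simp
      also have "\<dots> \<le> 2 * (cmod (u x))\<^sup>2 + 2 * (cmod (v x))\<^sup>2"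
        using sum_squares_bound[of "cmod (u x)" "cmod (v x)"] by (simp add: power2_sum)
      finally show ?thesis .
    qed
    then show "AE x in lborel. norm ((cmod (u x + v x))\<^sup>2) \<le> norm (2 * (cmod (u x))\<^sup>2 + 2 * (cmod (v x))\<^sup>2)"
      by auto
  qed (use assms[THEN sqint_meas] in measurable)
  then show ?thesis using assms[THEN sqint_meas] by (simp add: sqint_def)
qed

lemma sqint_mult_bounded:
  assumes "sqint u" "m \<in> borel_measurable borel" "\<And>x. cmod (m x) \<le> C"
  shows "sqint (\<lambda>x. m x * u x)"
  by (rule sqint_bound[OF assms(1), where C=C])
     (use assms sqint_meas[OF assms(1)] in \<open>auto simp: norm_mult intro!: mult_right_mono\<close>)

lemma sqint_cmult: "sqint u \<Longrightarrow> sqint (\<lambda>x. c * u x)"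
  using sqint_mult_bounded[of u "\<lambda>_. c" "cmod c"] by simp

lemma sqint_diff: "sqint u \<Longrightarrow> sqint v \<Longrightarrow> sqint (\<lambda>x. u x - v x)"
  using sqint_add[of u "\<lambda>x. -1 * v x"] sqint_cmult[of v "-1"] by simp

lemma sqint_cnj: "sqint u \<Longrightarrow> sqint (\<lambda>x. cnj (u x))"
  by (simp add: sqint_def borel_measurable_cnj)

lemma sqint_reflect: "sqint u \<Longrightarrow> sqint (\<lambda>x. u (- x))"
  using lborel_integrable_real_affine[of "\<lambda>x. (cmod (u x))\<^sup>2" "-1" 0]
    measurable_compose[of uminus borel borel u borel] by (simp add: sqint_def)

lemma sqint_translate: "sqint u \<Longrightarrow> sqint (\<lambda>x. u (a + x))"
  using lborel_integrable_real_affine[of "\<lambda>x. (cmod (u x))\<^sup>2" 1 a]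
    measurable_compose[of "(+) a" borel borel u borel] by (simp add: sqint_def)

lemma sqint_zero: "sqint (\<lambda>x. 0)" by (simp add: sqint_def)

lemma sqint_of_real: "u \<in> L2 \<longleftrightarrow> sqint (\<lambda>x. of_real (u x))"
proof -
  have "u \<in> borel_measurable borel" if "(\<lambda>x. complex_of_real (u x)) \<in> borel_measurable borel"
    using measurable_compose[OF that, of Re borel] by simp
  moreover have "(\<lambda>x. complex_of_real (u x)) \<in> borel_measurable borel" if "u \<in> borel_measurable borel"
    using that by measurable
  ultimately have "(\<lambda>x. complex_of_real (u x)) \<in> borel_measurable borel \<longleftrightarrow> u \<in> borel_measurable borel"
    by blast
  then show ?thesis unfolding sqint_def L2_def norm_of_real power2_abs measurable_lborel2 by simp
qed

lemma sqint_cong_AE: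
  assumes "sqint u" "v \<in> borel_measurable borel" "AE x in lborel. u x = v x"
  shows "sqint v"
  by (rule sqint_bound[OF assms(1), where C=1]) (use assms in auto)

lemma sqint_mult_integrable:
  assumes "sqint u" "sqint v"
  shows "integrable lborel (\<lambda>x. u x * v x)"
proof -
  have "integrable lborel (\<lambda>x. (cmod (u x))\<^sup>2 + (cmod (v x))\<^sup>2)"
    using assms[THEN sqint_integrable] by simp
  then show ?thesis
  proof (rule Bochner_Integration.integrable_bound)
    have "cmod (u x * v x) \<le> (cmod (u x))\<^sup>2 + (cmod (v x))\<^sup>2" for x
    proof -
      have "0 \<le> cmod (u x) * cmod (v x)" by simp
      then show ?thesis
        using sum_squares_bound[of "cmod (u x)" "cmod (v x)"] unfolding norm_mult by linarith
    qed
    then show "AE x in lborel. norm (u x * v x) \<le> norm ((cmod (u x))\<^sup>2 + (cmod (v x))\<^sup>2)"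
      by (auto intro: order_trans)
  qed (use assms[THEN sqint_meas] in measurable)
qed

lemma cinner_integrable: "sqint u \<Longrightarrow> sqint v \<Longrightarrow> integrable lborel (\<lambda>x. u x * cnj (v x))"
  by (intro sqint_mult_integrable sqint_cnj)

lemma sqnorm_nonneg: "0 \<le> sqnorm u" by (simp add: sqnorm_def)

lemma cinner_self: "cinner u u = of_real (sqnorm u)"
  unfolding cinner_def sqnorm_def complex_norm_square[symmetric] integral_complex_of_real by simp

lemma cinner_add_left: "sqint u \<Longrightarrow> sqint v \<Longrightarrow> sqint w \<Longrightarrow> cinner (\<lambda>x. u x + v x) w = cinner u w + cinner v w"
  unfolding cinner_def by (simp add: distrib_right cinner_integrable)

lemma cinner_add_right: "sqint u \<Longrightarrow> sqint v \<Longrightarrow> sqint w \<Longrightarrow> cinner w (\<lambda>x. u x + v x) = cinner w u + cinner w v"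
  unfolding cinner_def by (simp add: distrib_left cinner_integrable)

lemma cinner_diff_left: "sqint u \<Longrightarrow> sqint v \<Longrightarrow> sqint w \<Longrightarrow> cinner (\<lambda>x. u x - v x) w = cinner u w - cinner v w"
  unfolding cinner_def by (simp add: left_diff_distrib cinner_integrable)

lemma cinner_diff_right: "sqint u \<Longrightarrow> sqint v \<Longrightarrow> sqint w \<Longrightarrow> cinner w (\<lambda>x. u x - v x) = cinner w u - cinner w v"
  unfolding cinner_def by (simp add: right_diff_distrib cinner_integrable)

lemma cinner_cmult_left: "cinner (\<lambda>x. c * u x) w = c * cinner u w"
  unfolding cinner_def by (simp add: mult.assoc)

lemma cinner_cmult_right: "cinner w (\<lambda>x. c * u x) = cnj c * cinner w u"
  unfolding cinner_def by (simp add: mult.left_commute)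

lemma cinner_commute: "cinner u v = cnj (cinner v u)"
  unfolding cinner_def by (subst Bochner_Integration.integral_cnj[symmetric]) (simp add: mult.commute)

lemma sqnorm_cong_AE:
  assumes "sqint u" "sqint v" "AE x in lborel. u x = v x"
  shows "sqnorm u = sqnorm v"
  unfolding sqnorm_def using assms(3) assms(1,2)[THEN sqint_meas] by (intro integral_cong_AE) auto

lemma cinner_cong_AE:
  assumes "sqint u" "sqint v" "sqint u'" "sqint v'" "AE x in lborel. u x = u' x" "AE x in lborel. v x = v' x"
  shows "cinner u v = cinner u' v'"
  unfolding cinner_def using assms(5,6) assms(1-4)[THEN sqint_meas] by (intro integral_cong_AE) auto

lemma sqnorm_zero_iff: "sqint u \<Longrightarrow> sqnorm u = 0 \<longleftrightarrow> (AE x in lborel. u x = 0)"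
  unfolding sqnorm_def by (subst integral_nonneg_eq_0_iff_AE) (auto simp: sqint_integrable)

lemma sqnorm_cmult: "sqnorm (\<lambda>x. c * u x) = (cmod c)\<^sup>2 * sqnorm u"
  unfolding sqnorm_def by (simp add: norm_mult power_mult_distrib)

lemma sqnorm_mono:
  assumes "sqint u" "sqint v" "\<And>x. cmod (u x) \<le> cmod (v x)" shows "sqnorm u \<le> sqnorm v"
  unfolding sqnorm_def using assms by (intro integral_mono sqint_integrable power_mono) auto

lemma nn_integral_sqnorm: "sqint u \<Longrightarrow> (\<integral>\<^sup>+ x. ennreal ((cmod (u x))\<^sup>2) \<partial>lborel) = ennreal (sqnorm u)"
  unfolding sqnorm_def by (intro nn_integral_eq_integral sqint_integrable) auto

lemma sqnorm_add:
  assumes "sqint u" "sqint v"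
  shows "sqnorm (\<lambda>x. u x + v x) = sqnorm u + 2 * Re (cinner u v) + sqnorm v"
proof -
  have "complex_of_real (sqnorm (\<lambda>x. u x + v x)) = of_real (sqnorm u) + (cinner u v + cnj (cinner u v)) + of_real (sqnorm v)"
    unfolding cinner_self[symmetric] cinner_commute[of u v, symmetric]
    using assms by (simp add: cinner_add_left cinner_add_right sqint_add flip: cinner_commute)
  then have "Re (complex_of_real (sqnorm (\<lambda>x. u x + v x))) = Re (of_real (sqnorm u) + (cinner u v + cnj (cinner u v)) + of_real (sqnorm v))"
    by simp
  then show ?thesis by simp
qed

lemma Cauchy_Schwarz_cinner:
  assumes u: "sqint u" and v: "sqint v"
  shows "cmod (cinner u v) \<le> sqrt (sqnorm u) * sqrt (sqnorm v)"
proof -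
  have "(cmod (cinner u v))\<^sup>2 \<le> sqnorm u * sqnorm v"
  proof (cases "sqnorm v = 0")
    case True
    then have "AE x in lborel. v x = 0" using v by (simp add: sqnorm_zero_iff)
    then have "cinner u v = cinner u (\<lambda>_. 0)" by (intro cinner_cong_AE u v sqint_zero) auto
    then show ?thesis using True by (simp add: cinner_def)
  next
    case False
    with sqnorm_nonneg[of v] have q: "sqnorm v > 0" by simp
    \<comment> \<open>This \<open>c\<close> minimises the squared norm of u + c v; it is minus the
      coefficient of the orthogonal projection of \<open>u\<close> onto \<open>v\<close>.\<close>
    define c where "c = - cinner u v / of_real (sqnorm v)"
    have "0 \<le> sqnorm (\<lambda>x. u x + c * v x)" by (rule sqnorm_nonneg)
    also have "\<dots> = sqnorm u + 2 * Re (cnj c * cinner u v) + (cmod c)\<^sup>2 * sqnorm v"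
      using u v by (simp add: sqnorm_add sqint_cmult cinner_cmult_right sqnorm_cmult)
    also have "cnj c * cinner u v = - of_real ((cmod (cinner u v))\<^sup>2 / sqnorm v)"
      unfolding c_def by (simp add: complex_norm_square mult.commute del: of_real_power)
    also have "(cmod c)\<^sup>2 * sqnorm v = (cmod (cinner u v))\<^sup>2 / sqnorm v"
      using q by (simp add: c_def norm_divide power_divide power2_eq_square)
    finally show ?thesis using q by (simp add: field_simps)
  qed
  then show ?thesis
    by (metis real_sqrt_mult real_le_rsqrt)
qed

lemma Minkowski_sqnorm:
  assumes u: "sqint u" and v: "sqint v"
  shows "sqrt (sqnorm (\<lambda>x. u x + v x)) \<le> sqrt (sqnorm u) + sqrt (sqnorm v)"
proof (rule real_le_lsqrt)
  have "sqnorm (\<lambda>x. u x + v x) \<le> sqnorm u + 2 * (sqrt (sqnorm u) * sqrt (sqnorm v)) + sqnorm v"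
    using Cauchy_Schwarz_cinner[OF u v] complex_Re_le_cmod[of "cinner u v"] by (simp add: sqnorm_add u v)
  also have "\<dots> = (sqrt (sqnorm u) + sqrt (sqnorm v))\<^sup>2"
    by (simp add: power2_sum sqnorm_nonneg)
  finally show "sqnorm (\<lambda>x. u x + v x) \<le> (sqrt (sqnorm u) + sqrt (sqnorm v))\<^sup>2" .
qed (auto simp: sqnorm_nonneg)

lemma sqnorm_minus_commute: "sqnorm (\<lambda>x. u x - v x) = sqnorm (\<lambda>x. v x - u x)"
  by (simp add: sqnorm_def norm_minus_commute)

lemma sqnorm_triangle:
  assumes "sqint u" "sqint v" "sqint w"
  shows "sqrt (sqnorm (\<lambda>x. u x - w x)) \<le> sqrt (sqnorm (\<lambda>x. u x - v x)) + sqrt (sqnorm (\<lambda>x. v x - w x))"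
  using Minkowski_sqnorm[OF sqint_diff[OF assms(1,2)] sqint_diff[OF assms(2,3)]] by simp

section \<open>Convergence in L2, Fatou's lemma and completeness\<close>

definition l2conv :: "('i \<Rightarrow> real \<Rightarrow> complex) \<Rightarrow> (real \<Rightarrow> complex) \<Rightarrow> 'i filter \<Rightarrow> bool" where
  "l2conv s u F \<longleftrightarrow> ((\<lambda>k. sqnorm (\<lambda>x. s k x - u x)) \<longlongrightarrow> 0) F"

lemma l2conv_sqrt: "l2conv s u F \<longleftrightarrow> ((\<lambda>k. sqrt (sqnorm (\<lambda>x. s k x - u x))) \<longlongrightarrow> 0) F"
proof
  assume "((\<lambda>k. sqrt (sqnorm (\<lambda>x. s k x - u x))) \<longlongrightarrow> 0) F"
  then have "((\<lambda>k. (sqrt (sqnorm (\<lambda>x. s k x - u x)))\<^sup>2) \<longlongrightarrow> 0\<^sup>2) F"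
    by (rule tendsto_power)
  then show "l2conv s u F" by (simp add: l2conv_def sqnorm_nonneg)
qed (use tendsto_real_sqrt[of _ 0] in \<open>force simp: l2conv_def\<close>)

lemma cinner_l2conv:
  assumes s: "l2conv s u F" and t: "l2conv t v F"
    and sq: "\<And>k. sqint (s k)" "\<And>k. sqint (t k)" "sqint u" "sqint v"
  shows "((\<lambda>k. cinner (s k) (t k)) \<longlongrightarrow> cinner u v) F"
proof -
  let ?a = "\<lambda>k. sqrt (sqnorm (\<lambda>x. s k x - u x))" and ?b = "\<lambda>k. sqrt (sqnorm (\<lambda>x. t k x - v x))"
  have ab: "(?a \<longlongrightarrow> 0) F" "(?b \<longlongrightarrow> 0) F" using s t by (simp_all add: l2conv_sqrt)
  have "((\<lambda>k. cinner (s k) (t k) - cinner u v) \<longlongrightarrow> 0) F"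
  proof (rule Lim_null_comparison)
    have "cinner (s k) (t k) - cinner u v = cinner (\<lambda>x. s k x - u x) (\<lambda>x. t k x - v x)
        + cinner (\<lambda>x. s k x - u x) v + cinner u (\<lambda>x. t k x - v x)" for k
      by (simp add: cinner_diff_left cinner_diff_right sq sqint_diff)
    then have "norm (cinner (s k) (t k) - cinner u v) \<le> ?a k * ?b k + ?a k * sqrt (sqnorm v) + sqrt (sqnorm u) * ?b k" for k
      by (simp only:) (intro norm_triangle_le add_mono Cauchy_Schwarz_cinner sq sqint_diff)
    then show "\<forall>\<^sub>F k in F. norm (cinner (s k) (t k) - cinner u v) \<le> ?a k * ?b k + ?a k * sqrt (sqnorm v) + sqrt (sqnorm u) * ?b k"
      by simp
    show "((\<lambda>k. ?a k * ?b k + ?a k * sqrt (sqnorm v) + sqrt (sqnorm u) * ?b k) \<longlongrightarrow> 0) F"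
      using tendsto_add[OF tendsto_add[OF tendsto_mult[OF ab] tendsto_mult[OF ab(1) tendsto_const]]
          tendsto_mult[OF tendsto_const ab(2)], of "sqrt (sqnorm v)" "sqrt (sqnorm u)"] by simp
  qed
  then show ?thesis by (simp add: LIM_zero_iff)
qed

lemma l2conv_cmult: "l2conv s u F \<Longrightarrow> l2conv (\<lambda>k x. c * s k x) (\<lambda>x. c * u x) F"
proof -
  assume "l2conv s u F"
  then have "((\<lambda>k. (cmod c)\<^sup>2 * sqnorm (\<lambda>x. s k x - u x)) \<longlongrightarrow> (cmod c)\<^sup>2 * 0) F"
    unfolding l2conv_def by (intro tendsto_intros)
  then show ?thesis by (simp add: l2conv_def right_diff_distrib[symmetric] sqnorm_cmult)
qed

lemma l2conv_add:
  assumes "l2conv s u F" "l2conv t v F" and sq: "\<And>k. sqint (s k)" "\<And>k. sqint (t k)" "sqint u" "sqint v"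
  shows "l2conv (\<lambda>k x. s k x + t k x) (\<lambda>x. u x + v x) F"
proof -
  have "((\<lambda>k. sqrt (sqnorm (\<lambda>x. s k x - u x)) + sqrt (sqnorm (\<lambda>x. t k x - v x))) \<longlongrightarrow> 0) F"
    using tendsto_add[OF assms(1,2)[unfolded l2conv_sqrt]] by simp
  then show ?thesis unfolding l2conv_sqrt
  proof (rule Lim_null_comparison[rotated])
    have "sqrt (sqnorm (\<lambda>x. s k x + t k x - (u x + v x))) \<le> sqrt (sqnorm (\<lambda>x. s k x - u x)) + sqrt (sqnorm (\<lambda>x. t k x - v x))" for k
      using Minkowski_sqnorm[OF sqint_diff[OF sq(1,3)] sqint_diff[OF sq(2,4)], of k k]
      by (simp add: algebra_simps)
    then show "\<forall>\<^sub>F k in F. norm (sqrt (sqnorm (\<lambda>x. s k x + t k x - (u x + v x)))) \<le> sqrt (sqnorm (\<lambda>x. s k x - u x)) + sqrt (sqnorm (\<lambda>x. t k x - v x))"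
      by (simp add: sqnorm_nonneg)
  qed
qed

lemma l2conv_unique:
  assumes "l2conv s u F" "l2conv s v F" and sq: "\<And>k. sqint (s k)" "sqint u" "sqint v" and "F \<noteq> bot"
  shows "AE x in lborel. u x = v x"
proof -
  have "((\<lambda>k. sqrt (sqnorm (\<lambda>x. s k x - u x)) + sqrt (sqnorm (\<lambda>x. s k x - v x))) \<longlongrightarrow> 0) F"
    using tendsto_add[OF assms(1,2)[unfolded l2conv_sqrt]] by simp
  moreover have "sqrt (sqnorm (\<lambda>x. u x - v x)) \<le> sqrt (sqnorm (\<lambda>x. s k x - u x)) + sqrt (sqnorm (\<lambda>x. s k x - v x))" for k
    using sqnorm_triangle[OF sq(2) sq(1) sq(3), of k] sqnorm_minus_commute[of u "s k"] by simp
  ultimately have "sqrt (sqnorm (\<lambda>x. u x - v x)) \<le> 0"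
    using \<open>F \<noteq> bot\<close> by (intro tendsto_le[OF _ _ tendsto_const]) auto
  then have "sqnorm (\<lambda>x. u x - v x) = 0" using sqnorm_nonneg[of "\<lambda>x. u x - v x"] by simp
  then show ?thesis using sqnorm_zero_iff[OF sqint_diff[OF sq(2,3)]] by simp
qed

text \<open>Applied to differences, this identifies a pointwise limit with an L2 limit without
  extracting a subsequence. Membership is part of the conclusion because it too comes from the
  finite nonnegative integral, before \<open>sqnorm u\<close> has a meaning.\<close>

lemma Fatou_sqnorm:
  assumes s: "\<And>k. sqint (s k)" and C: "\<forall>\<^sub>F k in sequentially. sqnorm (s k) \<le> C" and [measurable]: "u \<in> borel_measurable borel"
    and lim: "AE x in lborel. (\<lambda>k. s k x) \<longlonglongrightarrow> u x"
  shows "sqint u \<and> sqnorm u \<le> C"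
proof -
  note [measurable] = sqint_meas[OF s]
  have "(\<integral>\<^sup>+ x. ennreal ((cmod (u x))\<^sup>2) \<partial>lborel) = (\<integral>\<^sup>+ x. liminf (\<lambda>k. ennreal ((cmod (s k x))\<^sup>2)) \<partial>lborel)"
  proof (rule nn_integral_cong_AE, use lim in eventually_elim)
    fix x assume "(\<lambda>k. s k x) \<longlonglongrightarrow> u x"
    then have "(\<lambda>k. ennreal ((cmod (s k x))\<^sup>2)) \<longlonglongrightarrow> ennreal ((cmod (u x))\<^sup>2)"
      by (intro tendsto_ennrealI tendsto_intros)
    from lim_imp_Liminf[OF _ this]
    show "ennreal ((cmod (u x))\<^sup>2) = liminf (\<lambda>k. ennreal ((cmod (s k x))\<^sup>2))"
      by simp
  qed
  also have "\<dots> \<le> liminf (\<lambda>k. \<integral>\<^sup>+ x. ennreal ((cmod (s k x))\<^sup>2) \<partial>lborel)"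
    by (intro nn_integral_liminf) measurable
  also have "\<dots> \<le> limsup (\<lambda>k. \<integral>\<^sup>+ x. ennreal ((cmod (s k x))\<^sup>2) \<partial>lborel)"
    by (intro Liminf_le_Limsup) simp
  also have "\<dots> \<le> ennreal C"
    by (rule Limsup_bounded, use C in eventually_elim) (simp add: nn_integral_sqnorm s ennreal_leI)
  finally have le: "(\<integral>\<^sup>+ x. ennreal ((cmod (u x))\<^sup>2) \<partial>lborel) \<le> ennreal C" .
  then have "sqint u"
    unfolding sqint_def by (auto intro!: integrableI_nonneg simp: order_le_less_trans)
  moreover from C obtain k where "sqnorm (s k) \<le> C"
    by (meson eventually_happens trivial_limit_sequentially)
  then have "C \<ge> 0" using sqnorm_nonneg[of "s k"] by linarith
  ultimately show ?thesis using le by (simp add: nn_integral_sqnorm)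
qed

text \<open>Riesz-Fischer: a rapidly Cauchy subsequence converges almost everywhere, and Fatou's
  lemma turns its pointwise limit into the L2 limit of the whole sequence.\<close>

lemma l2_complete:
  assumes s: "\<And>k::nat. sqint (s k)"
    and Cauchy: "\<And>e. e > 0 \<Longrightarrow> \<exists>N. \<forall>m\<ge>N. \<forall>n\<ge>N. sqrt (sqnorm (\<lambda>x. s m x - s n x)) < e"
  obtains u where "sqint u" "l2conv s u sequentially"
proof -
  have "\<forall>k. \<exists>N. \<forall>m\<ge>N. \<forall>n\<ge>N. sqrt (sqnorm (\<lambda>x. s m x - s n x)) < (1/2)^k"
    using Cauchy by simp
  then obtain N0 where N0: "\<And>k m n. N0 k \<le> m \<Longrightarrow> N0 k \<le> n \<Longrightarrow> sqrt (sqnorm (\<lambda>x. s m x - s n x)) < (1/2)^k"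
    by metis
  \<comment> \<open>Summing the thresholds gives monotone indices that lie above every earlier
    threshold.\<close>
  define r where "r k = (\<Sum>i\<le>k. N0 i)" for k
  have r_mono: "r j \<le> r k" if "j \<le> k" for j k
    unfolding r_def using that by (intro sum_mono2) auto
  have r_ge: "N0 j \<le> r k" if "j \<le> k" for j k
    unfolding r_def using that by (intro member_le_sum) auto
  define d where "d k x = cmod (s (r (Suc k)) x - s (r k) x)" for k x
  note [measurable] = sqint_meas[OF s]
  have [measurable]: "d k \<in> borel_measurable borel" for k unfolding d_def by measurable
  \<comment> \<open>The weight 2^k still leaves summable integrals and, by the arithmetic-geometric
    mean inequality, bounds \<open>d k x\<close> itself by (1/2)^k + 2^k (d k x)^2. Thus summability
    of weighted squares yields absolute convergence of the increments.\<close>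
  have d_int: "(\<integral>\<^sup>+ x. ennreal (2^k * (d k x)\<^sup>2) \<partial>lborel) \<le> ennreal ((1/2)^k)" for k
  proof -
    have "sqrt (sqnorm (\<lambda>x. s (r (Suc k)) x - s (r k) x)) < (1/2)^k"
      by (intro N0 r_ge) auto
    then have "sqnorm (\<lambda>x. s (r (Suc k)) x - s (r k) x) \<le> ((1/2)^k)\<^sup>2"
      by (metis less_imp_le sqrt_le_D)
    then have "2^k * sqnorm (\<lambda>x. s (r (Suc k)) x - s (r k) x) \<le> 2^k * ((1/2)^k)\<^sup>2"
      by (intro mult_left_mono) auto
    also have "\<dots> = (1/2)^k"
      by (simp add: power2_eq_square power_divide)
    finally have *: "2^k * sqnorm (\<lambda>x. s (r (Suc k)) x - s (r k) x) \<le> (1/2)^k" .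
    have "(\<integral>\<^sup>+ x. ennreal (2^k * (d k x)\<^sup>2) \<partial>lborel) = ennreal (2^k) * ennreal (sqnorm (\<lambda>x. s (r (Suc k)) x - s (r k) x))"
      unfolding d_def by (simp add: ennreal_mult nn_integral_cmult nn_integral_sqnorm[OF sqint_diff[OF s s]])
    then show ?thesis using * by (simp add: ennreal_mult[symmetric] sqnorm_nonneg ennreal_leI)
  qed
  have "AE x in lborel. (\<Sum>k. ennreal (2^k * (d k x)\<^sup>2)) \<noteq> \<infinity>"
  proof (rule nn_integral_PInf_AE)
    have "(\<integral>\<^sup>+ x. (\<Sum>k. ennreal (2^k * (d k x)\<^sup>2)) \<partial>lborel) = (\<Sum>k. \<integral>\<^sup>+ x. ennreal (2^k * (d k x)\<^sup>2) \<partial>lborel)"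
      by (intro nn_integral_suminf) measurable
    also have "\<dots> \<le> (\<Sum>k. ennreal ((1/2)^k))"
      by (intro suminf_le d_int) auto
    also have "\<dots> = ennreal (\<Sum>k. (1/2)^k)"
      by (intro suminf_ennreal2) (auto simp: summable_geometric)
    finally have "(\<integral>\<^sup>+ x. (\<Sum>k. ennreal (2^k * (d k x)\<^sup>2)) \<partial>lborel) \<le> ennreal (\<Sum>k. (1/2)^k)" .
    from order_le_less_trans[OF this ennreal_less_top]
    show "(\<integral>\<^sup>+ x. (\<Sum>k. ennreal (2^k * (d k x)\<^sup>2)) \<partial>lborel) \<noteq> \<infinity>"
      by simp
  qed measurable
  then have AEc: "AE x in lborel. convergent (\<lambda>k. s (r k) x)"
  proof eventually_elim
    fix x assume "(\<Sum>k. ennreal (2^k * (d k x)\<^sup>2)) \<noteq> \<infinity>"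
    then have 1: "summable (\<lambda>k. 2^k * (d k x)\<^sup>2)"
      by (intro summable_suminf_not_top) auto
    have 2: "summable (\<lambda>k. (1/2::real)^k + 2^k * (d k x)\<^sup>2)"
      by (intro summable_add 1 summable_geometric) auto
    have "summable (\<lambda>k. s (r (Suc k)) x - s (r k) x)"
    proof (rule summable_comparison_test'[OF 2])
      fix k
      have "2 * (sqrt ((1/2)^k)) * (sqrt (2^k) * d k x) \<le> (sqrt ((1/2)^k))\<^sup>2 + (sqrt (2^k) * d k x)\<^sup>2"
        by (rule sum_squares_bound)
      also have "sqrt ((1/2)^k) * (sqrt (2^k) * d k x) = d k x"
        by (simp add: real_sqrt_mult[symmetric] power_divide real_sqrt_divide flip: mult.assoc)
      then have "2 * sqrt ((1/2)^k) * (sqrt (2^k) * d k x) = 2 * d k x" by (simp only: mult.assoc)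
      finally have "2 * d k x \<le> (1/2)^k + 2^k * (d k x)\<^sup>2"
        by (simp add: power_mult_distrib)
      moreover have "0 \<le> d k x" by (simp add: d_def)
      ultimately have "d k x \<le> (1/2)^k + 2^k * (d k x)\<^sup>2" by linarith
      then show "norm (s (r (Suc k)) x - s (r k) x) \<le> (1/2)^k + 2^k * (d k x)\<^sup>2"
        by (simp add: d_def)
    qed
    then have "convergent (\<lambda>n. \<Sum>k<n. s (r (Suc k)) x - s (r k) x)"
      by (simp add: summable_iff_convergent)
    then have "convergent (\<lambda>n. s (r n) x - s (r 0) x)"
      by (simp only: sum_lessThan_telescope[of "\<lambda>n. s (r n) x"])
    then have "convergent (\<lambda>n. (s (r n) x - s (r 0) x) + s (r 0) x)"
      by (intro convergent_add convergent_const)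
    then show "convergent (\<lambda>k. s (r k) x)" by simp
  qed
  define u where "u x = lim (\<lambda>k. s (r k) x)" for x
  have [measurable]: "u \<in> borel_measurable borel"
    unfolding u_def by measurable
  have conv: "AE x in lborel. (\<lambda>k. s (r k) x) \<longlonglongrightarrow> u x"
    using AEc by eventually_elim (simp add: u_def convergent_LIMSEQ_iff)
  \<comment> \<open>Only the second index runs along the subsequence; \<open>m\<close> is arbitrary,
    so the estimate covers the full sequence.\<close>
  have close: "sqint (\<lambda>x. s m x - u x) \<and> sqnorm (\<lambda>x. s m x - u x) \<le> ((1/2)^j)\<^sup>2" if "m \<ge> r j" for m j
  proof (rule Fatou_sqnorm[where s="\<lambda>k x. s m x - s (r k) x"])
    show "\<forall>\<^sub>F k in sequentially. sqnorm (\<lambda>x. s m x - s (r k) x) \<le> ((1/2)^j)\<^sup>2"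
      unfolding eventually_sequentially
    proof (intro exI[of _ j] allI impI)
      fix k assume "j \<le> k"
      then have "sqrt (sqnorm (\<lambda>x. s m x - s (r k) x)) < (1/2)^j"
        using that r_ge[of j j] by (intro N0 r_ge) auto
      then show "sqnorm (\<lambda>x. s m x - s (r k) x) \<le> ((1/2)^j)\<^sup>2"
        by (metis less_imp_le sqrt_le_D)
    qed
    show "AE x in lborel. (\<lambda>k. s m x - s (r k) x) \<longlonglongrightarrow> s m x - u x"
      using conv by eventually_elim (intro tendsto_intros)
  qed (auto intro: sqint_diff s)
  have u: "sqint u"
    using sqint_diff[OF s conjunct1[OF close[OF order_refl]], of "r 0" 0] by simp
  have "l2conv s u sequentially"
    unfolding l2conv_sqrt
  proof (rule LIMSEQ_I)
    fix e :: real assume "e > 0"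
    then obtain j where j: "(1/2)^j < e"
      using real_arch_pow_inv[of e "1/2"] by auto
    show "\<exists>n0. \<forall>n\<ge>n0. norm (sqrt (sqnorm (\<lambda>x. s n x - u x)) - 0) < e"
    proof (intro exI allI impI)
      fix n assume "r j \<le> n"
      then have "sqnorm (\<lambda>x. s n x - u x) \<le> ((1/2)^j)\<^sup>2" using close by blast
      then have "sqrt (sqnorm (\<lambda>x. s n x - u x)) \<le> (1/2)^j"
        by (intro real_le_lsqrt) (auto simp: sqnorm_nonneg)
      then show "norm (sqrt (sqnorm (\<lambda>x. s n x - u x)) - 0) < e" using j by (simp add: sqnorm_nonneg)
    qed
  qed
  with u show thesis by (rule that)
qed

section \<open>Density of step functions among square integrable functions supported in a
  window\<close>

inductive_set stepf :: "real \<Rightarrow> (real \<Rightarrow> complex) set" for R where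
  zero: "(\<lambda>_. 0) \<in> stepf R"
| add: "s \<in> stepf R \<Longrightarrow> - R \<le> a \<Longrightarrow> a < b \<Longrightarrow> b \<le> R \<Longrightarrow> (\<lambda>x. s x + c * indicator {a<..b} x) \<in> stepf R"

lemma sqint_indicator:
  "A \<in> sets borel \<Longrightarrow> emeasure lborel A < \<infinity> \<Longrightarrow> sqint (indicator A)"
proof -
  assume A: "A \<in> sets borel" "emeasure lborel A < \<infinity>"
  have "(\<lambda>x. (cmod (indicator A x))\<^sup>2) = indicat_real A" by (auto simp: indicator_def)
  then show "sqint (indicator A)" using A unfolding sqint_def by simp
qed

lemma sqint_indicator_Ioc: "sqint (indicator {a<..b})"
  by (cases "a \<le> b") (auto intro!: sqint_indicator simp: sqint_zero)

lemma stepf_sqint: "s \<in> stepf R \<Longrightarrow> sqint s"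
  by (induction rule: stepf.induct) (intro sqint_zero sqint_add sqint_cmult sqint_indicator_Ioc; assumption)+

lemma stepf_support: "s \<in> stepf R \<Longrightarrow> x \<notin> {- R<..R} \<Longrightarrow> s x = 0"
  by (induction rule: stepf.induct) (auto simp: indicator_def)

lemma stepf_add: "s \<in> stepf R \<Longrightarrow> t \<in> stepf R \<Longrightarrow> (\<lambda>x. t x + s x) \<in> stepf R"
  by (induction rule: stepf.induct) (auto simp: add.assoc[symmetric] intro: stepf.add)

lemma stepf_cmult: "s \<in> stepf R \<Longrightarrow> (\<lambda>x. k * s x) \<in> stepf R"
proof (induction rule: stepf.induct)
  case (add s a b c)
  from stepf.add[OF add.IH add.hyps(2-4), of "k * c"] show ?case
    by (simp add: distrib_left mult.assoc)
qed (auto intro: stepf.zero)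

text \<open>The L2 closure of the step functions. Proving that it is a linear space closed under
  limits reduces density to indicators of Borel sets. The window is kept fixed because L2
  convergence implies L1 convergence only there.\<close>

definition step_closure :: "real \<Rightarrow> (real \<Rightarrow> complex) set" where
  "step_closure R = {u. sqint u \<and> (\<forall>e>0. \<exists>s\<in>stepf R. sqrt (sqnorm (\<lambda>x. u x - s x)) < e)}"

lemma step_closureE:
  assumes "u \<in> step_closure R" "e > 0"
  obtains s where "s \<in> stepf R" "sqrt (sqnorm (\<lambda>x. u x - s x)) < e"
  using assms unfolding step_closure_def by blast

lemma step_closureI_stepf: "s \<in> stepf R \<Longrightarrow> s \<in> step_closure R"
  unfolding step_closure_def by (auto simp: stepf_sqint sqnorm_def intro!: bexI[of _ s])

lemma step_closure_add:
  assumes "u \<in> step_closure R" "v \<in> step_closure R"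
  shows "(\<lambda>x. u x + v x) \<in> step_closure R"
  unfolding step_closure_def
proof (intro CollectI conjI allI impI)
  show "sqint (\<lambda>x. u x + v x)" using assms by (simp add: step_closure_def sqint_add)
  fix e :: real assume "e > 0"
  then have "e/2 > 0" by simp
  from step_closureE[OF assms(1) this] step_closureE[OF assms(2) this]
  obtain s t where st: "s \<in> stepf R" "sqrt (sqnorm (\<lambda>x. u x - s x)) < e/2"
      "t \<in> stepf R" "sqrt (sqnorm (\<lambda>x. v x - t x)) < e/2"
    by metis
  have "sqrt (sqnorm (\<lambda>x. u x + v x - (s x + t x))) \<le> sqrt (sqnorm (\<lambda>x. u x - s x)) + sqrt (sqnorm (\<lambda>x. v x - t x))"
    using Minkowski_sqnorm[of "\<lambda>x. u x - s x" "\<lambda>x. v x - t x"] assms st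
    by (simp add: step_closure_def sqint_diff stepf_sqint algebra_simps)
  also have "\<dots> < e" using st by simp
  finally show "\<exists>s\<in>stepf R. sqrt (sqnorm (\<lambda>x. u x + v x - s x)) < e"
    using stepf_add[OF st(3,1)] by (intro bexI[of _ "\<lambda>x. s x + t x"])
qed

lemma step_closure_cmult:
  assumes "u \<in> step_closure R" shows "(\<lambda>x. c * u x) \<in> step_closure R"
  unfolding step_closure_def
proof (intro CollectI conjI allI impI)
  show "sqint (\<lambda>x. c * u x)" using assms by (simp add: step_closure_def sqint_cmult)
  fix e :: real assume "e > 0"
  then have "e / (cmod c + 1) > 0" by (simp add: add_nonneg_pos)
  then obtain s where s: "s \<in> stepf R" "sqrt (sqnorm (\<lambda>x. u x - s x)) < e / (cmod c + 1)"
    using assms unfolding step_closure_def by blast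
  have "sqrt (sqnorm (\<lambda>x. c * u x - c * s x)) = cmod c * sqrt (sqnorm (\<lambda>x. u x - s x))"
    by (simp add: right_diff_distrib[symmetric] sqnorm_cmult real_sqrt_mult)
  also have "\<dots> \<le> (cmod c + 1) * sqrt (sqnorm (\<lambda>x. u x - s x))"
    by (intro mult_right_mono) (auto simp: sqnorm_nonneg)
  also have "\<dots> < e" using s(2) by (subst (asm) pos_less_divide_eq) (auto simp: mult.commute add_nonneg_pos)
  finally show "\<exists>s\<in>stepf R. sqrt (sqnorm (\<lambda>x. c * u x - s x)) < e"
    using stepf_cmult[OF s(1)] by (intro bexI[of _ "\<lambda>x. c * s x"])
qed

lemma step_closure_sum:
  "finite I \<Longrightarrow> (\<And>i. i \<in> I \<Longrightarrow> f i \<in> step_closure R) \<Longrightarrow> (\<lambda>x. \<Sum>i\<in>I. f i x) \<in> step_closure R"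
  by (induction rule: finite_induct) (auto intro: step_closure_add step_closureI_stepf stepf.zero)

lemma step_closure_limit:
  assumes "\<And>k. s k \<in> step_closure R" "l2conv s u sequentially" "sqint u"
  shows "u \<in> step_closure R"
  unfolding step_closure_def
proof (intro CollectI conjI allI impI assms)
  fix e :: real assume "e > 0"
  from order_tendstoD(2)[OF assms(2)[unfolded l2conv_sqrt], of "e/2"] \<open>e > 0\<close>
  obtain k where k: "sqrt (sqnorm (\<lambda>x. s k x - u x)) < e/2"
    by (auto simp: eventually_sequentially)
  from \<open>e > 0\<close> have "e/2 > 0" by simp
  from step_closureE[OF assms(1) this]
  obtain t where t: "t \<in> stepf R" "sqrt (sqnorm (\<lambda>x. s k x - t x)) < e/2" .
  have "sqrt (sqnorm (\<lambda>x. u x - t x)) \<le> sqrt (sqnorm (\<lambda>x. u x - s k x)) + sqrt (sqnorm (\<lambda>x. s k x - t x))"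
    using assms t stepf_sqint by (intro sqnorm_triangle) (auto simp: step_closure_def)
  also have "\<dots> < e" using k t by (simp add: sqnorm_minus_commute[of u])
  finally show "\<exists>s\<in>stepf R. sqrt (sqnorm (\<lambda>x. u x - s x)) < e" using t by blast
qed

lemma l2conv_dominated:
  assumes s: "\<And>k. s k \<in> borel_measurable borel" and u: "u \<in> borel_measurable borel" and w: "sqint w"
    and lim: "AE x in lborel. (\<lambda>k. s k x) \<longlonglongrightarrow> u x"
    and bound: "\<And>k. AE x in lborel. cmod (s k x - u x) \<le> cmod (w x)"
  shows "l2conv s u sequentially"
proof -
  note [measurable] = s u
  have "(\<lambda>k. LINT x|lborel. (cmod (s k x - u x))\<^sup>2) \<longlonglongrightarrow> (LINT x|(lborel::real measure). 0)"
  proof (rule integral_dominated_convergence)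
    show "integrable lborel (\<lambda>x. (cmod (w x))\<^sup>2)" by (rule sqint_integrable[OF w])
    show "AE x in lborel. (\<lambda>k. (cmod (s k x - u x))\<^sup>2) \<longlonglongrightarrow> 0"
      using lim
    proof eventually_elim
      fix x assume "(\<lambda>k. s k x) \<longlonglongrightarrow> u x"
      then have "(\<lambda>k. (cmod (s k x - u x))\<^sup>2) \<longlonglongrightarrow> (cmod (u x - u x))\<^sup>2"
        by (intro tendsto_intros)
      then show "(\<lambda>k. (cmod (s k x - u x))\<^sup>2) \<longlonglongrightarrow> 0" by simp
    qed
    show "AE x in lborel. norm ((cmod (s k x - u x))\<^sup>2) \<le> (cmod (w x))\<^sup>2" for k
      using bound[of k] by eventually_elim (auto intro: power_mono)
  qed measurable
  then show ?thesis by (simp add: l2conv_def sqnorm_def)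
qed

text \<open>Dynkin's argument: half-open intervals form an intersection-stable generator, and the
  sets with approximable trace on the window are closed under complements and disjoint unions.
  Intersecting with the window keeps all measures finite.\<close>

lemma step_closure_indicator:
  assumes "A \<in> sets borel"
  shows "(\<lambda>x. indicator (A \<inter> {- R<..R}) x) \<in> step_closure R"
proof -
  have fin: "emeasure lborel (A \<inter> {- R<..R}) < \<infinity>" if "A \<in> sets borel" for A
  proof -
    have "emeasure lborel (A \<inter> {- R<..R}) \<le> emeasure lborel {- \<bar>R\<bar>..\<bar>R\<bar>}"
      using that by (intro emeasure_mono) auto
    also have "\<dots> < \<infinity>" by simp
    finally show ?thesis .
  qed
  have sq: "sqint (indicator (A \<inter> {- R<..R}))" if "A \<in> sets borel" for A
    using fin that by (intro sqint_indicator) auto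
  have S: "sets borel = sigma_sets UNIV (range (\<lambda>(a, b). {a <.. b::real}))"
    by (simp add: borel_sigma_sets_Ioc)
  have Ioc: "indicator {a<..b} \<in> step_closure R" if "- R \<le> a" "b \<le> R" for a b
  proof (cases "a < b")
    case True
    show ?thesis using step_closureI_stepf[OF stepf.add[OF stepf.zero that(1) True that(2), of 1]] by simp
  next
    case False
    then have "indicator {a<..b} = (\<lambda>_. 0::complex)" by (auto simp: indicator_def)
    then show ?thesis by (simp add: step_closureI_stepf stepf.zero)
  qed
  have stable: "Int_stable (range (\<lambda>(a, b). {a <.. b::real}))"
  proof (rule Int_stableI)
    fix I J assume "I \<in> range (\<lambda>(a, b). {a <.. b::real})" "J \<in> range (\<lambda>(a, b). {a <.. b::real})"
    then obtain a b c d where "I = {a<..b}" "J = {c<..d}" by auto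
    then have "I \<inter> J = (\<lambda>(a, b). {a <.. b}) (max a c, min b d)" by auto
    then show "I \<inter> J \<in> range (\<lambda>(a, b). {a <.. b::real})" by blast
  qed
  have sub: "range (\<lambda>(a, b). {a <.. b::real}) \<subseteq> Pow UNIV" by simp
  show ?thesis
    using stable sub assms unfolding S
  proof (induction rule: sigma_sets_induct_disjoint)
    case (basic A)
    then obtain a b where "A = {a<..b}" by auto
    then have "A \<inter> {- R<..R} = {max a (- R)<..min b R}" by auto
    then show ?case using Ioc[of "max a (- R)" "min b R"] by simp
  next
    case empty
    show ?case by (simp add: step_closureI_stepf stepf.zero)
  next
    case (compl A)
    \<comment> \<open>The complement is taken relative to the window, where it is a difference of
      two approximable functions.\<close>
    have "(\<lambda>x. indicator {- R<..R} x + (-1) * indicator (A \<inter> {- R<..R}) x) \<in> step_closure R"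
      using compl by (intro step_closure_add step_closure_cmult Ioc) auto
    also have "(\<lambda>x. indicator {- R<..R} x + (-1) * indicator (A \<inter> {- R<..R}) x) = (\<lambda>x. indicator ((UNIV - A) \<inter> {- R<..R}) x :: complex)"
      by (auto simp: indicator_def fun_eq_iff)
    finally show ?case .
  next
    case (union A)
    have A: "A i \<in> sets borel" for i using union(2) unfolding S by auto
    have UA: "(\<Union>i. A i) \<in> sets borel" using A by auto
    show ?case
    proof (rule step_closure_limit[where s="\<lambda>k x. \<Sum>i<k. indicator (A i \<inter> {- R<..R}) x"])
      show "l2conv (\<lambda>k x. \<Sum>i<k. indicator (A i \<inter> {- R<..R}) x) (\<lambda>x. indicator ((\<Union>i. A i) \<inter> {- R<..R}) x) sequentially"
      proof (rule l2conv_dominated[where w="indicator ((\<Union>i. A i) \<inter> {- R<..R})"])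
        have eq: "(\<Sum>i<k. indicator (A i \<inter> {- R<..R}) x :: complex) = indicator ((\<Union>i<k. A i) \<inter> {- R<..R}) x" for k x
        proof -
          have "(\<Sum>i<k. indicator (A i \<inter> {- R<..R}) x :: complex) = indicator (\<Union>i<k. A i \<inter> {- R<..R}) x"
            using union(1) by (intro indicator_UN_disjoint[symmetric]) (auto simp: disjoint_family_on_def)
          then show ?thesis by (simp add: Int_UN_distrib2)
        qed
        show "AE x in lborel. (\<lambda>k. \<Sum>i<k. indicator (A i \<inter> {- R<..R}) x) \<longlonglongrightarrow> (indicator ((\<Union>i. A i) \<inter> {- R<..R}) x :: complex)"
        proof (rule AE_I2)
          fix x
          have "\<forall>\<^sub>F k in sequentially. indicator ((\<Union>i. A i) \<inter> {- R<..R}) x = (indicator ((\<Union>i<k. A i) \<inter> {- R<..R}) x :: complex)"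
          proof (cases "x \<in> (\<Union>i. A i)")
            case True
            then obtain i where "x \<in> A i" by auto
            then have "x \<in> (\<Union>i<k. A i)" if "k \<ge> Suc i" for k using that by (auto simp: Suc_le_eq)
            then show ?thesis using True by (auto simp: eventually_sequentially indicator_def)
          qed (auto simp: indicator_def)
          then show "(\<lambda>k. \<Sum>i<k. indicator (A i \<inter> {- R<..R}) x) \<longlonglongrightarrow> (indicator ((\<Union>i. A i) \<inter> {- R<..R}) x :: complex)"
            unfolding eq by (rule Lim_transform_eventually[OF tendsto_const])
        qed
        show "AE x in lborel. cmod ((\<Sum>i<k. indicator (A i \<inter> {- R<..R}) x) - indicator ((\<Union>i. A i) \<inter> {- R<..R}) x)
            \<le> cmod (indicator ((\<Union>i. A i) \<inter> {- R<..R}) x)" for k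
          unfolding eq by (auto simp: indicator_def)
      qed (use A sq[OF UA] in measurable)
    qed (auto intro!: step_closure_sum union sq[OF UA])
  qed
qed

lemma step_closure_bounded_support:
  assumes u: "sqint u" and supp: "\<And>x. x \<notin> {- R<..R} \<Longrightarrow> u x = 0"
  shows "u \<in> step_closure R"
proof -
  note [measurable] = sqint_meas[OF u]
  \<comment> \<open>With base point 0 the approximants satisfy |F i| \<le> 2 |u|: they vanish
    wherever \<open>u\<close> does, hence off the window, and 3 |u| dominates the errors.\<close>
  obtain F where F: "\<And>i. simple_function borel (F i)" "\<And>x. (\<lambda>i. F i x) \<longlonglongrightarrow> u x"
      "\<And>i x. cmod (F i x) \<le> 2 * cmod (u x)"
    using borel_measurable_implies_sequence_metric[of u borel 0] by auto
  have F0: "F i x = 0" if "x \<notin> {- R<..R}" for i x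
    using F(3)[of i x] supp[OF that] by simp
  have [measurable]: "F i \<in> borel_measurable borel" for i
    using F(1) by (rule borel_measurable_simple_function)
  have "F i \<in> step_closure R" for i
  proof -
    have "F i = (\<lambda>x. \<Sum>y\<in>range (F i). y * indicator (F i -` {y} \<inter> {- R<..R}) x)"
    proof
      fix x
      have "F i x = (\<Sum>y\<in>range (F i). indicator (F i -` {y}) x *\<^sub>R y)"
        using simple_function_indicator_representation_banach[OF F(1)[of i], of x]
        unfolding space_borel Int_UNIV_right by blast
      also have "\<dots> = (\<Sum>y\<in>range (F i). y * indicator (F i -` {y} \<inter> {- R<..R}) x)"
      proof (rule sum.cong[OF refl])
        fix y
        show "indicator (F i -` {y}) x *\<^sub>R y = y * indicator (F i -` {y} \<inter> {- R<..R}) x"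
          using F0[of x i] by (cases "x \<in> {- R<..R}"; cases "F i x = y") (simp_all add: indicator_def)
      qed
      finally show "F i x = (\<Sum>y\<in>range (F i). y * indicator (F i -` {y} \<inter> {- R<..R}) x)" .
    qed
    also have "\<dots> \<in> step_closure R"
    proof (intro step_closure_sum step_closure_cmult step_closure_indicator)
      show "finite (range (F i))" using simple_functionD(1)[OF F(1)] by simp
      show "F i -` {y} \<in> sets borel" for y
        using measurable_sets[of "F i" borel borel "{y}"] by simp
    qed
    finally show ?thesis .
  qed
  moreover have "l2conv F u sequentially"
  proof (rule l2conv_dominated[where w="\<lambda>x. 3 * u x"])
    show "AE x in lborel. cmod (F k x - u x) \<le> cmod (3 * u x)" for k
    proof (rule AE_I2)
      fix x
      have "cmod (F k x - u x) \<le> cmod (F k x) + cmod (u x)" by (rule norm_triangle_ineq4)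
      then show "cmod (F k x - u x) \<le> cmod (3 * u x)" using F(3)[of k x] by (simp add: norm_mult)
    qed
  qed (use F u in \<open>auto intro: sqint_cmult\<close>)
  ultimately show ?thesis by (intro step_closure_limit[OF _ _ u])
qed

lemma step_approx:
  assumes "sqint u" "\<And>x. x \<notin> {- R<..R} \<Longrightarrow> u x = 0"
  obtains s where "\<And>k. s k \<in> stepf R" "l2conv s u sequentially"
proof -
  have "\<forall>k. \<exists>s\<in>stepf R. sqrt (sqnorm (\<lambda>x. u x - s x)) < inverse (real (Suc k))"
    using step_closure_bounded_support[OF assms] by (simp add: step_closure_def)
  from choice[OF this[unfolded Bex_def]]
  obtain s where s: "\<And>k. s k \<in> stepf R" "\<And>k. sqrt (sqnorm (\<lambda>x. u x - s k x)) < inverse (real (Suc k))"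
    by blast
  have "norm (sqrt (sqnorm (\<lambda>x. s k x - u x))) \<le> inverse (real (Suc k))" for k
    using s(2)[of k] by (simp add: sqnorm_minus_commute[of "s k"] sqnorm_nonneg)
  then have "l2conv s u sequentially" unfolding l2conv_sqrt
    by (intro Lim_null_comparison[OF _ LIMSEQ_inverse_real_of_nat] always_eventually allI)
  with s(1) show thesis by (rule that)
qed

subsection \<open>The Fourier integral\<close>

text \<open>The Fourier integral in the unitary normalisation, meaningful for integrable
  \<open>u\<close>. Unlike \<open>fourier\<close> it has a value at each point, which pointwise
  limits and Fubini's theorem require.\<close>

definition ft :: "(real \<Rightarrow> complex) \<Rightarrow> real \<Rightarrow> complex" where
  "ft u \<xi> = (LINT x|lborel. exp (- (\<i> * of_real (x * \<xi>))) * u x) / of_real (sqrt (2 * pi))"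

lemma norm_exp_neg_i: "cmod (exp (- (\<i> * of_real t))) = 1"
  using norm_exp_i_times[of "- t"] by (simp add: exp_minus)

lemma ft_integrand_integrable:
  "integrable lborel u \<Longrightarrow> integrable lborel (\<lambda>x. exp (- (\<i> * of_real (x * \<xi>))) * u x)"
  by (rule Bochner_Integration.integrable_bound[of lborel u])
     (auto simp: norm_mult norm_exp_neg_i simp del: of_real_mult intro!: borel_measurable_times)

lemma ft_measurable [measurable]:
  assumes [measurable]: "u \<in> borel_measurable borel"
  shows "ft u \<in> borel_measurable borel"
  unfolding ft_def by measurable

lemma ft_add: "integrable lborel u \<Longrightarrow> integrable lborel v \<Longrightarrow> ft (\<lambda>x. u x + v x) \<xi> = ft u \<xi> + ft v \<xi>"
  using ft_integrand_integrable[of u \<xi>] ft_integrand_integrable[of v \<xi>]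
  by (simp add: ft_def distrib_left add_divide_distrib del: of_real_mult)

lemma ft_cmult: "ft (\<lambda>x. c * u x) \<xi> = c * ft u \<xi>"
  by (simp add: ft_def mult.left_commute[of _ c])

lemma ft_diff: "integrable lborel u \<Longrightarrow> integrable lborel v \<Longrightarrow> ft (\<lambda>x. u x - v x) \<xi> = ft u \<xi> - ft v \<xi>"
  using ft_integrand_integrable[of u \<xi>] ft_integrand_integrable[of v \<xi>]
  by (simp add: ft_def right_diff_distrib diff_divide_distrib del: of_real_mult)

lemma norm_ft_le: "cmod (ft u \<xi>) \<le> (LINT x|lborel. cmod (u x))"
proof -
  have "cmod (LINT x|lborel. exp (- (\<i> * of_real (x * \<xi>))) * u x) \<le> (LINT x|lborel. cmod (exp (- (\<i> * of_real (x * \<xi>))) * u x))"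
    by (rule integral_norm_bound)
  also have "\<dots> = (LINT x|lborel. cmod (u x))"
    by (simp add: norm_mult norm_exp_neg_i del: of_real_mult)
  finally have "cmod (LINT x|lborel. exp (- (\<i> * of_real (x * \<xi>))) * u x) \<le> (LINT x|lborel. cmod (u x))" .
  moreover have "1 \<le> sqrt (2 * pi)" using pi_gt3 by simp
  ultimately have "cmod (LINT x|lborel. exp (- (\<i> * of_real (x * \<xi>))) * u x) / sqrt (2 * pi) \<le> (LINT x|lborel. cmod (u x)) / 1"
    by (intro frac_le) auto
  then show ?thesis unfolding ft_def norm_divide norm_of_real by simp
qed

lemma ft_Ioc:
  assumes "a \<le> b" "t \<noteq> 0"
  shows "of_real (sqrt (2 * pi)) * ft (indicator {a<..b}) t
    = (exp (- (\<i> * of_real (a * t))) - exp (- (\<i> * of_real (b * t)))) / (\<i> * of_real t)"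
proof -
  let ?F = "\<lambda>x::real. exp (- (\<i> * of_real (x * t))) * (\<i> / of_real t)"
  have "(LINT x|lborel. indicator {a..b} x *\<^sub>R exp (- (\<i> * of_real (x * t)))) = ?F b - ?F a"
  proof (rule integral_FTC_Icc[OF assms(1)])
    fix x
    show "(?F has_vector_derivative exp (- (\<i> * of_real (x * t)))) (at x within {a..b})"
      unfolding has_real_derivative_iff_has_vector_derivative[symmetric]
      using assms(2)
      by (auto intro!: derivative_eq_intros has_vector_derivative_real_field simp: field_simps)
  qed (intro continuous_intros)
  moreover have "(LINT x|lborel. exp (- (\<i> * of_real (x * t))) * indicator {a<..b} x) =
      (LINT x|lborel. indicator {a..b} x *\<^sub>R exp (- (\<i> * of_real (x * t))))"
    by (intro integral_cong_AE AE_mp[OF AE_lborel_singleton[of a] AE_I2])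
       (auto simp: indicator_def)
  ultimately have "of_real (sqrt (2 * pi)) * ft (indicator {a<..b}) t = ?F b - ?F a"
    by (simp add: ft_def)
  also have "\<dots> = (exp (- (\<i> * of_real (a * t))) - exp (- (\<i> * of_real (b * t)))) / (\<i> * of_real t)"
    using assms(2) by (simp add: field_simps del: of_real_mult)
  finally show ?thesis .
qed

lemma integrable_inverse_1_plus_square_lborel: "integrable lborel (\<lambda>x::real. inverse (1 + x\<^sup>2))"
  using integrable_inverse_1_plus_square by (simp add: set_integrable_def)

lemma sqint_ft_Ioc: "sqint (ft (indicator {a<..b}))"
proof (cases "a \<le> b")
  case False
  then have "indicator {a<..b} = (\<lambda>_. 0::complex)" by (auto simp: indicator_def)
  then show ?thesis by (simp add: ft_def sqint_def)
next
  case True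
  \<comment> \<open>The length b - a bounds the transform, and 2/|t| bounds it by the explicit
    formula. So \<open>?K\<close> bounds the squared transform times 1 + t^2, and the square is
    dominated by a multiple of 1 / (1 + t^2).\<close>
  let ?K = "(b - a)\<^sup>2 + 4"
  have "(cmod (ft (indicator {a<..b}) t))\<^sup>2 \<le> 2 * ?K * inverse (1 + t\<^sup>2)" for t
  proof -
    have 1: "cmod (ft (indicator {a<..b}) t) \<le> b - a"
    proof -
      have "(\<lambda>x. cmod (indicator {a<..b} x)) = indicat_real {a<..b}" by (auto simp: indicator_def)
      then show ?thesis using norm_ft_le[of "indicator {a<..b}" t] True by simp
    qed
    have 2: "\<bar>t\<bar> * cmod (ft (indicator {a<..b}) t) \<le> 2"
    proof (cases "t = 0")
      case False
      have "cmod (of_real (sqrt (2 * pi)) * ft (indicator {a<..b}) t) \<le> 2 / \<bar>t\<bar>"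
        unfolding ft_Ioc[OF True False] norm_divide norm_mult norm_of_real
        using False by (intro frac_le) (auto simp: norm_exp_neg_i simp del: of_real_mult intro!: order_trans[OF norm_triangle_ineq4])
      moreover have "1 * cmod (ft (indicator {a<..b}) t) \<le> sqrt (2 * pi) * cmod (ft (indicator {a<..b}) t)"
        using pi_gt3 by (intro mult_right_mono) auto
      ultimately have "cmod (ft (indicator {a<..b}) t) \<le> 2 / \<bar>t\<bar>"
        by (simp add: norm_mult del: real_sqrt_mult)
      then show ?thesis using False by (simp add: field_simps)
    qed auto
    have "(cmod (ft (indicator {a<..b}) t))\<^sup>2 \<le> (b - a)\<^sup>2"
      using 1 by (intro power_mono) auto
    moreover have "(\<bar>t\<bar> * cmod (ft (indicator {a<..b}) t))\<^sup>2 \<le> 2\<^sup>2"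
      using 2 by (intro power_mono) auto
    ultimately have "(cmod (ft (indicator {a<..b}) t))\<^sup>2 * (1 + t\<^sup>2) \<le> ?K"
      by (simp add: power_mult_distrib algebra_simps)
    also have "\<dots> \<le> 2 * ?K" by simp
    finally show ?thesis
      by (simp add: field_simps add_pos_nonneg)
  qed
  then have "integrable lborel (\<lambda>t. (cmod (ft (indicator {a<..b}) t))\<^sup>2)"
    by (intro Bochner_Integration.integrable_bound[OF integrable_mult_right[OF integrable_inverse_1_plus_square_lborel, of "2 * ?K"]])
       (auto intro!: AE_I2 order_trans[OF _ abs_ge_self])
  then show ?thesis by (simp add: sqint_def)
qed

text \<open>
  Plancherel's identity for two intervals is Levy's inversion formula for the uniform distribution on
  one of them.
\<close>

lemma cinner_ft_Ioc:
  assumes ab: "a < b" and cd: "c < d"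
  shows "cinner (ft (indicator {a<..b})) (ft (indicator {c<..d})) = cinner (indicator {a<..b}) (indicator {c<..d})"
proof -
  let ?g = "\<lambda>x. indicat_real {c<..d} x / (d - c)"
  define M where "M = density lborel (\<lambda>x. ennreal (?g x))"
  have "(\<integral>\<^sup>+ x. ennreal (?g x) \<partial>lborel) = (\<integral>\<^sup>+ x. ennreal (1 / (d - c)) * indicator {c<..d} x \<partial>lborel)"
    by (intro nn_integral_cong) (auto simp: indicator_def)
  also have "\<dots> = 1"
    using cd by (simp add: nn_integral_cmult_indicator ennreal_mult[symmetric])
  finally have "prob_space M"
    by (intro prob_spaceI) (simp add: M_def emeasure_density)
  then interpret real_distribution M
    unfolding real_distribution_def real_distribution_axioms_def by (simp add: M_def)
  have meas: "measure M A = measure lborel (A \<inter> {c<..d}) / (d - c)" if [measurable]: "A \<in> sets borel" for A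
  proof -
    have "measure M A = (LINT x|M. indicator A x)" by (simp add: M_def)
    also have "\<dots> = (LINT x|lborel. ?g x *\<^sub>R indicator A x)"
      unfolding M_def using cd by (intro integral_density) auto
    also have "\<dots> = (LINT x|lborel. indicator (A \<inter> {c<..d}) x / (d - c))"
      by (intro Bochner_Integration.integral_cong) (auto simp: indicator_def)
    finally show ?thesis by simp
  qed
  \<comment> \<open>Levy's inversion formula recovers the mass of an interval whose endpoints carry
    no atoms.\<close>
  have pts: "measure M {p} = 0" for p
    by (cases "p \<in> {c<..d}") (simp_all add: meas)
  \<comment> \<open>The characteristic function uses the opposite sign in the exponent, which
    produces precisely the conjugate needed in the inner product.\<close>
  have char: "char M t = of_real (sqrt (2 * pi)) * cnj (ft (indicator {c<..d}) t) / of_real (d - c)" for t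
  proof -
    have "char M t = (LINT x|lborel. ?g x *\<^sub>R iexp (t * x))"
      unfolding M_def char_def using cd by (intro integral_density) auto
    also have "\<dots> = (LINT x|lborel. cnj (exp (- (\<i> * of_real (x * t))) * indicator {c<..d} x) / of_real (d - c))"
      by (intro Bochner_Integration.integral_cong) (auto simp: indicator_def scaleR_conv_of_real exp_cnj mult.commute)
    also have "\<dots> = cnj (LINT x|lborel. exp (- (\<i> * of_real (x * t))) * indicator {c<..d} x) / of_real (d - c)"
      by (simp del: complex_cnj_mult of_real_mult of_real_diff)
    finally show ?thesis by (simp add: ft_def del: of_real_diff)
  qed
  let ?P = "\<lambda>t. ft (indicator {a<..b}) t * cnj (ft (indicator {c<..d}) t)"
  have int: "integrable lborel ?P" by (intro cinner_integrable sqint_ft_Ioc)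
  have "(\<lambda>T. 1 / (2 * pi) * (CLBINT t=-real T..real T. (iexp (-(t * a)) - iexp (-(t * b))) / (\<i> * t) * char M t)) \<longlonglongrightarrow> measure M {a<..b}"
    using Levy_Inversion[OF less_imp_le[OF ab] pts pts] by simp
  moreover have "(CLBINT t=-real T..real T. (iexp (-(t * a)) - iexp (-(t * b))) / (\<i> * t) * char M t) =
      of_real (2 * pi / (d - c)) * (LINT t|lborel. indicator {- real T<..<real T} t *\<^sub>R ?P t)" for T
  proof -
    have *: "(iexp (-(t * a)) - iexp (-(t * b))) / (\<i> * t) * char M t = of_real (2 * pi / (d - c)) * ?P t" if "t \<noteq> 0" for t
    proof -
      have "(iexp (-(t * a)) - iexp (-(t * b))) / (\<i> * t) = of_real (sqrt (2 * pi)) * ft (indicator {a<..b}) t"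
        using ft_Ioc[of a b t] ab that by (simp add: mult.commute)
      then have "(iexp (-(t * a)) - iexp (-(t * b))) / (\<i> * t) * char M t =
          of_real (sqrt (2 * pi)) * of_real (sqrt (2 * pi)) * ?P t / of_real (d - c)"
        by (simp add: char)
      also have "complex_of_real (sqrt (2 * pi)) * of_real (sqrt (2 * pi)) = of_real (2 * pi)"
        by (simp flip: of_real_mult)
      finally show ?thesis by simp
    qed
    have [measurable]: "char M \<in> borel_measurable borel" by (rule char_measurable)
    have "(CLBINT t=-real T..real T. (iexp (-(t * a)) - iexp (-(t * b))) / (\<i> * t) * char M t) =
        (LINT t|lborel. indicator {- real T<..<real T} t *\<^sub>R ((iexp (-(t * a)) - iexp (-(t * b))) / (\<i> * t) * char M t))"
      by (simp add: interval_lebesgue_integral_def set_lebesgue_integral_def)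
    also have "\<dots> = (LINT t|lborel. of_real (2 * pi / (d - c)) * (indicator {- real T<..<real T} t *\<^sub>R ?P t))"
    proof (intro integral_cong_AE AE_mp[OF AE_lborel_singleton[of 0] AE_I2])
      fix t show "t \<noteq> 0 \<longrightarrow> indicator {- real T<..<real T} t *\<^sub>R ((iexp (-(t * a)) - iexp (-(t * b))) / (\<i> * t) * char M t)
          = of_real (2 * pi / (d - c)) * (indicator {- real T<..<real T} t *\<^sub>R ?P t)"
        using *[of t] by (auto simp: indicator_def)
    qed measurable
    finally show ?thesis unfolding integral_mult_right_zero .
  qed
  ultimately have L: "(\<lambda>T. of_real (1 / (d - c)) * (LINT t|lborel. indicator {- real T<..<real T} t *\<^sub>R ?P t)) \<longlonglongrightarrow> of_real (measure M {a<..b})"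
    by simp
  \<comment> \<open>The inversion formula gives only a limit of symmetric truncations. Both
    transforms are square integrable, so their product is integrable and the limit is the full
    integral.\<close>
  have "(\<lambda>T::nat. (LINT t|lborel. indicator {- real T<..<real T} t *\<^sub>R ?P t)) \<longlonglongrightarrow> (LINT t|lborel. ?P t)"
  proof (rule integral_dominated_convergence[where w="\<lambda>t. cmod (?P t)"])
    show "AE t in lborel. (\<lambda>T. indicator {- real T<..<real T} t *\<^sub>R ?P t) \<longlonglongrightarrow> ?P t"
    proof (rule AE_I2)
      fix t
      obtain N where N: "\<bar>t\<bar> < real N" using reals_Archimedean2 by blast
      have "t \<in> {- real T<..<real T}" if "T \<ge> N" for T
        using that N by (simp add: abs_less_iff of_nat_le_iff[symmetric, where 'a=real] del: of_nat_le_iff)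
      then have "\<forall>\<^sub>F T in sequentially. ?P t = indicator {- real T<..<real T} t *\<^sub>R ?P t"
        unfolding eventually_sequentially by (metis indicator_simps(1) scaleR_one)
      then show "(\<lambda>T. indicator {- real T<..<real T} t *\<^sub>R ?P t) \<longlonglongrightarrow> ?P t"
        by (rule Lim_transform_eventually[OF tendsto_const])
    qed
    show "AE t in lborel. norm (indicator {- real T<..<real T} t *\<^sub>R ?P t) \<le> cmod (?P t)" for T :: nat
      by (auto simp: indicator_def)
  qed (use int in auto)
  then have "(\<lambda>T::nat. of_real (1 / (d - c)) * (LINT t|lborel. indicator {- real T<..<real T} t *\<^sub>R ?P t)) \<longlonglongrightarrow> of_real (1 / (d - c)) * (LINT t|lborel. ?P t)"
    by (intro tendsto_intros)
  from LIMSEQ_unique[OF this L] have "(LINT t|lborel. ?P t) = of_real (measure lborel ({a<..b} \<inter> {c<..d}))"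
    using cd by (simp add: meas field_simps del: of_real_diff)
  also have "\<dots> = cinner (indicator {a<..b}) (indicator {c<..d})"
  proof -
    have "cinner (indicator {a<..b}) (indicator {c<..d}) = (LINT x|lborel. complex_of_real (indicator ({a<..b} \<inter> {c<..d}) x))"
      unfolding cinner_def by (intro Bochner_Integration.integral_cong) (auto simp: indicator_def)
    then show ?thesis unfolding integral_complex_of_real by simp
  qed
  finally show ?thesis by (simp add: cinner_def)
qed

text \<open>Cauchy-Schwarz against the indicator of the window. The resulting control of the L1 norm
  by the L2 norm makes \<open>ft\<close> pointwise continuous along L2 limits with a common
  window.\<close>

lemma bounded_support_integrable:
  assumes u: "sqint u" and supp: "\<And>x. x \<notin> {- R<..R} \<Longrightarrow> u x = 0"
  shows "integrable lborel u" "(LINT x|lborel. cmod (u x)) \<le> sqrt (sqnorm u) * sqrt (sqnorm (indicator {- R<..R}))"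
proof -
  have eq: "u = (\<lambda>x. u x * indicator {- R<..R} x)"
  proof
    fix x show "u x = u x * indicator {- R<..R} x" using supp[of x] by (cases "x \<in> {- R<..R}") auto
  qed
  show "integrable lborel u"
    by (subst eq) (intro sqint_mult_integrable u sqint_indicator_Ioc)
  have c: "sqint (\<lambda>x. of_real (cmod (u x)))"
    using sqint_integrable[OF u] sqint_meas[OF u] by (simp add: sqint_def)
  have "complex_of_real (LINT x|lborel. cmod (u x)) = cinner (\<lambda>x. of_real (cmod (u x))) (indicator {- R<..R})"
    unfolding cinner_def integral_complex_of_real[symmetric]
    using supp by (intro Bochner_Integration.integral_cong) (auto simp: indicator_def)
  then have "\<bar>LINT x|lborel. cmod (u x)\<bar> = cmod (cinner (\<lambda>x. of_real (cmod (u x))) (indicator {- R<..R}))"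
    by (metis norm_of_real)
  also have "\<dots> \<le> sqrt (sqnorm (\<lambda>x. of_real (cmod (u x)))) * sqrt (sqnorm (indicator {- R<..R}))"
    by (intro Cauchy_Schwarz_cinner c sqint_indicator_Ioc)
  also have "sqnorm (\<lambda>x. of_real (cmod (u x))) = sqnorm u" by (simp add: sqnorm_def)
  finally show "(LINT x|lborel. cmod (u x)) \<le> sqrt (sqnorm u) * sqrt (sqnorm (indicator {- R<..R}))" by simp
qed

lemma stepf_integrable: "s \<in> stepf R \<Longrightarrow> integrable lborel s"
  using bounded_support_integrable(1)[OF stepf_sqint, of s R R] stepf_support[of s R] by blast

lemma integrable_indicator_Ioc: "integrable lborel (indicator {a<..b::real} :: real \<Rightarrow> complex)"
proof -
  have "(indicator {a<..b} :: real \<Rightarrow> complex) = (\<lambda>x. of_real (indicator {a<..b} x))"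
    by (auto simp: indicator_def)
  moreover have "integrable lborel (indicat_real {a<..b})"
    by (cases "a \<le> b") auto
  ultimately show ?thesis by simp
qed

lemma sqint_ft_stepf: "s \<in> stepf R \<Longrightarrow> sqint (ft s)"
proof (induction rule: stepf.induct)
  case (add s a b c)
  have "ft (\<lambda>x. s x + c * indicator {a<..b} x) = (\<lambda>\<xi>. ft s \<xi> + c * ft (indicator {a<..b}) \<xi>)"
    using add stepf_integrable integrable_indicator_Ioc by (auto simp: ft_add ft_cmult fun_eq_iff)
  then show ?case using add by (simp add: sqint_add sqint_cmult sqint_ft_Ioc)
qed (simp add: ft_def sqint_def)

lemma cinner_zero_left: "cinner (\<lambda>x. 0) u = 0" by (simp add: cinner_def)

lemma cinner_zero_right: "cinner u (\<lambda>x. 0) = 0" by (simp add: cinner_def)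

lemma ft_zero: "ft (\<lambda>x. 0) = (\<lambda>_. 0)" by (rule ext) (simp add: ft_def)

lemma cinner_ft_stepf_aux:
  assumes "s \<in> stepf R" "a < b"
  shows "cinner (ft s) (ft (indicator {a<..b})) = cinner s (indicator {a<..b})"
  using assms(1)
proof (induction rule: stepf.induct)
  case (add s c d k)
  have "ft (\<lambda>x. s x + k * indicator {c<..d} x) = (\<lambda>\<xi>. ft s \<xi> + k * ft (indicator {c<..d}) \<xi>)"
    using add stepf_integrable integrable_indicator_Ioc by (auto simp: ft_add ft_cmult fun_eq_iff)
  then show ?case using add sqint_ft_stepf[OF add.hyps(1)] stepf_sqint[OF add.hyps(1)] assms(2)
    by (simp add: cinner_add_left cinner_cmult_left sqint_cmult sqint_ft_Ioc sqint_indicator_Ioc cinner_ft_Ioc)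
qed (simp add: ft_zero cinner_zero_left)

lemma cinner_ft_stepf:
  assumes "t \<in> stepf R'" "s \<in> stepf R"
  shows "cinner (ft s) (ft t) = cinner s t"
  using assms(1)
proof (induction rule: stepf.induct)
  case (add t c d k)
  have "ft (\<lambda>x. t x + k * indicator {c<..d} x) = (\<lambda>\<xi>. ft t \<xi> + k * ft (indicator {c<..d}) \<xi>)"
    using add stepf_integrable integrable_indicator_Ioc by (auto simp: ft_add ft_cmult fun_eq_iff)
  then show ?case
    using add sqint_ft_stepf[OF add.hyps(1)] stepf_sqint[OF add.hyps(1)]
      sqint_ft_stepf[OF assms(2)] stepf_sqint[OF assms(2)] cinner_ft_stepf_aux[OF assms(2)]
    by (simp add: cinner_add_right cinner_cmult_right sqint_cmult sqint_ft_Ioc sqint_indicator_Ioc)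
qed (simp add: ft_zero cinner_zero_right)

text \<open>The transforms of the step functions converge pointwise by the L1 estimate and are
  Cauchy in L2 by the isometry on step functions. Fatou's lemma identifies the two limits.\<close>

lemma ft_bounded_support:
  assumes u: "sqint u" and supp: "\<And>x. x \<notin> {- R<..R} \<Longrightarrow> u x = 0"
    and s: "\<And>k. s k \<in> stepf R" "l2conv s u sequentially"
  shows "sqint (ft u)" "l2conv (\<lambda>k. ft (s k)) (ft u) sequentially"
proof -
  note su = bounded_support_integrable(1)[OF u supp]
  let ?d = "\<lambda>k. sqrt (sqnorm (\<lambda>x. s k x - u x))"
  let ?C = "sqrt (sqnorm (indicator {- R<..R}))"
  have d0: "?d \<longlonglongrightarrow> 0" using s(2) by (simp add: l2conv_sqrt)
  have pt: "(\<lambda>k. ft (s k) \<xi>) \<longlonglongrightarrow> ft u \<xi>" for \<xi>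
  proof -
    have "(\<lambda>k. ft (s k) \<xi> - ft u \<xi>) \<longlonglongrightarrow> 0"
    proof (rule Lim_null_comparison)
      have "cmod (ft (s k) \<xi> - ft u \<xi>) \<le> ?d k * ?C" for k
      proof -
        have "cmod (ft (s k) \<xi> - ft u \<xi>) = cmod (ft (\<lambda>x. s k x - u x) \<xi>)"
          using stepf_integrable[OF s(1)] su by (simp add: ft_diff)
        also have "\<dots> \<le> (LINT x|lborel. cmod (s k x - u x))" by (rule norm_ft_le)
        also have "\<dots> \<le> ?d k * ?C"
          using stepf_support[OF s(1)] supp stepf_sqint[OF s(1)] u
          by (intro bounded_support_integrable(2)) (auto intro!: sqint_diff)
        finally show ?thesis .
      qed
      then show "\<forall>\<^sub>F k in sequentially. norm (ft (s k) \<xi> - ft u \<xi>) \<le> ?d k * ?C" by simp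
      show "(\<lambda>k. ?d k * ?C) \<longlonglongrightarrow> 0" using tendsto_mult_left_zero[OF d0] .
    qed
    then show ?thesis by (simp add: LIM_zero_iff)
  qed
  have iso: "sqnorm (\<lambda>\<xi>. ft (s j) \<xi> - ft (s k) \<xi>) = sqnorm (\<lambda>x. s j x - s k x)" for j k
  proof -
    have "(\<lambda>x. s j x - s k x) \<in> stepf R"
      using stepf_add[OF stepf_cmult[OF s(1), of "-1"] s(1)] by simp
    from cinner_ft_stepf[OF this this] have "sqnorm (ft (\<lambda>x. s j x - s k x)) = sqnorm (\<lambda>x. s j x - s k x)"
      unfolding cinner_self of_real_eq_iff .
    moreover have "ft (\<lambda>x. s j x - s k x) = (\<lambda>\<xi>. ft (s j) \<xi> - ft (s k) \<xi>)"
      using stepf_integrable[OF s(1)] by (simp add: ft_diff fun_eq_iff)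
    ultimately show ?thesis by simp
  qed
  \<comment> \<open>Here \<open>j\<close> is fixed and \<open>k\<close> tends to infinity;
    \<open>e\<close> absorbs the distance \<open>?d k\<close>, which is only eventually
    small.\<close>
  have close: "sqint (\<lambda>\<xi>. ft (s j) \<xi> - ft u \<xi>) \<and> sqnorm (\<lambda>\<xi>. ft (s j) \<xi> - ft u \<xi>) \<le> (?d j + e)\<^sup>2" if "e > 0" for j e
  proof (rule Fatou_sqnorm[where s="\<lambda>k \<xi>. ft (s j) \<xi> - ft (s k) \<xi>"])
    show "\<forall>\<^sub>F k in sequentially. sqnorm (\<lambda>\<xi>. ft (s j) \<xi> - ft (s k) \<xi>) \<le> (?d j + e)\<^sup>2"
      using order_tendstoD(2)[OF d0 that]
    proof eventually_elim
      case (elim k)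
      have "sqrt (sqnorm (\<lambda>x. s j x - s k x)) \<le> ?d j + sqrt (sqnorm (\<lambda>x. u x - s k x))"
        by (intro sqnorm_triangle stepf_sqint[OF s(1)] u)
      also have "\<dots> \<le> ?d j + e" using elim by (simp add: sqnorm_minus_commute[of u])
      finally show ?case by (simp add: iso sqrt_le_D)
    qed
    show "AE \<xi> in lborel. (\<lambda>k. ft (s j) \<xi> - ft (s k) \<xi>) \<longlonglongrightarrow> ft (s j) \<xi> - ft u \<xi>"
      by (intro AE_I2 tendsto_intros pt)
  qed (use sqint_ft_stepf[OF s(1)] sqint_meas[OF u] sqint_meas[OF stepf_sqint[OF s(1)]] in \<open>auto intro: sqint_diff\<close>)
  show 1: "sqint (ft u)"
    using sqint_diff[OF sqint_ft_stepf[OF s(1)] conjunct1[OF close[of 1]], of 0 0] by simp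
  have "sqrt (sqnorm (\<lambda>\<xi>. ft (s j) \<xi> - ft u \<xi>)) \<le> ?d j" for j
  proof (rule field_le_epsilon)
    fix e :: real assume "e > 0"
    from close[OF this] show "sqrt (sqnorm (\<lambda>\<xi>. ft (s j) \<xi> - ft u \<xi>)) \<le> ?d j + e"
      using \<open>e > 0\<close> by (intro real_le_lsqrt) (auto simp: sqnorm_nonneg)
  qed
  then show "l2conv (\<lambda>k. ft (s k)) (ft u) sequentially"
    unfolding l2conv_sqrt by (intro Lim_null_comparison[OF _ d0]) (simp add: sqnorm_nonneg)
qed

lemma Plancherel_bounded_support:
  assumes u: "sqint u" and supp: "\<And>x. x \<notin> {- R<..R} \<Longrightarrow> u x = 0"
    and v: "sqint v" and suppv: "\<And>x. x \<notin> {- R'<..R'} \<Longrightarrow> v x = 0"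
  shows "sqint (ft u)" "cinner (ft u) (ft v) = cinner u v"
proof -
  obtain s where s: "\<And>k. s k \<in> stepf R" "l2conv s u sequentially" using step_approx[OF u supp] by blast
  obtain t where t: "\<And>k. t k \<in> stepf R'" "l2conv t v sequentially" using step_approx[OF v suppv] by blast
  note fu = ft_bounded_support[OF u supp s] and fv = ft_bounded_support[OF v suppv t]
  show "sqint (ft u)" by (rule fu)
  have "(\<lambda>k. cinner (ft (s k)) (ft (t k))) \<longlonglongrightarrow> cinner (ft u) (ft v)"
    by (intro cinner_l2conv fu fv sqint_ft_stepf[OF s(1)] sqint_ft_stepf[OF t(1)])
  moreover have "(\<lambda>k. cinner (s k) (t k)) \<longlonglongrightarrow> cinner u v"
    by (intro cinner_l2conv s t u v stepf_sqint[OF s(1)] stepf_sqint[OF t(1)])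
  ultimately show "cinner (ft u) (ft v) = cinner u v"
    using LIMSEQ_unique by (simp add: cinner_ft_stepf[OF t(1) s(1)])
qed

subsection \<open>The Plancherel transform\<close>

definition trunc :: "real \<Rightarrow> (real \<Rightarrow> complex) \<Rightarrow> real \<Rightarrow> complex" where
  "trunc R u x = indicator {-R..R} x * u x"

lemma fourier_trunc_eq: "fourier_trunc R u = ft (trunc R u)"
proof
  fix \<xi>
  have "(LINT x:{-R..R}|lborel. exp (- (\<i> * of_real (x * \<xi>))) * u x) = (LINT x|lborel. exp (- (\<i> * of_real (x * \<xi>))) * trunc R u x)"
    unfolding set_lebesgue_integral_def trunc_def
    by (intro Bochner_Integration.integral_cong) (auto simp: indicator_def)
  then show "fourier_trunc R u \<xi> = ft (trunc R u) \<xi>"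
    by (simp add: fourier_trunc_def ft_def)
qed

lemma sqint_trunc: "sqint u \<Longrightarrow> sqint (trunc R u)"
  unfolding trunc_def by (rule sqint_mult_bounded[where C=1]) (auto simp: indicator_def)

text \<open>The truncation uses a closed interval and step functions live on a half-open one, so the
  window is enlarged by 1; the absolute value covers negative \<open>R\<close>.\<close>

lemma trunc_support: "x \<notin> {- (\<bar>R\<bar> + 1)<..\<bar>R\<bar> + 1} \<Longrightarrow> trunc R u x = 0"
  by (auto simp: trunc_def indicator_def)

lemma trunc_integrable: "sqint u \<Longrightarrow> integrable lborel (trunc R u)"
  using bounded_support_integrable(1)[OF sqint_trunc[of u R], of "\<bar>R\<bar> + 1"] trunc_support by blast

lemma l2conv_trunc:
  assumes u: "sqint u"
  shows "l2conv (\<lambda>R. trunc R u) u at_top"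
proof -
  note [measurable] = sqint_meas[OF u] sqint_meas[OF sqint_trunc[OF u]]
  have "((\<lambda>R. LINT x|lborel. (cmod (trunc R u x - u x))\<^sup>2) \<longlongrightarrow> (LINT x|(lborel::real measure). 0)) at_top"
  proof (rule integral_dominated_convergence_at_top[where w="\<lambda>x. (cmod (u x))\<^sup>2"])
    show "AE x in lborel. ((\<lambda>R. (cmod (trunc R u x - u x))\<^sup>2) \<longlongrightarrow> 0) at_top"
    proof (rule AE_I2)
      fix x
      have "\<forall>\<^sub>F R in at_top. 0 = (cmod (trunc R u x - u x))\<^sup>2"
        using eventually_ge_at_top[of "\<bar>x\<bar>"] by eventually_elim (auto simp: trunc_def indicator_def)
      then show "((\<lambda>R. (cmod (trunc R u x - u x))\<^sup>2) \<longlongrightarrow> 0) at_top"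
        by (rule Lim_transform_eventually[OF tendsto_const])
    qed
    show "\<forall>\<^sub>F R in at_top. AE x in lborel. norm ((cmod (trunc R u x - u x))\<^sup>2) \<le> (cmod (u x))\<^sup>2"
      by (intro always_eventually allI AE_I2) (auto simp: trunc_def indicator_def)
  qed (use sqint_integrable[OF u] in measurable)
  then show ?thesis by (simp add: l2conv_def sqnorm_def)
qed

lemma l2conv_compose: "l2conv s u F \<Longrightarrow> filterlim f F G \<Longrightarrow> l2conv (\<lambda>k. s (f k)) u G"
  unfolding l2conv_def by (rule filterlim_compose)

lemma sqint_ft_trunc: "sqint u \<Longrightarrow> sqint (ft (trunc R u))"
  using Plancherel_bounded_support(1)[of "trunc R u" "\<bar>R\<bar> + 1" "trunc R u" "\<bar>R\<bar> + 1"]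
    sqint_trunc trunc_support by blast

lemma cinner_ft_trunc: "sqint u \<Longrightarrow> sqint v \<Longrightarrow> cinner (ft (trunc R u)) (ft (trunc S v)) = cinner (trunc R u) (trunc S v)"
  using Plancherel_bounded_support(2)[of "trunc R u" "\<bar>R\<bar> + 1" "trunc S v" "\<bar>S\<bar> + 1"]
    sqint_trunc trunc_support by blast

lemma sqnorm_ft_trunc_diff:
  assumes u: "sqint u"
  shows "sqnorm (\<lambda>x. ft (trunc R u) x - ft (trunc S u) x) = sqnorm (\<lambda>x. trunc R u x - trunc S u x)"
proof -
  have "complex_of_real (sqnorm (\<lambda>x. ft (trunc R u) x - ft (trunc S u) x)) = of_real (sqnorm (\<lambda>x. trunc R u x - trunc S u x))"
    unfolding cinner_self[symmetric]
    by (simp add: cinner_diff_left cinner_diff_right sqint_diff sqint_ft_trunc sqint_trunc u cinner_ft_trunc)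
  then show ?thesis by simp
qed

text \<open>The limit is constructed along integer radii, where completeness for sequences applies.
  The isometry then bounds the distance at any real radius \<open>R\<close> by the norm of the
  discarded part of \<open>u\<close>.\<close>

lemma fourier_exists:
  assumes u: "sqint u"
  obtains g where "sqint g" "l2conv (\<lambda>R. ft (trunc R u)) g at_top"
proof -
  let ?d = "\<lambda>R. sqrt (sqnorm (\<lambda>x. trunc R u x - u x))"
  have d0: "(?d \<longlongrightarrow> 0) at_top" using l2conv_trunc[OF u] by (simp add: l2conv_sqrt)
  have tri: "sqrt (sqnorm (\<lambda>x. ft (trunc R u) x - ft (trunc S u) x)) \<le> ?d R + ?d S" for R S
    unfolding sqnorm_ft_trunc_diff[OF u] sqnorm_minus_commute[of "trunc S u" u]
    by (intro sqnorm_triangle sqint_trunc u)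
  obtain g where g: "sqint g" "l2conv (\<lambda>k. ft (trunc (real k) u)) g sequentially"
  proof (rule l2_complete[where s="\<lambda>k. ft (trunc (real k) u)"])
    fix e :: real assume "e > 0"
    then have "e / 2 > 0" by simp
    from order_tendstoD(2)[OF filterlim_compose[OF d0 filterlim_real_sequentially] this]
    obtain N where N: "\<And>n. n \<ge> N \<Longrightarrow> ?d (real n) < e/2" by (auto simp: eventually_sequentially)
    have "sqrt (sqnorm (\<lambda>x. ft (trunc (real m) u) x - ft (trunc (real n) u) x)) < e" if "m \<ge> N" "n \<ge> N" for m n
      using tri[of "real m" "real n"] N[OF that(1)] N[OF that(2)] by linarith
    then show "\<exists>N. \<forall>m\<ge>N. \<forall>n\<ge>N. sqrt (sqnorm (\<lambda>x. ft (trunc (real m) u) x - ft (trunc (real n) u) x)) < e"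
      by blast
  qed (use sqint_ft_trunc[OF u] in blast)+
  let ?c = "\<lambda>k. sqrt (sqnorm (\<lambda>x. ft (trunc (real k) u) x - g x))"
  have le: "sqrt (sqnorm (\<lambda>x. ft (trunc R u) x - g x)) \<le> ?d R" for R
  proof (rule tendsto_le[OF sequentially_bot _ tendsto_const])
    show "(\<lambda>k. ?d R + ?d (real k) + ?c k) \<longlonglongrightarrow> ?d R"
      using tendsto_add[OF tendsto_add[OF tendsto_const filterlim_compose[OF d0 filterlim_real_sequentially]] g(2)[unfolded l2conv_sqrt], of "?d R"] by simp
    have "sqrt (sqnorm (\<lambda>x. ft (trunc R u) x - g x)) \<le> ?d R + ?d (real k) + ?c k" for k
      using sqnorm_triangle[OF sqint_ft_trunc[OF u] sqint_ft_trunc[OF u] g(1), of R "real k"] tri[of R "real k"] by linarith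
    then show "\<forall>\<^sub>F k in sequentially. sqrt (sqnorm (\<lambda>x. ft (trunc R u) x - g x)) \<le> ?d R + ?d (real k) + ?c k"
      by simp
  qed
  have "l2conv (\<lambda>R. ft (trunc R u)) g at_top"
    unfolding l2conv_sqrt
    using le by (intro Lim_null_comparison[OF _ d0] always_eventually allI) (simp add: sqnorm_nonneg)
  with g(1) show thesis by (rule that)
qed

text \<open>This discharges the choice in \<open>fourier\<close>: the \<open>ennreal\<close>-valued
  distance is the squared L2 distance once both functions are square integrable, and a limit exists.
  All later facts about \<open>fourier\<close> rest on these two.\<close>

lemma
  assumes u: "sqint u"
  shows sqint_fourier: "sqint (fourier u)"
    and l2conv_ft_trunc: "l2conv (\<lambda>R. ft (trunc R u)) (fourier u) at_top"
proof -
  have iff: "((\<lambda>R. \<integral>\<^sup>+ \<xi>. ennreal ((cmod (fourier_trunc R u \<xi> - g \<xi>))\<^sup>2) \<partial>lborel) \<longlongrightarrow> 0) at_top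
      \<longleftrightarrow> l2conv (\<lambda>R. ft (trunc R u)) g at_top" if g: "sqint g" for g
    using nn_integral_sqnorm[OF sqint_diff[OF sqint_ft_trunc[OF u] g]]
    by (simp add: fourier_trunc_eq l2conv_def ennreal_0[symmetric] sqnorm_nonneg del: ennreal_0)
  obtain g where g: "sqint g" "l2conv (\<lambda>R. ft (trunc R u)) g at_top" by (rule fourier_exists[OF u])
  have "\<exists>g. g \<in> borel_measurable lborel \<and> integrable lborel (\<lambda>\<xi>. (cmod (g \<xi>))\<^sup>2) \<and>
     ((\<lambda>R. \<integral>\<^sup>+ \<xi>. ennreal ((cmod (fourier_trunc R u \<xi> - g \<xi>))\<^sup>2) \<partial>lborel) \<longlongrightarrow> 0) at_top"
    by (intro exI[of _ g]) (use g iff[OF g(1)] in \<open>auto simp: sqint_def\<close>)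
  from someI_ex[OF this, folded fourier_def]
  show "sqint (fourier u)" "l2conv (\<lambda>R. ft (trunc R u)) (fourier u) at_top"
    using iff[of "fourier u"] by (auto simp: sqint_def)
qed

theorem Plancherel:
  assumes u: "sqint u" and v: "sqint v"
  shows "cinner (fourier u) (fourier v) = cinner u v"
proof -
  have "((\<lambda>R. cinner (ft (trunc R u)) (ft (trunc R v))) \<longlongrightarrow> cinner (fourier u) (fourier v)) at_top"
    by (intro cinner_l2conv l2conv_ft_trunc sqint_ft_trunc sqint_fourier u v)
  moreover have "((\<lambda>R. cinner (trunc R u) (trunc R v)) \<longlongrightarrow> cinner u v) at_top"
    by (intro cinner_l2conv l2conv_trunc sqint_trunc u v)
  ultimately show ?thesis
    using tendsto_unique[OF trivial_limit_at_top_linorder] by (simp add: cinner_ft_trunc u v)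
qed

lemma sqnorm_fourier: "sqint u \<Longrightarrow> sqnorm (fourier u) = sqnorm u"
  using Plancherel[of u u] by (simp add: cinner_self)

text \<open>Linearity of \<open>ft\<close> on truncations passes to the limit; uniqueness of L2
  limits then gives equality almost everywhere, which is all that a chosen version can
  satisfy.\<close>

lemma fourier_add:
  assumes u: "sqint u" and v: "sqint v"
  shows "AE x in lborel. fourier (\<lambda>y. u y + v y) x = fourier u x + fourier v x"
proof (rule l2conv_unique[OF _ l2conv_add])
  have "trunc R (\<lambda>y. u y + v y) = (\<lambda>y. trunc R u y + trunc R v y)" for R
    by (simp add: trunc_def distrib_left fun_eq_iff)
  then have "ft (trunc R (\<lambda>y. u y + v y)) = (\<lambda>x. ft (trunc R u) x + ft (trunc R v) x)" for R
    by (simp only:) (rule ext, rule ft_add[OF trunc_integrable[OF u] trunc_integrable[OF v]])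
  then show "l2conv (\<lambda>R x. ft (trunc R u) x + ft (trunc R v) x) (fourier (\<lambda>y. u y + v y)) at_top"
    using l2conv_ft_trunc[OF sqint_add[OF u v]] by simp
qed (intro l2conv_ft_trunc sqint_ft_trunc sqint_fourier sqint_add u v trivial_limit_at_top_linorder)+

lemma fourier_cmult:
  assumes u: "sqint u"
  shows "AE x in lborel. fourier (\<lambda>y. c * u y) x = c * fourier u x"
proof (rule l2conv_unique[OF _ l2conv_cmult])
  have "trunc R (\<lambda>y. c * u y) = (\<lambda>y. c * trunc R u y)" for R
    by (simp add: trunc_def mult.left_commute fun_eq_iff)
  then have "ft (trunc R (\<lambda>y. c * u y)) = (\<lambda>x. c * ft (trunc R u) x)" for R
    by (simp only:) (rule ext, rule ft_cmult)
  then show "l2conv (\<lambda>R x. c * ft (trunc R u) x) (fourier (\<lambda>y. c * u y)) at_top"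
    using l2conv_ft_trunc[OF sqint_cmult[OF u, of c]] by simp
qed (intro l2conv_ft_trunc sqint_ft_trunc sqint_fourier sqint_cmult u trivial_limit_at_top_linorder)+

lemma fourier_diff:
  assumes u: "sqint u" and v: "sqint v"
  shows "AE x in lborel. fourier (\<lambda>y. u y - v y) x = fourier u x - fourier v x"
  using fourier_add[OF u sqint_cmult[OF v, of "-1"]] fourier_cmult[OF v, of "-1"]
  by eventually_elim simp

lemma sqnorm_fourier_diff:
  assumes u: "sqint u" and v: "sqint v"
  shows "sqnorm (\<lambda>x. fourier u x - fourier v x) = sqnorm (\<lambda>x. u x - v x)"
proof -
  have "sqnorm (\<lambda>x. fourier u x - fourier v x) = sqnorm (fourier (\<lambda>y. u y - v y))"
    using fourier_diff[OF u v]
    by (intro sqnorm_cong_AE sqint_diff sqint_fourier u v) (auto elim: eventually_mono)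
  then show ?thesis using sqnorm_fourier[OF sqint_diff[OF u v]] by simp
qed

lemma fourier_cong_AE:
  assumes u: "sqint u" and v: "sqint v" and eq: "AE x in lborel. u x = v x"
  shows "AE x in lborel. fourier u x = fourier v x"
proof -
  have "sqnorm (\<lambda>x. u x - v x) = 0"
    using eq by (subst sqnorm_zero_iff) (auto intro: sqint_diff u v)
  then have "sqnorm (\<lambda>x. fourier u x - fourier v x) = 0" by (simp add: sqnorm_fourier_diff u v)
  then show ?thesis using sqnorm_zero_iff[OF sqint_diff[OF sqint_fourier[OF u] sqint_fourier[OF v]]] by simp
qed

lemma fourier_l2conv_iff:
  assumes s: "\<And>k. sqint (s k)" and u: "sqint u"
  shows "l2conv (\<lambda>k. fourier (s k)) (fourier u) F \<longleftrightarrow> l2conv s u F"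
  unfolding l2conv_def sqnorm_fourier_diff[OF s u] ..

text \<open>The transforms of the truncations tend to \<open>fourier u\<close> in L2 and, by
  dominated convergence, to \<open>ft u\<close> at every point. Fatou's lemma forces the two limits
  to agree.\<close>

lemma fourier_L1:
  assumes u: "sqint u" and int: "integrable lborel u"
  shows "AE x in lborel. fourier u x = ft u x"
proof -
  have pt: "(\<lambda>k. ft (trunc (real k) u) \<xi>) \<longlonglongrightarrow> ft u \<xi>" for \<xi>
    unfolding ft_def
  proof (intro tendsto_divide tendsto_const, rule integral_dominated_convergence[where w="\<lambda>x. cmod (u x)"])
    show "AE x in lborel. (\<lambda>k. exp (- (\<i> * of_real (x * \<xi>))) * trunc (real k) u x) \<longlonglongrightarrow> exp (- (\<i> * of_real (x * \<xi>))) * u x"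
    proof (rule AE_I2)
      fix x
      obtain N where "\<bar>x\<bar> < real N" using reals_Archimedean2 by blast
      then have "\<forall>\<^sub>F k in sequentially. u x = trunc (real k) u x"
        by (auto simp: eventually_sequentially trunc_def indicator_def intro!: exI[of _ N])
      then have "(\<lambda>k. trunc (real k) u x) \<longlonglongrightarrow> u x"
        by (rule Lim_transform_eventually[OF tendsto_const])
      then show "(\<lambda>k. exp (- (\<i> * of_real (x * \<xi>))) * trunc (real k) u x) \<longlonglongrightarrow> exp (- (\<i> * of_real (x * \<xi>))) * u x"
        by (intro tendsto_intros)
    qed
    show "AE x in lborel. norm (exp (- (\<i> * of_real (x * \<xi>))) * trunc (real k) u x) \<le> cmod (u x)" for k
      by (rule AE_I2) (auto simp: norm_mult norm_exp_neg_i trunc_def indicator_def simp del: of_real_mult)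
  qed (use int ft_integrand_integrable[OF int] ft_integrand_integrable[OF trunc_integrable[OF u]] in auto)
  note [measurable] = sqint_meas[OF u] sqint_meas[OF sqint_fourier[OF u]]
  have conv: "l2conv (\<lambda>k. ft (trunc (real k) u)) (fourier u) sequentially"
    by (rule l2conv_compose[OF l2conv_ft_trunc[OF u] filterlim_real_sequentially])
  have *: "sqint (\<lambda>\<xi>. ft u \<xi> - fourier u \<xi>) \<and> sqnorm (\<lambda>\<xi>. ft u \<xi> - fourier u \<xi>) \<le> e" if "e > 0" for e
  proof (rule Fatou_sqnorm[where s="\<lambda>k \<xi>. ft (trunc (real k) u) \<xi> - fourier u \<xi>"])
    show "\<forall>\<^sub>F k in sequentially. sqnorm (\<lambda>\<xi>. ft (trunc (real k) u) \<xi> - fourier u \<xi>) \<le> e"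
      using order_tendstoD(2)[OF conv[unfolded l2conv_def] that] by eventually_elim simp
    show "AE \<xi> in lborel. (\<lambda>k. ft (trunc (real k) u) \<xi> - fourier u \<xi>) \<longlonglongrightarrow> ft u \<xi> - fourier u \<xi>"
      by (intro AE_I2 tendsto_intros pt)
  qed (use ft_measurable[OF sqint_meas[OF u]] sqint_meas[OF sqint_fourier[OF u]] in
      \<open>auto intro!: sqint_diff sqint_ft_trunc sqint_fourier u\<close>)
  have "sqnorm (\<lambda>\<xi>. ft u \<xi> - fourier u \<xi>) \<le> 0"
    by (rule field_le_epsilon) (use * in simp)
  then have "sqnorm (\<lambda>\<xi>. ft u \<xi> - fourier u \<xi>) = 0" using sqnorm_nonneg by (simp add: order_antisym)
  then show ?thesis using sqnorm_zero_iff[OF conjunct1[OF *[of 1]]] by (auto elim: eventually_mono)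
qed

section \<open>The multiplication formula and Fourier inversion\<close>

lemma integrable_pair_mult:
  fixes u v :: "real \<Rightarrow> 'a::{real_normed_algebra, banach, second_countable_topology}"
  assumes u: "integrable lborel u" and v: "integrable lborel v"
  shows "integrable (lborel \<Otimes>\<^sub>M lborel) (\<lambda>(x, y). norm (u x) * norm (v y))"
proof (rule lborel_pair.Fubini_integrable)
  note [measurable] = borel_measurable_integrable[OF u] borel_measurable_integrable[OF v]
  show "(\<lambda>(x, y). norm (u x) * norm (v y)) \<in> borel_measurable (lborel \<Otimes>\<^sub>M lborel)" by measurable
qed (use u v in auto)

text \<open>The kernel is symmetric in its two variables, so Fubini's theorem moves the transform
  from one factor to the other.\<close>

lemma ft_multiplication:
  assumes u: "integrable lborel u" and v: "integrable lborel v"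
  shows "(LINT \<xi>|lborel. ft u \<xi> * v \<xi>) = (LINT x|lborel. u x * ft v x)"
proof -
  note [measurable] = borel_measurable_integrable[OF u] borel_measurable_integrable[OF v]
  let ?c = "complex_of_real (sqrt (2 * pi))"
  have int: "integrable (lborel \<Otimes>\<^sub>M lborel) (\<lambda>(x, \<xi>). exp (- (\<i> * of_real (x * \<xi>))) * u x * v \<xi>)"
    by (rule Bochner_Integration.integrable_bound[OF integrable_pair_mult[OF u v]])
       (auto simp: norm_mult norm_exp_neg_i simp del: of_real_mult)
  have "(LINT \<xi>|lborel. ft u \<xi> * v \<xi>) = (LINT \<xi>|lborel. (LINT x|lborel. exp (- (\<i> * of_real (x * \<xi>))) * u x * v \<xi>)) / ?c"
    by (simp add: ft_def del: of_real_mult)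
  also have "(LINT \<xi>|lborel. (LINT x|lborel. exp (- (\<i> * of_real (x * \<xi>))) * u x * v \<xi>)) =
      (LINT x|lborel. (LINT \<xi>|lborel. exp (- (\<i> * of_real (x * \<xi>))) * u x * v \<xi>))"
    by (rule lborel_pair.Fubini_integral[OF int])
  also have "\<dots> = (LINT x|lborel. u x * (LINT \<xi>|lborel. exp (- (\<i> * of_real (\<xi> * x))) * v \<xi>))"
    by (simp add: mult_ac del: of_real_mult flip: integral_mult_right_zero)
  also have "\<dots> / ?c = (LINT x|lborel. u x * ft v x)"
    by (simp add: ft_def del: of_real_mult)
  finally show ?thesis .
qed

lemma fourier_multiplication:
  assumes u: "sqint u" and v: "sqint v"
  shows "(LINT x|lborel. fourier u x * v x) = (LINT x|lborel. u x * fourier v x)"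
proof -
  have c: "sqint (\<lambda>x. cnj (w x))" if "sqint w" for w using that by (rule sqint_cnj)
  have lc: "l2conv (\<lambda>R x. cnj (s R x)) (\<lambda>x. cnj (w x)) F" if "l2conv s w F" for s w and F :: "real filter"
    using that unfolding l2conv_def sqnorm_def complex_cnj_diff[symmetric] complex_mod_cnj .
  \<comment> \<open>The bilinear pairing is written as an inner product with a conjugated second
    argument so that continuity of \<open>cinner\<close> applies.\<close>
  have "((\<lambda>R. cinner (ft (trunc R u)) (\<lambda>x. cnj (trunc R v x))) \<longlongrightarrow> cinner (fourier u) (\<lambda>x. cnj (v x))) at_top"
    by (intro cinner_l2conv l2conv_ft_trunc l2conv_trunc sqint_ft_trunc sqint_fourier u v c sqint_trunc lc)
  moreover have "((\<lambda>R. cinner (trunc R u) (\<lambda>x. cnj (ft (trunc R v) x))) \<longlongrightarrow> cinner u (\<lambda>x. cnj (fourier v x))) at_top"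
    by (intro cinner_l2conv l2conv_ft_trunc l2conv_trunc sqint_ft_trunc sqint_fourier u v c sqint_trunc lc)
  moreover have "cinner (ft (trunc R u)) (\<lambda>x. cnj (trunc R v x)) = cinner (trunc R u) (\<lambda>x. cnj (ft (trunc R v) x))" for R
    using ft_multiplication[OF trunc_integrable[OF u] trunc_integrable[OF v]] by (simp add: cinner_def)
  ultimately show ?thesis
    using tendsto_unique[OF trivial_limit_at_top_linorder] by (simp add: cinner_def)
qed

text \<open>The kernel of the inverse transform is the conjugate of the forward kernel, so
  conjugating before and after \<open>fourier\<close> gives the inverse and reuses all that is known
  of \<open>fourier\<close>.\<close>

definition inv_fourier :: "(real \<Rightarrow> complex) \<Rightarrow> real \<Rightarrow> complex" where
  "inv_fourier g x = cnj (fourier (\<lambda>y. cnj (g y)) x)"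

lemma sqint_inv_fourier: "sqint g \<Longrightarrow> sqint (inv_fourier g)"
  unfolding inv_fourier_def by (intro sqint_cnj sqint_fourier)

text \<open>
  By the multiplication formula \<open>inv_fourier\<close> is the Hilbert space adjoint of \<open>fourier\<close>. It is isometric
  as well, being \<open>fourier\<close> conjugated by complex conjugation, hence \<open>fourier\<close> is onto.
\<close>

lemma inv_fourier_adjoint: "sqint u \<Longrightarrow> sqint g \<Longrightarrow> cinner (fourier u) g = cinner u (inv_fourier g)"
  using fourier_multiplication[of u "\<lambda>x. cnj (g x)"] by (simp add: cinner_def inv_fourier_def sqint_cnj)

lemma cinner_inv_fourier:
  assumes "sqint g" "sqint h" shows "cinner (inv_fourier g) (inv_fourier h) = cinner g h"
proof -
  have "cinner (inv_fourier g) (inv_fourier h) = cnj (cinner (fourier (\<lambda>y. cnj (g y))) (fourier (\<lambda>y. cnj (h y))))"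
    unfolding cinner_def Bochner_Integration.integral_cnj[symmetric] by (simp add: inv_fourier_def)
  also have "\<dots> = cinner g h"
    unfolding Plancherel[OF sqint_cnj[OF assms(1)] sqint_cnj[OF assms(2)]]
    unfolding cinner_def Bochner_Integration.integral_cnj[symmetric] by simp
  finally show ?thesis .
qed

lemma AE_eq_if_cinner:
  assumes "sqint u" "sqint v" "\<And>w. sqint w \<Longrightarrow> cinner u w = cinner v w"
  shows "AE x in lborel. u x = v x"
proof -
  have "cinner (\<lambda>x. u x - v x) (\<lambda>x. u x - v x) = 0"
    using assms by (simp add: cinner_diff_left sqint_diff)
  then have "sqnorm (\<lambda>x. u x - v x) = 0" by (simp add: cinner_self)
  then show ?thesis using sqnorm_zero_iff[OF sqint_diff[OF assms(1,2)]] by simp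
qed

text \<open>Against any \<open>w\<close>, adjointness turns the inner product of the left side into
  that of \<open>inv_fourier g\<close> and \<open>inv_fourier w\<close>, and isometry turns this
  into that of \<open>g\<close> and \<open>w\<close>.\<close>

theorem fourier_inv_fourier:
  assumes g: "sqint g" shows "AE x in lborel. fourier (inv_fourier g) x = g x"
  by (rule AE_eq_if_cinner) (simp_all add: inv_fourier_adjoint cinner_inv_fourier sqint_inv_fourier sqint_fourier g)

lemma fourier_inj:
  assumes u: "sqint u" and v: "sqint v" and eq: "AE x in lborel. fourier u x = fourier v x"
  shows "AE x in lborel. u x = v x"
proof -
  have "sqnorm (\<lambda>x. fourier u x - fourier v x) = 0"
    using eq by (subst sqnorm_zero_iff) (auto intro: sqint_diff sqint_fourier u v)
  then have "sqnorm (\<lambda>x. u x - v x) = 0" by (simp add: sqnorm_fourier_diff u v)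
  then show ?thesis using sqnorm_zero_iff[OF sqint_diff[OF u v]] by simp
qed

section \<open>Reflection, conjugation and translation under the Fourier transform\<close>

lemma AE_reflect:
  assumes "AE x in lborel. P x"
  shows "AE x in (lborel::real measure). P (- x)"
proof -
  have d: "distr lborel borel uminus = (lborel::real measure)" by (rule lborel_distr_uminus)
  from assms have "AE x in distr lborel borel uminus. P x" by (subst d)
  then show ?thesis by (rule AE_distrD[rotated]) simp
qed

lemma sqnorm_reflect: "sqnorm (\<lambda>x. u (- x)) = sqnorm u"
  unfolding sqnorm_def using lborel_integral_real_affine[of "-1" "\<lambda>x. (cmod (u x))\<^sup>2" 0] by simp

text \<open>For real \<open>u\<close> this is the Hermitian symmetry of the transform, which decides
  whether a multiplier maps real functions to real functions.\<close>

lemma fourier_cnj: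
  assumes u: "sqint u"
  shows "AE x in lborel. fourier (\<lambda>y. cnj (u y)) x = cnj (fourier u (- x))"
proof (rule l2conv_unique[OF l2conv_ft_trunc])
  have eq: "ft (trunc R (\<lambda>y. cnj (u y))) = (\<lambda>x. cnj (ft (trunc R u) (- x)))" for R
  proof
    fix x
    have "(LINT y|lborel. exp (- (\<i> * of_real (y * x))) * trunc R (\<lambda>y. cnj (u y)) y) = (LINT y|lborel. cnj (exp (- (\<i> * of_real (y * - x))) * trunc R u y))"
      by (intro Bochner_Integration.integral_cong) (auto simp: exp_cnj trunc_def indicator_def)
    then show "ft (trunc R (\<lambda>y. cnj (u y))) x = cnj (ft (trunc R u) (- x))"
      unfolding ft_def Bochner_Integration.integral_cnj by simp
  qed
  have "sqnorm (\<lambda>x. cnj (ft (trunc R u) (- x)) - cnj (fourier u (- x))) = sqnorm (\<lambda>x. ft (trunc R u) x - fourier u x)" for R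
    using sqnorm_reflect[of "\<lambda>x. ft (trunc R u) x - fourier u x"]
    by (simp add: sqnorm_def flip: complex_cnj_diff)
  then show "l2conv (\<lambda>R. ft (trunc R (\<lambda>y. cnj (u y)))) (\<lambda>x. cnj (fourier u (- x))) at_top"
    using l2conv_ft_trunc[OF u] unfolding eq l2conv_def by simp
qed (intro sqint_ft_trunc sqint_fourier sqint_cnj sqint_reflect u trivial_limit_at_top_linorder)+

lemma ft_translate: "ft (\<lambda>y. u (a + y)) x = exp (\<i> * of_real (a * x)) * ft u x"
proof -
  have "(LINT y|lborel. exp (- (\<i> * of_real (y * x))) * u y) =
      (LINT y|lborel. exp (- (\<i> * of_real ((a + y) * x))) * u (a + y))"
    using lborel_integral_real_affine[of 1 "\<lambda>y. exp (- (\<i> * of_real (y * x))) * u y" a] by simp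
  also have "\<dots> = (LINT y|lborel. exp (- (\<i> * of_real (a * x))) * (exp (- (\<i> * of_real (y * x))) * u (a + y)))"
  proof (intro Bochner_Integration.integral_cong refl)
    fix y
    have "exp (- (\<i> * complex_of_real ((a + y) * x))) = exp (- (\<i> * of_real (a * x))) * exp (- (\<i> * of_real (y * x)))"
      by (simp add: exp_add[symmetric] algebra_simps)
    then show "exp (- (\<i> * complex_of_real ((a + y) * x))) * u (a + y) = exp (- (\<i> * of_real (a * x))) * (exp (- (\<i> * of_real (y * x))) * u (a + y))"
      by (simp only: mult.assoc)
  qed
  finally have "(LINT y|lborel. exp (- (\<i> * of_real (y * x))) * u y) =
      exp (- (\<i> * of_real (a * x))) * (LINT y|lborel. exp (- (\<i> * of_real (y * x))) * u (a + y))"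
    by simp
  then show ?thesis by (simp add: ft_def exp_minus)
qed

lemma sqnorm_translate: "sqnorm (\<lambda>x. u (a + x)) = sqnorm u"
  unfolding sqnorm_def using lborel_integral_real_affine[of 1 "\<lambda>x. (cmod (u x))\<^sup>2" a] by simp

text \<open>Truncation does not commute with translation, so the translates of
  \<open>trunc R u\<close> are used. They are integrable, hence \<open>fourier_L1\<close> and
  \<open>ft_translate\<close> settle them, and both sides converge in L2.\<close>

lemma fourier_translate:
  assumes u: "sqint u"
  shows "AE x in lborel. fourier (\<lambda>y. u (a + y)) x = exp (\<i> * of_real (a * x)) * fourier u x"
proof (rule l2conv_unique)
  let ?e = "\<lambda>x. exp (\<i> * complex_of_real (a * x))"
  have e: "cmod (?e x) = 1" for x by (rule norm_exp_i_times)
  let ?s = "\<lambda>R y. trunc R u (a + y)"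
  have s: "sqint (?s R)" for R by (intro sqint_translate sqint_trunc u)
  show "l2conv (\<lambda>R. fourier (?s R)) (fourier (\<lambda>y. u (a + y))) at_top"
  proof (subst fourier_l2conv_iff[OF s sqint_translate[OF u]])
    show "l2conv (\<lambda>R y. trunc R u (a + y)) (\<lambda>y. u (a + y)) at_top"
      using l2conv_trunc[OF u] sqnorm_translate[of "\<lambda>y. trunc _ u y - u y"] by (simp add: l2conv_def)
  qed
  have me: "?e \<in> borel_measurable borel" by measurable
  have sq: "sqint (\<lambda>x. ?e x * w x)" if "sqint w" for w
    by (rule sqint_mult_bounded[OF that me, where C=1]) (simp add: e del: of_real_mult)
  have "sqnorm (\<lambda>x. fourier (?s R) x - ?e x * fourier u x) = sqnorm (\<lambda>x. ft (trunc R u) x - fourier u x)" for R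
  proof -
    have int: "integrable lborel (?s R)"
      using lborel_integrable_real_affine[OF trunc_integrable[OF u], of 1 R a] by simp
    have "sqnorm (\<lambda>x. fourier (?s R) x - ?e x * fourier u x) = sqnorm (\<lambda>x. ?e x * ft (trunc R u) x - ?e x * fourier u x)"
      using fourier_L1[OF s int]
      by (intro sqnorm_cong_AE sqint_diff sq sqint_fourier s u sqint_ft_trunc)
         (auto simp: ft_translate[of "trunc R u"] elim!: eventually_mono)
    also have "\<dots> = sqnorm (\<lambda>x. ft (trunc R u) x - fourier u x)"
      by (simp add: sqnorm_def right_diff_distrib[symmetric] norm_mult e del: of_real_mult)
    finally show ?thesis .
  qed
  then show "l2conv (\<lambda>R. fourier (?s R)) (\<lambda>x. ?e x * fourier u x) at_top"
    using l2conv_ft_trunc[OF u] unfolding l2conv_def by simp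
  show "sqint (\<lambda>x. ?e x * fourier u x)" by (intro sq sqint_fourier u)
qed (intro sqint_fourier sqint_translate sqint_trunc u trivial_limit_at_top_linorder)+

subsection \<open>Fourier multipliers\<close>

abbreviation cr :: "(real \<Rightarrow> real) \<Rightarrow> real \<Rightarrow> complex" where
  "cr u \<equiv> \<lambda>x. complex_of_real (u x)"

lemma L2_sqint: "u \<in> L2 \<Longrightarrow> sqint (cr u)" by (simp add: sqint_of_real)

lemma L2_fourier: "u \<in> L2 \<Longrightarrow> sqint (fourier_real u)" by (intro sqint_fourier L2_sqint)

lemma L2_lin: "u \<in> L2 \<Longrightarrow> v \<in> L2 \<Longrightarrow> (\<lambda>x. a * u x + b * v x) \<in> L2"
  using sqint_add[OF sqint_cmult[OF L2_sqint, of u "of_real a"] sqint_cmult[OF L2_sqint, of v "of_real b"]]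
  by (simp add: sqint_of_real)

lemma cinner_cr: "cinner (cr u) (cr v) = of_real (l2_inner u v)"
  unfolding cinner_def l2_inner_def integral_complex_of_real[symmetric] by simp

lemma l2_inner_fourier: "u \<in> L2 \<Longrightarrow> v \<in> L2 \<Longrightarrow> of_real (l2_inner u v) = cinner (fourier_real u) (fourier_real v)"
  by (simp add: Plancherel L2_sqint cinner_cr)

lemma l2_norm_sqnorm: "l2_norm u = sqrt (sqnorm (cr u))"
  by (simp add: l2_norm_def sqnorm_def l2_inner_def power2_eq_square)

lemma l2_tendsto_iff: "l2_tendsto w u F \<longleftrightarrow> l2conv (\<lambda>i. cr (w i)) (cr u) F"
  by (simp add: l2_tendsto_def l2conv_sqrt l2_norm_sqnorm)

lemma l2_tendsto_fourier:
  assumes "\<And>i. w i \<in> L2" "u \<in> L2"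
  shows "l2_tendsto w u F \<longleftrightarrow> l2conv (\<lambda>i. fourier_real (w i)) (fourier_real u) F"
  unfolding l2_tendsto_iff by (rule fourier_l2conv_iff[symmetric]) (auto intro: L2_sqint assms)

lemma fourier_real_lin:
  assumes "u \<in> L2" "v \<in> L2"
  shows "AE x in lborel. fourier_real (\<lambda>y. a * u y + b * v y) x = of_real a * fourier_real u x + of_real b * fourier_real v x"
  using fourier_add[OF sqint_cmult[OF L2_sqint[OF assms(1)], of "of_real a"] sqint_cmult[OF L2_sqint[OF assms(2)], of "of_real b"]]
    fourier_cmult[OF L2_sqint[OF assms(1)], of "of_real a"] fourier_cmult[OF L2_sqint[OF assms(2)], of "of_real b"]
  by eventually_elim simp

lemma fourier_real_inj:
  assumes "u \<in> L2" "v \<in> L2" "AE x in lborel. fourier_real u x = fourier_real v x"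
  shows "AE x in lborel. u x = v x"
  using fourier_inj[OF L2_sqint[OF assms(1)] L2_sqint[OF assms(2)] assms(3)] by simp

definition multiplier :: "(real \<Rightarrow> real) \<Rightarrow> bool" where
  "multiplier m \<longleftrightarrow> m \<in> borel_measurable borel \<and> (\<forall>x. m (- x) = m x) \<and> (\<exists>C. \<forall>x. \<bar>m x\<bar> \<le> C)"

text \<open>
  For an even bounded \<open>m\<close> the inverse transform is real almost everywhere, so \<open>Re\<close> is only a type
  conversion.
\<close>

definition mult :: "(real \<Rightarrow> real) \<Rightarrow> (real \<Rightarrow> real) \<Rightarrow> real \<Rightarrow> real" where
  "mult m u x = Re (inv_fourier (\<lambda>\<xi>. of_real (m \<xi>) * fourier_real u \<xi>) x)"

lemma multiplierI:
  "m \<in> borel_measurable borel \<Longrightarrow> (\<And>x. m (- x) = m x) \<Longrightarrow> (\<And>x. \<bar>m x\<bar> \<le> C) \<Longrightarrow> multiplier m"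
  unfolding multiplier_def by blast

lemma multiplier_meas: "multiplier m \<Longrightarrow> m \<in> borel_measurable borel" by (simp add: multiplier_def)

lemma sqint_multiplier: "multiplier m \<Longrightarrow> sqint u \<Longrightarrow> sqint (\<lambda>\<xi>. of_real (m \<xi>) * u \<xi>)"
  unfolding multiplier_def by (auto intro!: sqint_mult_bounded)

text \<open>The product \<open>h\<close> of an even real multiplier and the transform of a real
  function is Hermitian. Therefore \<open>inv_fourier h\<close> and its conjugate have the same
  transform, and injectivity makes \<open>inv_fourier h\<close> real almost everywhere.\<close>

lemma
  assumes m: "multiplier m" and u: "u \<in> L2"
  shows mult_L2: "mult m u \<in> L2"
    and fourier_mult: "AE \<xi> in lborel. fourier_real (mult m u) \<xi> = of_real (m \<xi>) * fourier_real u \<xi>"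
proof -
  define h where "h \<xi> = of_real (m \<xi>) * fourier_real u \<xi>" for \<xi>
  have h: "sqint h" unfolding h_def by (intro sqint_multiplier m L2_fourier u)
  have Vh: "sqint (inv_fourier h)" by (rule sqint_inv_fourier[OF h])
  have herm: "AE \<xi> in lborel. cnj (h (- \<xi>)) = h \<xi>"
    using fourier_cnj[OF L2_sqint[OF u]]
    by eventually_elim (use m in \<open>simp add: h_def multiplier_def\<close>)
  have F: "AE \<xi> in lborel. fourier (inv_fourier h) \<xi> = h \<xi>" by (rule fourier_inv_fourier[OF h])
  have "AE x in lborel. cnj (inv_fourier h x) = inv_fourier h x"
  proof (rule fourier_inj[OF sqint_cnj[OF Vh] Vh])
    show "AE \<xi> in lborel. fourier (\<lambda>y. cnj (inv_fourier h y)) \<xi> = fourier (inv_fourier h) \<xi>"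
      using fourier_cnj[OF Vh] AE_reflect[OF F] F herm by eventually_elim simp
  qed
  then have real: "AE x in lborel. inv_fourier h x = of_real (mult m u x)"
    by eventually_elim (simp add: mult_def h_def[abs_def, symmetric] complex_eq_iff)
  have meas: "mult m u \<in> borel_measurable borel"
    unfolding mult_def h_def[symmetric] using sqint_meas[OF Vh] by measurable
  have sq: "sqint (cr (mult m u))"
    by (rule sqint_cong_AE[OF Vh _ real]) (use meas in measurable)
  then show "mult m u \<in> L2" by (simp add: sqint_of_real)
  show "AE \<xi> in lborel. fourier_real (mult m u) \<xi> = of_real (m \<xi>) * fourier_real u \<xi>"
    using fourier_cong_AE[OF Vh sq real] F by eventually_elim (simp add: h_def)
qed

lemma mult_eqI:
  assumes "multiplier m" "u \<in> L2" "w \<in> L2"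
    "AE \<xi> in lborel. fourier_real w \<xi> = of_real (m \<xi>) * fourier_real u \<xi>"
  shows "AE x in lborel. mult m u x = w x"
proof (rule fourier_real_inj[OF mult_L2[OF assms(1,2)] assms(3)])
  show "AE \<xi> in lborel. fourier_real (mult m u) \<xi> = fourier_real w \<xi>"
    using fourier_mult[OF assms(1,2)] assms(4) by eventually_elim simp
qed

lemma l2_inner_mult:
  assumes "multiplier m" "u \<in> L2" "v \<in> L2"
  shows "of_real (l2_inner (mult m u) v) = cinner (\<lambda>\<xi>. of_real (m \<xi>) * fourier_real u \<xi>) (fourier_real v)"
  unfolding l2_inner_fourier[OF mult_L2[OF assms(1,2)] assms(3)]
  by (intro cinner_cong_AE fourier_mult sqint_multiplier L2_fourier mult_L2 assms) auto

lemma l2_inner_commute: "l2_inner u v = l2_inner v u"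
  by (simp add: l2_inner_def mult.commute)

lemma l2_inner_mult_commute:
  assumes "multiplier m" "u \<in> L2" "v \<in> L2"
  shows "l2_inner (mult m u) v = l2_inner u (mult m v)"
proof -
  have "complex_of_real (l2_inner (mult m u) v) = cnj (of_real (l2_inner (mult m v) u))"
    unfolding l2_inner_mult[OF assms] l2_inner_mult[OF assms(1,3,2)]
    unfolding cinner_def Bochner_Integration.integral_cnj[symmetric]
    by (intro Bochner_Integration.integral_cong) (auto simp: mult_ac)
  then show ?thesis by (simp add: l2_inner_commute)
qed

subsection \<open>Positivity preserving multipliers\<close>

text \<open>Positivity is stated weakly, against nonnegative test functions. In this form sums,
  mixtures and limits follow by linearity and continuity of the inner product; only products need an
  argument.\<close>

definition pos_mult :: "(real \<Rightarrow> real) \<Rightarrow> bool" where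
  "pos_mult m \<longleftrightarrow> multiplier m \<and>
    (\<forall>u\<in>L2. \<forall>v\<in>L2. (\<forall>x. 0 \<le> u x) \<longrightarrow> (\<forall>x. 0 \<le> v x) \<longrightarrow>
      0 \<le> Re (cinner (\<lambda>\<xi>. of_real (m \<xi>) * fourier_real u \<xi>) (fourier_real v)))"

lemma pos_multI:
  assumes "multiplier m"
    and "\<And>u v. u \<in> L2 \<Longrightarrow> v \<in> L2 \<Longrightarrow> (\<And>x. 0 \<le> u x) \<Longrightarrow> (\<And>x. 0 \<le> v x) \<Longrightarrow>
      0 \<le> Re (cinner (\<lambda>\<xi>. of_real (m \<xi>) * fourier_real u \<xi>) (fourier_real v))"
  shows "pos_mult m"
  using assms unfolding pos_mult_def by blast

lemma pos_multD:
  assumes "pos_mult m" "u \<in> L2" "v \<in> L2" "\<And>x. 0 \<le> u x" "\<And>x. 0 \<le> v x"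
  shows "0 \<le> Re (cinner (\<lambda>\<xi>. of_real (m \<xi>) * fourier_real u \<xi>) (fourier_real v))"
  using assms unfolding pos_mult_def by blast

lemma pos_mult_multiplier: "pos_mult m \<Longrightarrow> multiplier m" by (simp add: pos_mult_def)

lemma pos_mult_const: assumes "0 \<le> c" shows "pos_mult (\<lambda>_. c)"
proof (rule pos_multI)
  show "multiplier (\<lambda>_. c)" by (rule multiplierI[where C=c]) (use assms in auto)
  fix u v assume uv: "u \<in> L2" "v \<in> L2" "\<And>x. 0 \<le> u x" "\<And>x. (0::real) \<le> v x"
  have "0 \<le> l2_inner u v" unfolding l2_inner_def by (intro integral_nonneg_AE AE_I2 mult_nonneg_nonneg uv)
  then show "0 \<le> Re (cinner (\<lambda>\<xi>. of_real c * fourier_real u \<xi>) (fourier_real v))"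
    using assms by (simp add: cinner_cmult_left flip: l2_inner_fourier[OF uv(1,2)])
qed

lemma multiplier_add: "multiplier m \<Longrightarrow> multiplier m' \<Longrightarrow> multiplier (\<lambda>x. m x + m' x)"
  unfolding multiplier_def by (auto, metis abs_triangle_ineq add_mono order_trans)

lemma multiplier_times: "multiplier m \<Longrightarrow> multiplier m' \<Longrightarrow> multiplier (\<lambda>x. m x * m' x)"
  unfolding multiplier_def by (auto simp: abs_mult, meson abs_ge_zero mult_mono order_trans)

lemma pos_mult_add: assumes "pos_mult m" "pos_mult m'" shows "pos_mult (\<lambda>x. m x + m' x)"
proof (rule pos_multI)
  show "multiplier (\<lambda>x. m x + m' x)" using assms by (intro multiplier_add pos_mult_multiplier)
  fix u v assume uv: "u \<in> L2" "v \<in> L2" "\<And>x. 0 \<le> u x" "\<And>x. (0::real) \<le> v x"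
  have "cinner (\<lambda>\<xi>. of_real (m \<xi> + m' \<xi>) * fourier_real u \<xi>) (fourier_real v) =
      cinner (\<lambda>\<xi>. of_real (m \<xi>) * fourier_real u \<xi>) (fourier_real v) + cinner (\<lambda>\<xi>. of_real (m' \<xi>) * fourier_real u \<xi>) (fourier_real v)"
    by (subst cinner_add_left[symmetric])
       (auto intro!: sqint_multiplier L2_fourier uv assms[THEN pos_mult_multiplier] simp: distrib_right)
  then show "0 \<le> Re (cinner (\<lambda>\<xi>. of_real (m \<xi> + m' \<xi>) * fourier_real u \<xi>) (fourier_real v))"
    using pos_multD[OF assms(1) uv] pos_multD[OF assms(2) uv] by simp
qed

text \<open>Testing \<open>mult m' u\<close> against its own negative part shows that part to vanish
  almost everywhere. So \<open>mult m' u\<close> may be replaced by its positive part, a nonnegative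
  function to which \<open>m\<close> applies.\<close>

lemma pos_mult_times: assumes m: "pos_mult m" and m': "pos_mult m'" shows "pos_mult (\<lambda>x. m x * m' x)"
proof (rule pos_multI)
  note mm = m[THEN pos_mult_multiplier] m'[THEN pos_mult_multiplier]
  show "multiplier (\<lambda>x. m x * m' x)" by (intro multiplier_times mm)
  fix u v assume uv: "u \<in> L2" "v \<in> L2" "\<And>x. 0 \<le> u x" "\<And>x. (0::real) \<le> v x"
  let ?w = "mult m' u"
  have w: "?w \<in> L2" by (intro mult_L2 mm uv)
  then have [measurable]: "?w \<in> borel_measurable borel" by (simp add: L2_def)
  have L2max: "(\<lambda>x. max 0 (a * ?w x)) \<in> L2" if "\<bar>a\<bar> = 1" for a
  proof -
    have "\<bar>max 0 (a * ?w x)\<bar> \<le> \<bar>?w x\<bar>" for x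
    proof -
      have "\<bar>a * ?w x\<bar> = \<bar>?w x\<bar>" using that by (simp add: abs_mult)
      then show ?thesis by linarith
    qed
    then show ?thesis unfolding sqint_of_real
      by (intro sqint_bound[OF L2_sqint[OF w], where C=1]) auto
  qed
  have n: "(\<lambda>x. max 0 (- ?w x)) \<in> L2" and p: "(\<lambda>x. max 0 (?w x)) \<in> L2"
    using L2max[of "-1"] L2max[of 1] by simp_all
  have "0 \<le> Re (complex_of_real (l2_inner ?w (\<lambda>x. max 0 (- ?w x))))"
    unfolding l2_inner_mult[OF mm(2) uv(1) n] by (rule pos_multD[OF m' uv(1) n uv(3)]) simp
  also have "l2_inner ?w (\<lambda>x. max 0 (- ?w x)) = - sqnorm (cr (\<lambda>x. max 0 (- ?w x)))"
  proof -
    have "?w x * max 0 (- ?w x) = - (max 0 (- ?w x))\<^sup>2" for x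
      by (auto simp: max_def power2_eq_square)
    then show ?thesis by (simp add: l2_inner_def sqnorm_def)
  qed
  finally have "sqnorm (cr (\<lambda>x. max 0 (- ?w x))) = 0" using sqnorm_nonneg by (simp add: order_antisym)
  then have "AE x in lborel. complex_of_real (max 0 (- ?w x)) = 0" by (subst (asm) sqnorm_zero_iff[OF L2_sqint[OF n]])
  then have eq: "AE x in lborel. complex_of_real (?w x) = of_real (max 0 (?w x))"
    by eventually_elim (auto simp: max_def split: if_splits)
  have "cinner (\<lambda>\<xi>. of_real (m \<xi> * m' \<xi>) * fourier_real u \<xi>) (fourier_real v) =
    cinner (\<lambda>\<xi>. of_real (m \<xi>) * fourier_real (\<lambda>x. max 0 (?w x)) \<xi>) (fourier_real v)"
  proof (rule cinner_cong_AE)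
    show "AE \<xi> in lborel. of_real (m \<xi> * m' \<xi>) * fourier_real u \<xi> = of_real (m \<xi>) * fourier_real (\<lambda>x. max 0 (?w x)) \<xi>"
      using fourier_mult[OF mm(2) uv(1)] fourier_cong_AE[OF L2_sqint[OF w] L2_sqint[OF p] eq]
      by eventually_elim simp
  qed (intro sqint_multiplier[OF multiplier_times] sqint_multiplier mm L2_fourier uv p AE_I2 refl)+
  then show "0 \<le> Re (cinner (\<lambda>\<xi>. of_real (m \<xi> * m' \<xi>) * fourier_real u \<xi>) (fourier_real v))"
    using pos_multD[OF m p uv(2) _ uv(4)] by simp
qed

text \<open>Dominated convergence with majorant C |u|. It serves limits of positive multipliers, the
  recovery sequence of Mosco convergence and the strong continuity of the semigroup.\<close>

lemma l2conv_multiplier: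
  assumes mk: "\<And>k. multiplier (m k)" and m: "m' \<in> borel_measurable borel" and u: "sqint u"
    and C: "\<And>k x. \<bar>m k x - m' x\<bar> \<le> C" and lim: "AE x in lborel. (\<lambda>k. m k x) \<longlonglongrightarrow> m' x"
  shows "l2conv (\<lambda>k \<xi>. of_real (m k \<xi>) * u \<xi>) (\<lambda>\<xi>. of_real (m' \<xi>) * u \<xi>) sequentially"
proof (rule l2conv_dominated)
  note [measurable] = multiplier_meas[OF mk] m sqint_meas[OF u]
  show "(\<lambda>\<xi>. of_real (m k \<xi>) * u \<xi>) \<in> borel_measurable borel" for k by measurable
  show "(\<lambda>\<xi>. of_real (m' \<xi>) * u \<xi>) \<in> borel_measurable borel" by measurable
  show "sqint (\<lambda>x. of_real C * u x)" by (intro sqint_cmult u)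
  show "AE x in lborel. (\<lambda>k. of_real (m k x) * u x) \<longlonglongrightarrow> of_real (m' x) * u x"
    using lim by eventually_elim (intro tendsto_intros)
  show "AE x in lborel. cmod (of_real (m k x) * u x - of_real (m' x) * u x) \<le> cmod (of_real C * u x)" for k
  proof (rule AE_I2)
    fix x
    have "cmod (of_real (m k x) * u x - of_real (m' x) * u x) = \<bar>m k x - m' x\<bar> * cmod (u x)"
      by (metis left_diff_distrib norm_mult norm_of_real of_real_diff)
    also have "\<dots> \<le> \<bar>C\<bar> * cmod (u x)" using C[of k x] by (intro mult_right_mono) auto
    finally show "cmod (of_real (m k x) * u x - of_real (m' x) * u x) \<le> cmod (of_real C * u x)" by (simp add: norm_mult)
  qed
qed

lemma pos_mult_limit:
  assumes m: "\<And>k. pos_mult (m k)" and C: "\<And>k x. \<bar>m k x\<bar> \<le> C" and lim: "\<And>x. (\<lambda>k. m k x) \<longlonglongrightarrow> m' x"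
  shows "pos_mult m'"
proof (rule pos_multI)
  note mm = m[THEN pos_mult_multiplier]
  have meas: "m' \<in> borel_measurable borel"
    by (rule borel_measurable_LIMSEQ_real[OF lim]) (use mm in \<open>auto simp: multiplier_def\<close>)
  have C': "\<bar>m' x\<bar> \<le> C" for x
    by (rule tendsto_upperbound[OF tendsto_rabs[OF lim]]) (use C in auto)
  have "m' (- x) = m' x" for x
    using LIMSEQ_unique[OF lim[of "- x"]] lim[of x] mm by (simp add: multiplier_def)
  then show mul: "multiplier m'" by (intro multiplierI[OF meas _ C'])
  have d: "\<bar>m k x - m' x\<bar> \<le> 2 * C" for k x using C[of k x] C'[of x] by linarith
  fix u v assume uv: "u \<in> L2" "v \<in> L2" "\<And>x. 0 \<le> u x" "\<And>x. (0::real) \<le> v x"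
  have "(\<lambda>k. Re (cinner (\<lambda>\<xi>. of_real (m k \<xi>) * fourier_real u \<xi>) (fourier_real v))) \<longlonglongrightarrow>
      Re (cinner (\<lambda>\<xi>. of_real (m' \<xi>) * fourier_real u \<xi>) (fourier_real v))"
    by (intro tendsto_Re cinner_l2conv sqint_multiplier mm mul L2_fourier uv l2conv_multiplier[OF mm meas _ d] AE_I2 lim)
       (simp add: l2conv_def sqnorm_def)
  then show "0 \<le> Re (cinner (\<lambda>\<xi>. of_real (m' \<xi>) * fourier_real u \<xi>) (fourier_real v))"
    by (rule tendsto_lowerbound) (use pos_multD[OF m uv] in auto)
qed

text \<open>The cosine is the mean of the multipliers of the translations by \<open>a\<close> and by
  -a, and translations preserve nonnegativity.\<close>

lemma pos_mult_cos: "pos_mult (\<lambda>\<xi>. cos (a * \<xi>))"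
proof (rule pos_multI)
  show "multiplier (\<lambda>\<xi>. cos (a * \<xi>))" by (rule multiplierI[where C=1]) auto
  fix u v assume uv: "u \<in> L2" "v \<in> L2" "\<And>x. 0 \<le> u x" "\<And>x. (0::real) \<le> v x"
  have tr: "(\<lambda>y. u (b + y)) \<in> L2" for b
    using sqint_translate[OF L2_sqint[OF uv(1)], of b] by (simp add: sqint_of_real)
  let ?e = "\<lambda>b \<xi>. exp (\<i> * complex_of_real (b * \<xi>))"
  have sq: "sqint (\<lambda>\<xi>. ?e b \<xi> * fourier_real u \<xi>)" for b
    by (rule sqint_mult_bounded[OF L2_fourier[OF uv(1)], where C=1]) (simp_all del: of_real_mult)
  have "0 \<le> Re (cinner (\<lambda>\<xi>. ?e b \<xi> * fourier_real u \<xi>) (fourier_real v))" for b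
  proof -
    have "cinner (\<lambda>\<xi>. ?e b \<xi> * fourier_real u \<xi>) (fourier_real v) = cinner (fourier_real (\<lambda>y. u (b + y))) (fourier_real v)"
      using fourier_translate[OF L2_sqint[OF uv(1)], of b]
      by (intro cinner_cong_AE sq L2_fourier tr uv) (auto elim: eventually_mono)
    also have "\<dots> = of_real (l2_inner (\<lambda>y. u (b + y)) v)" by (rule l2_inner_fourier[OF tr uv(2), symmetric])
    finally show ?thesis using uv by (auto simp: l2_inner_def intro!: integral_nonneg_AE)
  qed
  from this[of a] this[of "- a"]
  have "0 \<le> Re (cinner (\<lambda>\<xi>. ?e a \<xi> * fourier_real u \<xi> + ?e (- a) \<xi> * fourier_real u \<xi>) (fourier_real v))"
    by (simp only: cinner_add_left[OF sq sq L2_fourier[OF uv(2)]]) simp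
  also have "(\<lambda>\<xi>. ?e a \<xi> * fourier_real u \<xi> + ?e (- a) \<xi> * fourier_real u \<xi>) = (\<lambda>\<xi>. 2 * (of_real (cos (a * \<xi>)) * fourier_real u \<xi>))"
    by (rule ext) (simp add: distrib_right[symmetric] complex_eq_iff Re_exp Im_exp)
  finally show "0 \<le> Re (cinner (\<lambda>\<xi>. of_real (cos (a * \<xi>)) * fourier_real u \<xi>) (fourier_real v))"
    by (simp add: cinner_cmult_left)
qed

text \<open>Fubini's theorem writes the pairing as the integral, against the nonnegative weight
  \<open>h\<close>, of the pairings for the single cosines.\<close>

lemma pos_mult_mixture:
  assumes h: "integrable lborel h" "\<And>a. 0 \<le> h a"
  shows "pos_mult (\<lambda>\<xi>. LINT a|lborel. cos (a * \<xi>) * h a)"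
proof (rule pos_multI)
  note [measurable] = borel_measurable_integrable[OF h(1)]
  have int: "integrable lborel (\<lambda>a. cos (a * \<xi>) * h a)" for \<xi>
    by (rule Bochner_Integration.integrable_bound[OF h(1)]) (auto simp: abs_mult intro!: mult_left_le_one_le)
  show mul: "multiplier (\<lambda>\<xi>. LINT a|lborel. cos (a * \<xi>) * h a)"
  proof (rule multiplierI)
    show "(\<lambda>\<xi>. LINT a|lborel. cos (a * \<xi>) * h a) \<in> borel_measurable borel" by measurable
    fix x
    show "(LINT a|lborel. cos (a * - x) * h a) = (LINT a|lborel. cos (a * x) * h a)" by simp
    have "\<bar>LINT a|lborel. cos (a * x) * h a\<bar> \<le> (LINT a|lborel. \<bar>cos (a * x) * h a\<bar>)"
      by (rule integral_abs_bound)
    also have "\<dots> \<le> (LINT a|lborel. h a)"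
      using h by (intro integral_mono integrable_abs int) (auto simp: abs_mult intro!: mult_left_le_one_le)
    finally show "\<bar>LINT a|lborel. cos (a * x) * h a\<bar> \<le> (LINT a|lborel. h a)" .
  qed
  fix u v assume uv: "u \<in> L2" "v \<in> L2" "\<And>x. 0 \<le> u x" "\<And>x. (0::real) \<le> v x"
  let ?P = "\<lambda>\<xi>. fourier_real u \<xi> * cnj (fourier_real v \<xi>)"
  have P: "integrable lborel ?P" by (intro cinner_integrable L2_fourier uv)
  note [measurable] = borel_measurable_integrable[OF P]
  have i2: "integrable (lborel \<Otimes>\<^sub>M lborel) (\<lambda>(a, \<xi>). norm (complex_of_real (h a)) * norm (?P \<xi>))"
    by (rule integrable_pair_mult) (use h P in auto)
  have F: "integrable (lborel \<Otimes>\<^sub>M lborel) (\<lambda>(a, \<xi>). of_real (cos (a * \<xi>) * h a) * ?P \<xi>)"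
  proof (rule Bochner_Integration.integrable_bound[OF i2])
    show "AE x in lborel \<Otimes>\<^sub>M lborel. norm (case x of (a, \<xi>) \<Rightarrow> of_real (cos (a * \<xi>) * h a) * ?P \<xi>)
        \<le> norm (case x of (a, \<xi>) \<Rightarrow> norm (complex_of_real (h a)) * norm (?P \<xi>))"
      by (rule AE_I2) (auto simp: norm_mult mult.assoc intro!: mult_left_le_one_le)
  qed measurable
  have "cinner (\<lambda>\<xi>. of_real (LINT a|lborel. cos (a * \<xi>) * h a) * fourier_real u \<xi>) (fourier_real v) =
      (LINT \<xi>|lborel. LINT a|lborel. of_real (cos (a * \<xi>) * h a) * ?P \<xi>)"
    unfolding cinner_def by (simp add: mult.assoc flip: integral_complex_of_real del: of_real_mult)
  also have "\<dots> = (LINT a|lborel. LINT \<xi>|lborel. of_real (cos (a * \<xi>) * h a) * ?P \<xi>)"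
    by (rule lborel_pair.Fubini_integral[OF F])
  also have "\<dots> = (LINT a|lborel. of_real (h a) * cinner (\<lambda>\<xi>. of_real (cos (a * \<xi>)) * fourier_real u \<xi>) (fourier_real v))"
    unfolding cinner_def integral_mult_right_zero[symmetric] by (simp add: mult_ac)
  finally have eq: "cinner (\<lambda>\<xi>. of_real (LINT a|lborel. cos (a * \<xi>) * h a) * fourier_real u \<xi>) (fourier_real v)
      = (LINT a|lborel. of_real (h a) * cinner (\<lambda>\<xi>. of_real (cos (a * \<xi>)) * fourier_real u \<xi>) (fourier_real v))" (is "_ = (LINT a|lborel. ?I a)") .
  have "integrable lborel ?I"
    using lborel_pair.integrable_fst'[OF F]
    unfolding cinner_def integral_mult_right_zero[symmetric] by (simp add: mult_ac)
  then have "Re (LINT a|lborel. ?I a) = (LINT a|lborel. Re (?I a))" by (rule integral_Re[symmetric])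
  also have "\<dots> \<ge> 0"
    using pos_multD[OF pos_mult_cos uv] h(2) by (intro integral_nonneg_AE AE_I2) auto
  finally show "0 \<le> Re (cinner (\<lambda>\<xi>. of_real (LINT a|lborel. cos (a * \<xi>) * h a) * fourier_real u \<xi>) (fourier_real v))"
    unfolding eq .
qed

lemma pos_mult_power: "pos_mult m \<Longrightarrow> pos_mult (\<lambda>\<xi>. m \<xi> ^ n)"
  by (induction n) (auto intro: pos_mult_const pos_mult_times)

lemma pos_mult_sum: "finite I \<Longrightarrow> (\<And>i. i \<in> I \<Longrightarrow> pos_mult (m i)) \<Longrightarrow> pos_mult (\<lambda>\<xi>. \<Sum>i\<in>I. m i \<xi>)"
  by (induction rule: finite_induct) (auto intro: pos_mult_const pos_mult_add)

text \<open>The partial sums of the exponential series are polynomials in \<open>m\<close> with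
  nonnegative coefficients, and \<open>exp C\<close> bounds them uniformly.\<close>

lemma pos_mult_exp:
  assumes m: "pos_mult m" shows "pos_mult (\<lambda>\<xi>. exp (m \<xi>))"
proof -
  obtain C where C: "\<And>x. \<bar>m x\<bar> \<le> C" using pos_mult_multiplier[OF m] unfolding multiplier_def by blast
  let ?s = "\<lambda>k \<xi>. \<Sum>n<k. inverse (fact n) * m \<xi> ^ n"
  show ?thesis
  proof (rule pos_mult_limit[where m="?s"])
    show "pos_mult (?s k)" for k
      by (intro pos_mult_sum pos_mult_times pos_mult_const pos_mult_power m) auto
    show "(\<lambda>k. ?s k x) \<longlonglongrightarrow> exp (m x)" for x
      using exp_converges[of "m x"] by (simp add: sums_def divide_inverse)
    fix k x
    have "\<bar>?s k x\<bar> \<le> (\<Sum>n<k. inverse (fact n) * \<bar>m x\<bar> ^ n)"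
      by (rule order_trans[OF sum_abs]) (simp add: abs_mult power_abs)
    also have "\<dots> \<le> (\<Sum>n. inverse (fact n) * \<bar>m x\<bar> ^ n)"
      using summable_exp[of "\<bar>m x\<bar>"] by (intro sum_le_suminf) auto
    also have "\<dots> = exp \<bar>m x\<bar>" by (simp add: exp_def)
    also have "\<dots> \<le> exp C" using C by simp
    finally show "\<bar>?s k x\<bar> \<le> exp C" .
  qed
qed

subsection \<open>Characteristic exponents\<close>

lemma one_minus_cos_bound: "\<bar>1 - cos (y::real)\<bar> \<le> 2" "\<bar>1 - cos y\<bar> \<le> y\<^sup>2 / 2"
proof -
  show "\<bar>1 - cos y\<bar> \<le> 2" using cos_ge_minus_one[of y] cos_le_one[of y] by linarith
  have "1 - cos y = 2 * (sin (y/2))\<^sup>2" using cos_double_sin[of "y/2"] by simp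
  moreover have "(sin (y/2))\<^sup>2 \<le> (y/2)\<^sup>2"
    using abs_sin_x_le_abs_x[of "y/2"] by (metis abs_le_square_iff)
  ultimately show "\<bar>1 - cos y\<bar> \<le> y\<^sup>2 / 2" by (simp add: power_divide)
qed

locale levy_density =
  fixes h :: "real \<Rightarrow> real"
  assumes h_nonneg: "0 \<le> h x" and h_meas [measurable]: "h \<in> borel_measurable borel"
    and h_int: "integrable lborel (\<lambda>x. min 1 (x\<^sup>2) * h x)"
begin

definition \<phi> :: "real \<Rightarrow> real" where "\<phi> \<xi> = (LINT x|lborel. (1 - cos (\<xi> * x)) * h x)"

text \<open>One constant covers small jumps, through the quadratic bound on 1 - cos, and large
  jumps, through the bound 2. Having \<open>h\<close> as a factor, it later yields a majorant common
  to a whole family of densities.\<close>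

lemma integrand_bound: "\<bar>(1 - cos (\<xi> * x)) * h x\<bar> \<le> (2 + \<xi>\<^sup>2) * (min 1 (x\<^sup>2) * h x)"
proof -
  have "\<bar>1 - cos (\<xi> * x)\<bar> \<le> (2 + \<xi>\<^sup>2) * min 1 (x\<^sup>2)"
  proof (cases "x\<^sup>2 \<le> 1")
    case True
    have "\<bar>1 - cos (\<xi> * x)\<bar> \<le> (\<xi> * x)\<^sup>2 / 2" by (rule one_minus_cos_bound)
    also have "\<dots> \<le> (2 + \<xi>\<^sup>2) * x\<^sup>2" by (simp add: power_mult_distrib algebra_simps)
    finally show ?thesis using True by (simp add: min_def)
  next
    case False
    have "\<bar>1 - cos (\<xi> * x)\<bar> \<le> 2 + \<xi>\<^sup>2"
      using one_minus_cos_bound(1)[of "\<xi> * x"] zero_le_power2[of \<xi>] by linarith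
    then show ?thesis using False by (simp add: min_def)
  qed
  then have "\<bar>1 - cos (\<xi> * x)\<bar> * h x \<le> (2 + \<xi>\<^sup>2) * min 1 (x\<^sup>2) * h x"
    using h_nonneg by (rule mult_right_mono)
  then show ?thesis using h_nonneg[of x] by (simp add: abs_mult mult.assoc)
qed

lemma integrand_integrable: "integrable lborel (\<lambda>x. (1 - cos (\<xi> * x)) * h x)"
  by (rule Bochner_Integration.integrable_bound[OF integrable_mult_right[OF h_int, of "2 + \<xi>\<^sup>2"]])
     (use integrand_bound in \<open>auto intro!: AE_I2 order_trans[OF _ abs_ge_self]\<close>)

lemma \<phi>_nonneg: "0 \<le> \<phi> \<xi>"
  unfolding \<phi>_def by (intro integral_nonneg_AE AE_I2 mult_nonneg_nonneg h_nonneg) simp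

lemma \<phi>_even: "\<phi> (- \<xi>) = \<phi> \<xi>" by (simp add: \<phi>_def)

lemma \<phi>_meas [measurable]: "\<phi> \<in> borel_measurable borel" unfolding \<phi>_def by measurable

lemma multiplier_semigroup: "0 \<le> t \<Longrightarrow> multiplier (\<lambda>\<xi>. exp (- t * \<phi> \<xi>))"
  by (rule multiplierI[where C=1]) (auto simp: \<phi>_even \<phi>_nonneg)

text \<open>
  Removing the jumps of size at most \<open>1 / (k + 1)\<close> leaves a finite Levy measure, for which the exponential
  splits into a constant and the exponential of a mixture of cosines, i.e. of symmetrised translations.
\<close>

lemma pos_mult_semigroup:
  assumes t: "0 \<le> t" shows "pos_mult (\<lambda>\<xi>. exp (- t * \<phi> \<xi>))"
proof -
  let ?A = "\<lambda>k::nat. {x::real. inverse (real (Suc k)) < \<bar>x\<bar>}"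
  define hk where "hk k x = indicator (?A k) x * h x" for k x
  have [measurable]: "hk k \<in> borel_measurable borel" for k unfolding hk_def by measurable
  have hk: "0 \<le> hk k x" "hk k x \<le> h x" for k x using h_nonneg by (auto simp: hk_def indicator_def)
  have hk_int: "integrable lborel (hk k)" for k
  \<comment> \<open>On the retained jumps |x| > 1 / (k + 1), so (k + 1)^2 min 1 (x^2) is at least
    1.\<close>
  proof (rule Bochner_Integration.integrable_bound[OF integrable_mult_right[OF h_int, of "(real (Suc k))\<^sup>2"]])
    show "AE x in lborel. norm (hk k x) \<le> norm ((real (Suc k))\<^sup>2 * (min 1 (x\<^sup>2) * h x))"
    proof (rule AE_I2)
      fix x
      have "1 \<le> (real (Suc k))\<^sup>2 * min 1 (x\<^sup>2)" if "x \<in> ?A k"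
      proof -
        have "1 \<le> real (Suc k) * \<bar>x\<bar>" using that by (simp add: field_simps)
        then have "1 \<le> (real (Suc k) * \<bar>x\<bar>)\<^sup>2" by (rule one_le_power)
        moreover have "1 \<le> (real (Suc k))\<^sup>2" by (rule one_le_power) simp
        ultimately show ?thesis by (simp add: min_def power_mult_distrib)
      qed
      then have "hk k x \<le> (real (Suc k))\<^sup>2 * min 1 (x\<^sup>2) * h x"
        using mult_right_mono[OF _ h_nonneg[of x], of 1 "(real (Suc k))\<^sup>2 * min 1 (x\<^sup>2)"] h_nonneg[of x]
        by (cases "x \<in> ?A k") (auto simp: hk_def)
      then show "norm (hk k x) \<le> norm ((real (Suc k))\<^sup>2 * (min 1 (x\<^sup>2) * h x))"
        using hk(1)[of k x] h_nonneg[of x] by (simp add: abs_mult mult.assoc)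
    qed
  qed measurable
  define \<phi>k where "\<phi>k k \<xi> = (LINT x|lborel. (1 - cos (\<xi> * x)) * hk k x)" for k \<xi>
  have \<phi>k: "\<phi>k k \<xi> = (LINT x|lborel. hk k x) - (LINT x|lborel. cos (x * \<xi>) * hk k x)" for k \<xi>
  proof -
    have "integrable lborel (\<lambda>x. cos (x * \<xi>) * hk k x)"
      by (rule Bochner_Integration.integrable_bound[OF hk_int[of k]]) (use hk in \<open>auto simp: abs_mult intro!: mult_left_le_one_le\<close>)
    then show ?thesis using hk_int[of k]
      by (simp add: \<phi>k_def left_diff_distrib mult.commute[of \<xi>])
  qed
  have \<phi>k0: "0 \<le> \<phi>k k \<xi>" for k \<xi>
    unfolding \<phi>k_def by (intro integral_nonneg_AE AE_I2 mult_nonneg_nonneg hk) simp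
  show ?thesis
  proof (rule pos_mult_limit[where m="\<lambda>k \<xi>. exp (- t * \<phi>k k \<xi>)" and C=1])
    show "pos_mult (\<lambda>\<xi>. exp (- t * \<phi>k k \<xi>))" for k
    proof -
      have "pos_mult (\<lambda>\<xi>. exp (- t * (LINT x|lborel. hk k x)) * exp (t * (LINT x|lborel. cos (x * \<xi>) * hk k x)))"
        by (intro pos_mult_times pos_mult_const pos_mult_exp pos_mult_mixture hk_int hk t) simp
      then show ?thesis by (simp add: \<phi>k exp_add[symmetric] algebra_simps)
    qed
    show "\<bar>exp (- t * \<phi>k k x)\<bar> \<le> 1" for k x using \<phi>k0[of k x] t by simp
    fix \<xi>
    have "(\<lambda>k. \<phi>k k \<xi>) \<longlonglongrightarrow> \<phi> \<xi>"
      unfolding \<phi>k_def \<phi>_def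
    proof (rule integral_dominated_convergence[where w="\<lambda>x. (1 - cos (\<xi> * x)) * h x"])
      show "AE x in lborel. (\<lambda>k. (1 - cos (\<xi> * x)) * hk k x) \<longlonglongrightarrow> (1 - cos (\<xi> * x)) * h x"
      proof (rule AE_I2)
        fix x
        have "\<forall>\<^sub>F k in sequentially. (1 - cos (\<xi> * x)) * h x = (1 - cos (\<xi> * x)) * hk k x"
        proof (cases "x = 0")
          case False
          then have "\<forall>\<^sub>F k in sequentially. inverse (real (Suc k)) < \<bar>x\<bar>"
            using order_tendstoD(2)[OF LIMSEQ_inverse_real_of_nat, of "\<bar>x\<bar>"] by simp
          then show ?thesis by eventually_elim (simp add: hk_def)
        qed simp
        then show "(\<lambda>k. (1 - cos (\<xi> * x)) * hk k x) \<longlonglongrightarrow> (1 - cos (\<xi> * x)) * h x"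
          by (rule Lim_transform_eventually[OF tendsto_const])
      qed
      show "AE x in lborel. norm ((1 - cos (\<xi> * x)) * hk k x) \<le> (1 - cos (\<xi> * x)) * h x" for k
        using hk by (intro AE_I2) (auto simp: abs_mult intro!: mult_left_mono)
    qed (use integrand_integrable in measurable)
    then show "(\<lambda>k. exp (- t * \<phi>k k \<xi>)) \<longlonglongrightarrow> exp (- t * \<phi> \<xi>)" by (intro tendsto_intros)
  qed
qed

end

subsection \<open>The form of a characteristic exponent\<close>

text \<open>The domain is the set where this integral is finite, so the value \<infinity> off the
  domain is automatic. Both halves of Mosco convergence become statements about nonnegative
  integrals.\<close>

lemma extended_form_translation_invariant:
  assumes [measurable]: "\<phi> \<in> borel_measurable borel" and nn: "\<And>x. 0 \<le> \<phi> x" and u: "u \<in> L2"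
  shows "extended_form (translation_invariant_form \<phi>) u = enn2ereal (\<integral>\<^sup>+ x. ennreal ((cmod (fourier_real u x))\<^sup>2 * \<phi> x) \<partial>lborel)"
proof (cases "(\<integral>\<^sup>+ x. ennreal ((cmod (fourier_real u x))\<^sup>2 * \<phi> x) \<partial>lborel) < \<infinity>")
  case True
  note [measurable] = sqint_meas[OF L2_fourier[OF u]]
  have int: "integrable lborel (\<lambda>x. (cmod (fourier_real u x))\<^sup>2 * \<phi> x)"
    using True by (intro integrableI_nonneg) (auto simp: nn)
  have "(LINT x|lborel. fourier_real u x * cnj (fourier_real u x) * of_real (\<phi> x)) = of_real (LINT x|lborel. (cmod (fourier_real u x))\<^sup>2 * \<phi> x)"
    unfolding integral_complex_of_real[symmetric] of_real_mult complex_norm_square ..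
  moreover have "(\<integral>\<^sup>+ x. ennreal ((cmod (fourier_real u x))\<^sup>2 * \<phi> x) \<partial>lborel) = ennreal (LINT x|lborel. (cmod (fourier_real u x))\<^sup>2 * \<phi> x)"
    by (intro nn_integral_eq_integral int) (auto simp: nn)
  moreover have "0 \<le> (LINT x|lborel. (cmod (fourier_real u x))\<^sup>2 * \<phi> x)"
    by (intro integral_nonneg_AE) (auto simp: nn)
  ultimately show ?thesis
    using True u by (simp add: extended_form_def translation_invariant_form_def)
next
  case False
  then have "(\<integral>\<^sup>+ x. ennreal ((cmod (fourier_real u x))\<^sup>2 * \<phi> x) \<partial>lborel) = \<infinity>"
    by (simp add: not_less top_unique)
  with False show ?thesis
    by (simp add: extended_form_def translation_invariant_form_def)
qed

text \<open>Nothing is assumed about the exponents below \<open>N0\<close>, since lower and upper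
  limits ignore finitely many indices. Positivity of \<phi> almost everywhere makes the quotients of
  \<phi> by \<phi>n tend to 1.\<close>

theorem mosco_converges_translation_invariant:
  fixes \<phi>n :: "nat \<Rightarrow> real \<Rightarrow> real"
  assumes \<phi>n_meas: "\<And>n. n \<ge> N0 \<Longrightarrow> \<phi>n n \<in> borel_measurable borel" and \<phi>n_nn: "\<And>n x. n \<ge> N0 \<Longrightarrow> 0 \<le> \<phi>n n x"
    and \<phi>n_even: "\<And>n x. n \<ge> N0 \<Longrightarrow> \<phi>n n (- x) = \<phi>n n x"
    and \<phi>_meas: "\<phi> \<in> borel_measurable borel" and \<phi>_nn: "\<And>x. 0 \<le> \<phi> x" and \<phi>_even: "\<And>x. \<phi> (- x) = \<phi> x"
    and pos: "AE x in lborel. 0 < \<phi> x"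
    and lim: "\<And>x. (\<lambda>n. \<phi>n n x) \<longlonglongrightarrow> \<phi> x"
  shows "mosco_converges (\<lambda>n. translation_invariant_form (\<phi>n n)) (translation_invariant_form \<phi>)"
  unfolding mosco_converges_def
proof (intro conjI ballI allI impI)
  let ?I = "\<lambda>\<phi> u. \<integral>\<^sup>+ x. ennreal ((cmod (fourier_real u x))\<^sup>2 * \<phi> x) \<partial>lborel"
  note ext_n = extended_form_translation_invariant[OF \<phi>n_meas \<phi>n_nn]
  note ext_l = extended_form_translation_invariant[OF \<phi>_meas \<phi>_nn]
  {
    fix u w assume u: "u \<in> L2" and "(\<forall>n. w n \<in> L2) \<and> l2_weak_tendsto w u sequentially"
    then have w: "\<And>n. w n \<in> L2" and weak: "\<And>v. v \<in> L2 \<Longrightarrow> (\<lambda>i. l2_inner (w i) v) \<longlonglongrightarrow> l2_inner u v"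
      by (auto simp: l2_weak_tendsto_def)
    note [measurable] = sqint_meas[OF L2_fourier[OF u]] sqint_meas[OF L2_fourier[OF w]]
    \<comment> \<open>The infimum over the tail puts \<open>m N\<close> below all later exponents,
      the cap makes it a bounded multiplier, and \<open>max N N0\<close> avoids indices about which
      nothing is known.\<close>
    define m where "m N x = min (INF n\<in>{max N N0..}. \<phi>n n x) (real N)" for N x
    have bdd: "bdd_below ((\<lambda>n. \<phi>n n x) ` {max N N0..})" for N :: nat and x
      by (rule bdd_belowI[of _ 0]) (auto simp: \<phi>n_nn)
    have inf_nn: "0 \<le> (INF n\<in>{max N N0..}. \<phi>n n x)" for N x
      by (rule cINF_greatest) (auto simp: \<phi>n_nn)
    have m_nn: "0 \<le> m N x" and m_le: "m N x \<le> real N" for N x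
      using inf_nn[of x N] by (auto simp: m_def)
    have m_le_\<phi>n: "m N x \<le> \<phi>n n x" if "max N N0 \<le> n" for N n x
      using that unfolding m_def by (intro min.coboundedI1 cINF_lower[OF bdd]) simp
    have [measurable]: "m N \<in> borel_measurable borel" for N
      unfolding m_def by (intro borel_measurable_min borel_measurable_cINF_real) (auto simp: \<phi>n_meas)
    have mul: "multiplier (m N)" for N
    proof (rule multiplierI[where C="real N"])
      fix x
      have "(\<lambda>n. \<phi>n n (- x)) ` {max N N0..} = (\<lambda>n. \<phi>n n x) ` {max N N0..}"
        by (rule image_cong) (auto simp: \<phi>n_even)
      then show "m N (- x) = m N x" unfolding m_def by presburger
      show "\<bar>m N x\<bar> \<le> real N" using m_nn[of N x] m_le[of N x] by simp
    qed measurable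
    have m_le_\<phi>: "m N x \<le> \<phi> x" for N x
      using m_le_\<phi>n[of N] by (intro tendsto_lowerbound[OF lim]) (auto simp: eventually_sequentially intro!: exI[of _ "max N N0"])
    have m_lim: "(\<lambda>N. m N x) \<longlonglongrightarrow> \<phi> x" for x
    proof (rule order_tendstoI)
      fix a assume "a < \<phi> x"
      then obtain b where b: "a < b" "b < \<phi> x" using dense by blast
      obtain N1 where N1: "\<And>n. n \<ge> N1 \<Longrightarrow> b < \<phi>n n x"
        using order_tendstoD(1)[OF lim b(2)] by (auto simp: eventually_sequentially)
      obtain N2 where N2: "\<phi> x < real N2" using reals_Archimedean2 by blast
      have "a < m N x" if "N \<ge> max N1 N2" for N
      proof -
        have "b \<le> (INF n\<in>{max N N0..}. \<phi>n n x)"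
        proof (rule cINF_greatest)
          fix n assume "n \<in> {max N N0..}"
          then show "b \<le> \<phi>n n x" using N1[of n] that by auto
        qed simp
        moreover have "b < real N" using b(2) N2 that by (smt (verit) max.bounded_iff of_nat_le_iff)
        ultimately show ?thesis using b(1) by (simp add: m_def)
      qed
      then show "\<forall>\<^sub>F N in sequentially. a < m N x" unfolding eventually_sequentially by blast
    next
      fix a assume "\<phi> x < a"
      then show "\<forall>\<^sub>F N in sequentially. m N x < a"
        using m_le_\<phi> le_less_trans by (intro always_eventually) blast
    qed
    have Im: "?I (m N) u \<le> liminf (\<lambda>n. ?I (\<phi>n n) (w n))" for N
    proof -
      have iu: "integrable lborel (\<lambda>x. (cmod (fourier_real v x))\<^sup>2 * m N x)" if "v \<in> L2" for v
      proof (rule Bochner_Integration.integrable_bound[OF integrable_mult_right[OF sqint_integrable[OF L2_fourier[OF that]], of "real N"]])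
        show "AE x in lborel. norm ((cmod (fourier_real v x))\<^sup>2 * m N x) \<le> norm (real N * (cmod (fourier_real v x))\<^sup>2)"
          using m_nn m_le by (auto simp: abs_mult mult.commute intro!: mult_right_mono)
      qed (use sqint_meas[OF L2_fourier[OF that]] in measurable)
      define q where "q v = (LINT x|lborel. (cmod (fourier_real v x))\<^sup>2 * m N x)" for v
      have Iq: "?I (m N) v = ennreal (q v)" if "v \<in> L2" for v
        unfolding q_def by (intro nn_integral_eq_integral iu that) (auto simp: m_nn)
      \<comment> \<open>The cross term is an inner product with a fixed element of L2, so weak
        convergence of \<open>w\<close> applies to it; here boundedness of \<open>m N\<close> is
        essential.\<close>
      have cross: "Re (cinner (fourier_real v) (\<lambda>x. of_real (m N x) * fourier_real u x)) = l2_inner v (mult (m N) u)" if "v \<in> L2" for v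
        using l2_inner_mult[OF mul[of N] u that] cinner_commute[of "fourier_real v"]
        by (metis complex_cnj_complex_of_real Re_complex_of_real l2_inner_commute)
      have qu: "q u = l2_inner u (mult (m N) u)"
      proof -
        have "complex_of_real (q u) = cinner (fourier_real u) (\<lambda>x. of_real (m N x) * fourier_real u x)"
          unfolding q_def cinner_def integral_complex_of_real[symmetric] of_real_mult complex_norm_square
          by (simp add: mult_ac)
        then show ?thesis using cross[OF u] by (metis Re_complex_of_real)
      qed
      \<comment> \<open>weak lower semicontinuity of a bounded quadratic form, from expanding a square\<close>
      have low: "2 * l2_inner (w n) (mult (m N) u) - q u \<le> q (w n)" for n
      proof -
        let ?a = "fourier_real (w n)" and ?b = "fourier_real u"
        have "0 \<le> (LINT x|lborel. (cmod (?a x - ?b x))\<^sup>2 * m N x)"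
          by (intro integral_nonneg_AE) (auto simp: m_nn)
        also have "(\<lambda>x. (cmod (?a x - ?b x))\<^sup>2 * m N x) =
            (\<lambda>x. (cmod (?a x))\<^sup>2 * m N x + (cmod (?b x))\<^sup>2 * m N x - 2 * Re (?a x * cnj (of_real (m N x) * ?b x)))"
          by (rule ext) (simp only: cmod_power2, simp add: power2_eq_square algebra_simps)
        also have "(LINT x|lborel. (cmod (?a x))\<^sup>2 * m N x + (cmod (?b x))\<^sup>2 * m N x - 2 * Re (?a x * cnj (of_real (m N x) * ?b x)))
            = q (w n) + q u - 2 * l2_inner (w n) (mult (m N) u)"
        proof -
          have i: "integrable lborel (\<lambda>x. ?a x * cnj (of_real (m N x) * ?b x))"
            by (intro cinner_integrable sqint_multiplier mul L2_fourier u w)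
          show ?thesis
            unfolding cross[OF w, symmetric] cinner_def integral_Re[OF i, symmetric] q_def
            using iu[OF w] iu[OF u] integrable_Re[OF i]
            by (subst Bochner_Integration.integral_diff) (auto simp del: complex_cnj_mult times_complex.simps)
        qed
        finally show ?thesis by linarith
      qed
      have "?I (m N) u = ennreal (2 * l2_inner u (mult (m N) u) - q u)"
        using Iq[OF u] qu by simp
      \<comment> \<open>The lower bounds converge to 2 \<open>q u\<close> - \<open>q u\<close>, that
        is to the energy of \<open>u\<close> for the multiplier \<open>m N\<close>.\<close>
      also have "\<dots> = liminf (\<lambda>n. ennreal (2 * l2_inner (w n) (mult (m N) u) - q u))"
        by (rule lim_imp_Liminf[symmetric])
           (auto intro!: tendsto_ennrealI tendsto_intros weak mult_L2 mul u)
      also have "\<dots> \<le> liminf (\<lambda>n. ?I (\<phi>n n) (w n))"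
      proof (rule Liminf_mono, unfold eventually_sequentially, intro exI allI impI)
        fix n assume n: "max N N0 \<le> n"
        have "ennreal (2 * l2_inner (w n) (mult (m N) u) - q u) \<le> ?I (m N) (w n)"
          unfolding Iq[OF w] by (intro ennreal_leI low)
        also have "\<dots> \<le> ?I (\<phi>n n) (w n)"
          by (intro nn_integral_mono ennreal_leI mult_left_mono m_le_\<phi>n n) auto
        finally show "ennreal (2 * l2_inner (w n) (mult (m N) u) - q u) \<le> ?I (\<phi>n n) (w n)" .
      qed
      finally show ?thesis .
    qed
    have "?I \<phi> u = (\<integral>\<^sup>+ x. liminf (\<lambda>N. ennreal ((cmod (fourier_real u x))\<^sup>2 * m N x)) \<partial>lborel)"
      by (intro nn_integral_cong lim_imp_Liminf[symmetric] tendsto_ennrealI tendsto_intros m_lim) simp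
    also have "\<dots> \<le> liminf (\<lambda>N. ?I (m N) u)"
      by (rule nn_integral_liminf) measurable
    \<comment> \<open>The right-hand side of \<open>Im\<close> does not depend on \<open>N\<close>,
      so it bounds the upper limit over \<open>N\<close> as well.\<close>
    also have "\<dots> \<le> limsup (\<lambda>N. ?I (m N) u)" by (intro Liminf_le_Limsup) simp
    also have "\<dots> \<le> liminf (\<lambda>n. ?I (\<phi>n n) (w n))"
      by (intro Limsup_bounded always_eventually allI Im)
    finally have "enn2ereal (?I \<phi> u) \<le> enn2ereal (liminf (\<lambda>n. ?I (\<phi>n n) (w n)))"
      by (simp add: less_eq_ennreal.rep_eq)
    also have "\<dots> = liminf (\<lambda>n. enn2ereal (?I (\<phi>n n) (w n)))"
      by (rule Liminf_compose_continuous_mono[symmetric])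
         (auto simp: mono_def less_eq_ennreal.rep_eq intro: continuous_on_enn2ereal)
    also have "\<dots> = liminf (\<lambda>n. extended_form (translation_invariant_form (\<phi>n n)) (w n))"
      by (rule Liminf_eq) (auto simp: eventually_sequentially ext_n w intro!: exI[of _ N0])
    finally show "extended_form (translation_invariant_form \<phi>) u \<le> liminf (\<lambda>n. extended_form (translation_invariant_form (\<phi>n n)) (w n))"
      by (simp add: ext_l u)
  }
  {
    \<comment> \<open>The multiplier below turns \<open>\<phi>n\<close> into a function dominated by \<open>\<phi>\<close>, so no diagonal argument is needed.\<close>
    fix u assume u: "u \<in> L2"
    define m where "m n x = (if n \<ge> N0 then min 1 (sqrt (\<phi> x / \<phi>n n x)) else 1)" for n x
    have m01: "0 \<le> m n x" "m n x \<le> 1" for n x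
      by (auto simp: m_def \<phi>_nn \<phi>n_nn)
    have mul: "multiplier (m n)" for n
    proof (rule multiplierI[where C=1])
      show "m n \<in> borel_measurable borel"
        unfolding m_def using \<phi>n_meas[of n] \<phi>_meas by (cases "N0 \<le> n") simp_all
    qed (use m01 in \<open>auto simp: m_def \<phi>_even \<phi>n_even\<close>)
    have bound: "(m n x)\<^sup>2 * \<phi>n n x \<le> \<phi> x" if "n \<ge> N0" for n x
    \<comment> \<open>At a zero of \<phi>n the left side vanishes and nonnegativity of \<phi>
      suffices; elsewhere the square root cancels against the square.\<close>
    proof (cases "\<phi>n n x = 0")
      case False
      then have p: "\<phi>n n x > 0" using \<phi>n_nn[OF that, of x] by simp
      have "m n x \<le> sqrt (\<phi> x / \<phi>n n x)" using that by (simp add: m_def)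
      then have "(m n x)\<^sup>2 \<le> (sqrt (\<phi> x / \<phi>n n x))\<^sup>2" using m01 by (intro power_mono)
      then have "(m n x)\<^sup>2 \<le> \<phi> x / \<phi>n n x" using p \<phi>_nn[of x] by simp
      then show ?thesis using p by (simp add: field_simps)
    qed (use \<phi>_nn in simp)
    have m_lim: "AE x in lborel. (\<lambda>n. m n x) \<longlonglongrightarrow> 1"
      using pos
    proof eventually_elim
      fix x assume x: "0 < \<phi> x"
      have "(\<lambda>n. min 1 (sqrt (\<phi> x / \<phi>n n x))) \<longlonglongrightarrow> min 1 (sqrt (\<phi> x / \<phi> x))"
        using x by (intro tendsto_intros lim) auto
      then have "(\<lambda>n. min 1 (sqrt (\<phi> x / \<phi>n n x))) \<longlonglongrightarrow> 1" using x by simp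
      moreover have "\<forall>\<^sub>F n in sequentially. min 1 (sqrt (\<phi> x / \<phi>n n x)) = m n x"
        by (auto simp: eventually_sequentially m_def)
      ultimately show "(\<lambda>n. m n x) \<longlonglongrightarrow> 1" by (rule Lim_transform_eventually)
    qed
    show "\<exists>w. (\<forall>n. w n \<in> L2) \<and> l2_tendsto w u sequentially \<and>
        limsup (\<lambda>n. extended_form (translation_invariant_form (\<phi>n n)) (w n)) \<le> extended_form (translation_invariant_form \<phi>) u"
    proof (intro exI[of _ "\<lambda>n. mult (m n) u"] conjI allI)
      show w: "mult (m n) u \<in> L2" for n by (intro mult_L2 mul u)
      have "l2conv (\<lambda>n \<xi>. of_real (m n \<xi>) * fourier_real u \<xi>) (\<lambda>\<xi>. of_real 1 * fourier_real u \<xi>) sequentially"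
      proof (rule l2conv_multiplier[where C=1, OF mul _ L2_fourier[OF u] _ m_lim])
        show "\<bar>m k x - 1\<bar> \<le> 1" for k x using m01[of k x] by linarith
      qed simp
      moreover have "sqnorm (\<lambda>\<xi>. fourier_real (mult (m n) u) \<xi> - fourier_real u \<xi>) = sqnorm (\<lambda>\<xi>. of_real (m n \<xi>) * fourier_real u \<xi> - fourier_real u \<xi>)" for n
        using fourier_mult[OF mul u, of n]
        by (intro sqnorm_cong_AE sqint_diff L2_fourier sqint_multiplier mul u w) (auto elim: eventually_mono)
      ultimately show "l2_tendsto (\<lambda>n. mult (m n) u) u sequentially"
        unfolding l2_tendsto_fourier[OF w u] by (simp add: l2conv_def)
      show "limsup (\<lambda>n. extended_form (translation_invariant_form (\<phi>n n)) (mult (m n) u)) \<le> extended_form (translation_invariant_form \<phi>) u"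
      proof (rule Limsup_bounded, unfold eventually_sequentially, intro exI allI impI)
        fix n assume n: "N0 \<le> n"
        have "?I (\<phi>n n) (mult (m n) u) \<le> ?I \<phi> u"
        proof (rule nn_integral_mono_AE, use fourier_mult[OF mul u, of n] in eventually_elim)
          fix x assume "fourier_real (mult (m n) u) x = of_real (m n x) * fourier_real u x"
          then have "(cmod (fourier_real (mult (m n) u) x))\<^sup>2 * \<phi>n n x = (cmod (fourier_real u x))\<^sup>2 * ((m n x)\<^sup>2 * \<phi>n n x)"
            by (simp add: norm_mult power_mult_distrib)
          also have "\<dots> \<le> (cmod (fourier_real u x))\<^sup>2 * \<phi> x"
            by (intro mult_left_mono bound n) auto
          finally show "ennreal ((cmod (fourier_real (mult (m n) u) x))\<^sup>2 * \<phi>n n x) \<le> ennreal ((cmod (fourier_real u x))\<^sup>2 * \<phi> x)"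
            by (rule ennreal_leI)
        qed
        then show "extended_form (translation_invariant_form (\<phi>n n)) (mult (m n) u) \<le> extended_form (translation_invariant_form \<phi>) u"
          by (simp add: ext_n[OF n n] ext_l u w less_eq_ennreal.rep_eq)
      qed
    qed
  }
qed

subsection \<open>The associated semigroup\<close>

context levy_density
begin

definition T :: "real \<Rightarrow> (real \<Rightarrow> real) \<Rightarrow> real \<Rightarrow> real" where
  "T t = mult (\<lambda>\<xi>. exp (- t * \<phi> \<xi>))"

lemma T_L2: "0 < t \<Longrightarrow> u \<in> L2 \<Longrightarrow> T t u \<in> L2"
  unfolding T_def by (intro mult_L2 multiplier_semigroup) auto

lemma fourier_T: "0 < t \<Longrightarrow> u \<in> L2 \<Longrightarrow> AE \<xi> in lborel. fourier_real (T t u) \<xi> = of_real (exp (- t * \<phi> \<xi>)) * fourier_real u \<xi>"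
  unfolding T_def by (intro fourier_mult multiplier_semigroup) auto

lemma T_eqI:
  "0 < t \<Longrightarrow> u \<in> L2 \<Longrightarrow> w \<in> L2 \<Longrightarrow> AE \<xi> in lborel. fourier_real w \<xi> = of_real (exp (- t * \<phi> \<xi>)) * fourier_real u \<xi>
    \<Longrightarrow> AE x in lborel. T t u x = w x"
  unfolding T_def by (intro mult_eqI multiplier_semigroup) auto

text \<open>Stated along sequences because dominated convergence is sequential;
  \<open>at_right 0\<close> is recovered through its sequential characterisation.\<close>

lemma l2conv_semigroup:
  assumes u: "u \<in> L2" and X: "X \<longlonglongrightarrow> 0" "\<And>k. 0 < X k"
  shows "l2conv (\<lambda>k. fourier_real (T (X k) u)) (fourier_real u) sequentially"
proof -
  have "l2conv (\<lambda>k \<xi>. of_real (exp (- X k * \<phi> \<xi>)) * fourier_real u \<xi>) (\<lambda>\<xi>. of_real 1 * fourier_real u \<xi>) sequentially"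
  proof (rule l2conv_multiplier[where C=1, OF multiplier_semigroup _ L2_fourier[OF u]])
    show "\<bar>exp (- X k * \<phi> x) - 1\<bar> \<le> 1" for k x
    proof -
      have "exp (- X k * \<phi> x) \<le> 1" using X(2)[of k] \<phi>_nonneg[of x] by simp
      then show ?thesis using exp_ge_zero[of "- X k * \<phi> x"] by linarith
    qed
    show "AE x in lborel. (\<lambda>k. exp (- X k * \<phi> x)) \<longlonglongrightarrow> 1"
    proof (rule AE_I2)
      fix x
      have "(\<lambda>k. exp (- X k * \<phi> x)) \<longlonglongrightarrow> exp (- 0 * \<phi> x)" by (intro tendsto_intros X)
      then show "(\<lambda>k. exp (- X k * \<phi> x)) \<longlonglongrightarrow> 1" by simp
    qed
  qed (use X(2) in \<open>auto intro: less_imp_le\<close>)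
  moreover have "sqnorm (\<lambda>\<xi>. fourier_real (T (X k) u) \<xi> - fourier_real u \<xi>) =
      sqnorm (\<lambda>\<xi>. of_real (exp (- X k * \<phi> \<xi>)) * fourier_real u \<xi> - fourier_real u \<xi>)" for k
    using fourier_T[OF X(2) u, of k]
    by (intro sqnorm_cong_AE sqint_diff L2_fourier sqint_multiplier multiplier_semigroup less_imp_le X(2) T_L2 u) (auto elim: eventually_mono)
  ultimately show ?thesis by (simp add: l2conv_def)
qed

lemma symmetric_contraction_semigroup_T: "symmetric_contraction_semigroup T"
  unfolding symmetric_contraction_semigroup_def
proof (intro conjI allI impI ballI)
  fix t a b :: real and u v
  assume t: "0 < t" and u: "u \<in> L2" and v: "v \<in> L2"
  show "AE x in lborel. T t (\<lambda>y. a * u y + b * v y) x = a * T t u x + b * T t v x"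
  proof (rule T_eqI[OF t L2_lin[OF u v] L2_lin[OF T_L2[OF t u] T_L2[OF t v]]])
    show "AE \<xi> in lborel. fourier_real (\<lambda>x. a * T t u x + b * T t v x) \<xi> = of_real (exp (- t * \<phi> \<xi>)) * fourier_real (\<lambda>y. a * u y + b * v y) \<xi>"
      using fourier_real_lin[OF T_L2[OF t u] T_L2[OF t v], of a b] fourier_real_lin[OF u v, of a b] fourier_T[OF t u] fourier_T[OF t v]
      by eventually_elim (simp add: algebra_simps)
  qed
  show "l2_inner (T t u) v = l2_inner u (T t v)"
    unfolding T_def using t by (intro l2_inner_mult_commute multiplier_semigroup u v) simp
next
  fix t :: real and u assume t: "0 < t" and u: "u \<in> L2"
  have "sqnorm (fourier_real (T t u)) = sqnorm (\<lambda>\<xi>. of_real (exp (- t * \<phi> \<xi>)) * fourier_real u \<xi>)"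
    by (rule sqnorm_cong_AE[OF L2_fourier[OF T_L2[OF t u]] _ fourier_T[OF t u]])
       (use t in \<open>intro sqint_multiplier multiplier_semigroup L2_fourier u; simp\<close>)
  also have "\<dots> \<le> sqnorm (fourier_real u)"
    using t \<phi>_nonneg
    by (intro sqnorm_mono sqint_multiplier multiplier_semigroup L2_fourier u) (auto simp: norm_mult intro!: mult_left_le_one_le)
  finally show "l2_norm (T t u) \<le> l2_norm u"
    by (simp add: l2_norm_sqnorm sqnorm_fourier L2_sqint T_L2 t u)
next
  fix s t :: real and u assume s: "0 < s" and t: "0 < t" and u: "u \<in> L2"
  have st: "0 < s + t" using s t by simp
  show "AE x in lborel. T s (T t u) x = T (s + t) u x"
  proof (rule T_eqI[OF s T_L2[OF t u] T_L2[OF st u]])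
    show "AE \<xi> in lborel. fourier_real (T (s + t) u) \<xi> = of_real (exp (- s * \<phi> \<xi>)) * fourier_real (T t u) \<xi>"
      using fourier_T[OF t u] fourier_T[OF st u]
      by eventually_elim (simp add: algebra_simps exp_diff exp_minus exp_add divide_inverse)
  qed
next
  fix u assume u: "u \<in> L2"
  show "l2_tendsto (\<lambda>t. T t u) u (at_right 0)"
    unfolding l2_tendsto_iff l2conv_def tendsto_at_iff_sequentially comp_def
  proof (intro allI impI)
    fix X :: "nat \<Rightarrow> real" assume "\<forall>i. X i \<in> {0<..} - {0}" and X: "X \<longlonglongrightarrow> 0"
    then have X0: "\<And>i. 0 < X i" by auto
    show "(\<lambda>k. sqnorm (\<lambda>x. complex_of_real (T (X k) u x) - complex_of_real (u x))) \<longlonglongrightarrow> 0"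
      using iffD1[OF fourier_l2conv_iff[OF L2_sqint[OF T_L2[OF X0 u]] L2_sqint[OF u]] l2conv_semigroup[OF u X X0]]
      unfolding l2conv_def .
  qed
qed (rule T_L2)

text \<open>Convergence of the difference quotients in L2, compared with their pointwise limit on
  the Fourier side, forces the transform of \<open>w\<close> to be -\<phi> times that of
  \<open>u\<close>. Both the domain condition and the formula for the form follow from this
  identity.\<close>

theorem associated_semigroup_T: "associated_semigroup (translation_invariant_form \<phi>) T"
  unfolding associated_semigroup_def
proof (intro conjI allI impI ballI symmetric_contraction_semigroup_T)
  fix u w assume "generator_graph T u w"
  then have u: "u \<in> L2" and w: "w \<in> L2" and gen: "l2_tendsto (\<lambda>t x. (T t u x - u x) / t) w (at_right 0)"
    by (auto simp: generator_graph_def)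
  \<comment> \<open>A countable sequence of times is needed: each formula for the transform of a
    difference quotient has its own null set.\<close>
  define X where "X k = inverse (real (Suc k))" for k
  have X0: "0 < X k" for k by (simp add: X_def)
  have Xne: "X k \<noteq> 0" for k by (simp add: X_def)
  have X: "X \<longlonglongrightarrow> 0" unfolding X_def by (rule LIMSEQ_inverse_real_of_nat)
  note [measurable] = sqint_meas[OF L2_fourier[OF u]] sqint_meas[OF L2_fourier[OF w]]
  define d where "d k = (\<lambda>x. (T (X k) u x - u x) / X k)" for k
  have d: "d k \<in> L2" for k
    using L2_lin[OF T_L2[OF X0 u] u, of "1 / X k" k "- 1 / X k"] by (simp add: d_def diff_divide_distrib)
  have "filterlim X (at_right 0) sequentially"
    using X X0 Xne by (simp add: filterlim_at)
  then have "l2_tendsto d w sequentially"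
    using gen unfolding l2_tendsto_iff d_def by (auto dest: l2conv_compose)
  then have conv: "l2conv (\<lambda>k. fourier_real (d k)) (fourier_real w) sequentially"
    by (simp add: l2_tendsto_fourier d w)
  have fd: "AE \<xi> in lborel. fourier_real (d k) \<xi> = of_real ((exp (- X k * \<phi> \<xi>) - 1) / X k) * fourier_real u \<xi>" for k
    using fourier_real_lin[OF T_L2[OF X0 u] u, of "1 / X k" k "- 1 / X k"] fourier_T[OF X0 u, of k]
    by eventually_elim (use X0[of k] in \<open>simp add: d_def diff_divide_distrib left_diff_distrib\<close>)
  have eq: "AE \<xi> in lborel. fourier_real w \<xi> = - of_real (\<phi> \<xi>) * fourier_real u \<xi>"
  proof -
    have meas: "(\<lambda>\<xi>. - of_real (\<phi> \<xi>) * fourier_real u \<xi> - fourier_real w \<xi>) \<in> borel_measurable borel"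
      by measurable
    have *: "sqint (\<lambda>\<xi>. - of_real (\<phi> \<xi>) * fourier_real u \<xi> - fourier_real w \<xi>) \<and> sqnorm (\<lambda>\<xi>. - of_real (\<phi> \<xi>) * fourier_real u \<xi> - fourier_real w \<xi>) \<le> e"
      if "e > 0" for e
    proof (rule Fatou_sqnorm[where s="\<lambda>k \<xi>. fourier_real (d k) \<xi> - fourier_real w \<xi>"])
      show "\<forall>\<^sub>F k in sequentially. sqnorm (\<lambda>\<xi>. fourier_real (d k) \<xi> - fourier_real w \<xi>) \<le> e"
        using order_tendstoD(2)[OF conv[unfolded l2conv_def] that] by eventually_elim simp
      have "AE \<xi> in lborel. \<forall>k. fourier_real (d k) \<xi> = of_real ((exp (- X k * \<phi> \<xi>) - 1) / X k) * fourier_real u \<xi>"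
        unfolding AE_all_countable using fd by blast
      then show "AE \<xi> in lborel. (\<lambda>k. fourier_real (d k) \<xi> - fourier_real w \<xi>) \<longlonglongrightarrow> - of_real (\<phi> \<xi>) * fourier_real u \<xi> - fourier_real w \<xi>"
      proof eventually_elim
        fix \<xi> assume e: "\<forall>k. fourier_real (d k) \<xi> = of_real ((exp (- X k * \<phi> \<xi>) - 1) / X k) * fourier_real u \<xi>"
        have "((\<lambda>t. exp (- t * \<phi> \<xi>)) has_real_derivative - \<phi> \<xi>) (at 0)"
          by (auto intro!: derivative_eq_intros)
        then have "((\<lambda>t. (exp (- t * \<phi> \<xi>) - 1) / t) \<longlongrightarrow> - \<phi> \<xi>) (at 0)"
          by (simp add: has_field_derivative_iff)
        moreover have "filterlim X (at 0) sequentially"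
          by (intro filterlim_atI X always_eventually allI less_imp_neq[OF X0, symmetric])
        ultimately have "(\<lambda>k. (exp (- X k * \<phi> \<xi>) - 1) / X k) \<longlonglongrightarrow> - \<phi> \<xi>"
          by (rule filterlim_compose)
        then have "(\<lambda>k. complex_of_real ((exp (- X k * \<phi> \<xi>) - 1) / X k)) \<longlonglongrightarrow> of_real (- \<phi> \<xi>)"
          by (rule tendsto_of_real)
        then show "(\<lambda>k. fourier_real (d k) \<xi> - fourier_real w \<xi>) \<longlonglongrightarrow> - of_real (\<phi> \<xi>) * fourier_real u \<xi> - fourier_real w \<xi>"
          unfolding e[rule_format] of_real_minus by (intro tendsto_intros)
      qed
    qed (intro sqint_diff L2_fourier d w meas)+
    have "sqnorm (\<lambda>\<xi>. - of_real (\<phi> \<xi>) * fourier_real u \<xi> - fourier_real w \<xi>) \<le> 0"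
      by (rule field_le_epsilon) (use * in simp)
    then have "sqnorm (\<lambda>\<xi>. - of_real (\<phi> \<xi>) * fourier_real u \<xi> - fourier_real w \<xi>) = 0"
      using sqnorm_nonneg by (simp add: order_antisym)
    then show ?thesis
      using sqnorm_zero_iff[OF conjunct1[OF *[of 1]]] by (auto elim: eventually_mono)
  qed
  show "u \<in> snd (translation_invariant_form \<phi>)"
  proof -
    have "integrable lborel (\<lambda>\<xi>. cmod (fourier_real w \<xi> * cnj (fourier_real u \<xi>)))"
      by (intro integrable_norm cinner_integrable L2_fourier u w)
    then have "(\<integral>\<^sup>+ \<xi>. ennreal (cmod (fourier_real w \<xi> * cnj (fourier_real u \<xi>))) \<partial>lborel) < \<infinity>"
      by (simp add: integrable_iff_bounded)
    \<comment> \<open>The energy density equals the modulus of a product of two square integrable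
      functions, hence is integrable.\<close>
    also have "(\<integral>\<^sup>+ \<xi>. ennreal (cmod (fourier_real w \<xi> * cnj (fourier_real u \<xi>))) \<partial>lborel) =
        (\<integral>\<^sup>+ \<xi>. ennreal ((cmod (fourier_real u \<xi>))\<^sup>2 * \<phi> \<xi>) \<partial>lborel)"
      by (rule nn_integral_cong_AE, use eq in eventually_elim)
         (auto simp: norm_mult power2_eq_square \<phi>_nonneg mult_ac)
    finally show ?thesis using u by (simp add: translation_invariant_form_def)
  qed
  fix v assume "v \<in> snd (translation_invariant_form \<phi>)"
  then have v: "v \<in> L2" by (simp add: translation_invariant_form_def)
  note [measurable] = sqint_meas[OF L2_fourier[OF v]]
  have "complex_of_real (- l2_inner w v) = - cinner (fourier_real w) (fourier_real v)"
    by (simp add: l2_inner_fourier w v)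
  also have "\<dots> = (LINT x|lborel. - (fourier_real w x * cnj (fourier_real v x)))"
    by (simp add: cinner_def)
  also have "\<dots> = (LINT x|lborel. fourier_real u x * cnj (fourier_real v x) * of_real (\<phi> x))"
    by (intro integral_cong_AE, measurable, use eq in eventually_elim) (simp add: mult_ac)
  finally have "Re (LINT x|lborel. fourier_real u x * cnj (fourier_real v x) * of_real (\<phi> x)) = - l2_inner w v"
    by (metis Re_complex_of_real)
  then show "fst (translation_invariant_form \<phi>) u v = - l2_inner w v"
    by (simp add: translation_invariant_form_def)
qed

end

subsection \<open>Transience and recurrence by the heat kernel\<close>

lemma nn_integral_exp_atLeast:
  assumes "0 < (a::real)"
  shows "(\<integral>\<^sup>+ t. ennreal (exp (- t * a)) * indicator {s..} t \<partial>lborel) = ennreal (exp (- s * a) / a)"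
proof -
  have "(\<integral>\<^sup>+ t. ennreal (exp (- t * a)) * indicator {s..} t \<partial>lborel) = ennreal (0 - (- exp (- s * a) / a))"
  proof (rule nn_integral_FTC_atLeast)
    show "((\<lambda>t. - exp (- t * a) / a) has_real_derivative exp (- t * a)) (at t)" for t
      using assms by (auto intro!: derivative_eq_intros)
    have "((\<lambda>t. exp (- (t * a))) \<longlongrightarrow> 0) at_top"
      using assms by real_asymp
    from tendsto_mult_right_zero[OF this, of "- 1 / a"]
    show "((\<lambda>t. - exp (- t * a) / a) \<longlongrightarrow> 0) at_top" by simp
  qed auto
  then show ?thesis by simp
qed

text \<open>Integrability of the multipliers gives a bounded continuous transition density with an
  explicit formula. It supplies the jointly measurable version that \<open>is_green\<close> asks
  for.\<close>

locale levy_kernel = levy_density +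
  assumes exp_int: "0 < t \<Longrightarrow> integrable lborel (\<lambda>\<xi>. exp (- t * \<phi> \<xi>))"
begin

text \<open>The convolution kernel of the semigroup. Evenness of \<phi> leaves only the cosine, and
  2 pi is the product of the two unitary normalisations.\<close>

definition heat_kernel :: "real \<Rightarrow> real \<Rightarrow> real" where
  "heat_kernel t z = (LINT \<xi>|lborel. cos (z * \<xi>) * exp (- t * \<phi> \<xi>)) / (2 * pi)"

lemma heat_kernel_meas [measurable]: "(\<lambda>(t, z). heat_kernel t z) \<in> borel_measurable (borel \<Otimes>\<^sub>M borel)"
  unfolding heat_kernel_def by measurable

lemma heat_kernel_meas_snd [measurable]: "heat_kernel t \<in> borel_measurable borel"
  unfolding heat_kernel_def by measurable

lemma cos_exp_int: "0 < t \<Longrightarrow> integrable lborel (\<lambda>\<xi>. cos (z * \<xi>) * exp (- t * \<phi> \<xi>))"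
  by (rule Bochner_Integration.integrable_bound[OF exp_int]) (auto simp: abs_mult)

lemma heat_kernel_bound: assumes "0 < t" shows "\<bar>heat_kernel t z\<bar> \<le> heat_kernel t 0"
proof -
  have "\<bar>LINT \<xi>|lborel. cos (z * \<xi>) * exp (- t * \<phi> \<xi>)\<bar> \<le> (LINT \<xi>|lborel. \<bar>cos (z * \<xi>) * exp (- t * \<phi> \<xi>)\<bar>)"
    by (rule integral_abs_bound)
  also have "\<dots> \<le> (LINT \<xi>|lborel. cos (0 * \<xi>) * exp (- t * \<phi> \<xi>))"
    using assms by (intro integral_mono integrable_abs cos_exp_int) (auto simp: abs_mult)
  finally show ?thesis by (simp add: heat_kernel_def divide_right_mono)
qed

lemma heat_kernel_tendsto:
  assumes "0 < t" shows "(heat_kernel t \<longlongrightarrow> heat_kernel t z) (at z)"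
  unfolding tendsto_at_iff_sequentially comp_def
proof (intro allI impI)
  fix X :: "nat \<Rightarrow> real" assume X: "X \<longlonglongrightarrow> z"
  have "(\<lambda>i. LINT \<xi>|lborel. cos (X i * \<xi>) * exp (- t * \<phi> \<xi>)) \<longlonglongrightarrow> (LINT \<xi>|lborel. cos (z * \<xi>) * exp (- t * \<phi> \<xi>))"
  proof (rule integral_dominated_convergence[where w="\<lambda>\<xi>. exp (- t * \<phi> \<xi>)"])
    show "AE \<xi> in lborel. (\<lambda>i. cos (X i * \<xi>) * exp (- t * \<phi> \<xi>)) \<longlonglongrightarrow> cos (z * \<xi>) * exp (- t * \<phi> \<xi>)"
      by (intro AE_I2 tendsto_intros X)
  qed (use exp_int[OF assms] in \<open>auto simp: abs_mult\<close>)
  then show "(\<lambda>i. heat_kernel t (X i)) \<longlonglongrightarrow> heat_kernel t z"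
    unfolding heat_kernel_def by (intro tendsto_intros) auto
qed

text \<open>For integrable \<open>u\<close> the transform is bounded, so multiplying by the
  exponential makes it integrable. The inverse transform is then an ordinary integral and Fubini's
  theorem exposes the kernel.\<close>

lemma T_kernel:
  assumes t: "0 < t" and u: "u \<in> L2" and int: "integrable lborel u"
  shows "AE x in lborel. T t u x = (LINT y|lborel. heat_kernel t (x - y) * u y)"
proof -
  let ?e = "\<lambda>\<xi>. exp (- t * \<phi> \<xi>)"
  note [measurable] = borel_measurable_integrable[OF int]
  have cint: "integrable lborel (cr u)" using int by simp
  have fm: "ft (cr u) \<in> borel_measurable borel" by measurable
  \<comment> \<open>By the definition of \<open>inv_fourier\<close>, \<open>T t u\<close> is the
    real part of \<open>fourier g\<close> with \<open>g\<close> below. The version \<open>G\<close>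
    built from \<open>ft\<close> is bounded by an integrable function at every point.\<close>
  define G where "G \<xi> = cnj (of_real (?e \<xi>) * ft (cr u) \<xi>)" for \<xi>
  define g where "g \<xi> = cnj (of_real (?e \<xi>) * fourier_real u \<xi>)" for \<xi>
  have gsq: "sqint g"
    unfolding g_def using t by (intro sqint_cnj sqint_multiplier multiplier_semigroup L2_fourier u) simp
  have Gm: "G \<in> borel_measurable borel" unfolding G_def using fm by measurable
  have gG: "AE \<xi> in lborel. g \<xi> = G \<xi>"
    using fourier_L1[OF L2_sqint[OF u] cint] by eventually_elim (simp add: g_def G_def)
  have Gsq: "sqint G" by (rule sqint_cong_AE[OF gsq Gm gG])
  have Gint: "integrable lborel G"
  proof (rule Bochner_Integration.integrable_bound[OF integrable_mult_right[OF exp_int[OF t], of "LINT x|lborel. cmod (cr u x)"]])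
    show "AE \<xi> in lborel. norm (G \<xi>) \<le> norm ((LINT x|lborel. cmod (cr u x)) * ?e \<xi>)"
    proof (rule AE_I2)
      fix \<xi>
      have "norm (G \<xi>) = cmod (ft (cr u) \<xi>) * ?e \<xi>" by (simp add: G_def norm_mult)
      also have "\<dots> \<le> (LINT x|lborel. cmod (cr u x)) * ?e \<xi>"
        by (intro mult_right_mono norm_ft_le) auto
      finally show "norm (G \<xi>) \<le> norm ((LINT x|lborel. cmod (cr u x)) * ?e \<xi>)" by simp
    qed
  qed (use Gm in simp)
  have "AE x in lborel. fourier g x = ft G x"
    using fourier_cong_AE[OF gsq Gsq gG] fourier_L1[OF Gsq Gint] by eventually_elim simp
  moreover have "T t u x = Re (fourier g x)" for x
    by (simp add: T_def mult_def inv_fourier_def g_def[abs_def])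
  moreover have "Re (ft G x) = (LINT y|lborel. heat_kernel t (x - y) * u y)" for x
  proof -
    let ?s = "complex_of_real (sqrt (2 * pi))"
    let ?F = "\<lambda>\<xi> y. exp (- (\<i> * of_real (\<xi> * (x - y)))) * of_real (?e \<xi> * u y)"
    have s2: "?s * ?s = of_real (2 * pi)" by (simp flip: of_real_mult)
    have inner: "exp (- (\<i> * of_real (\<xi> * x))) * G \<xi> = (LINT y|lborel. ?F \<xi> y) / ?s" for \<xi>
    proof -
      have "cnj (ft (cr u) \<xi>) = (LINT y|lborel. cnj (exp (- (\<i> * of_real (y * \<xi>))) * cr u y)) / ?s"
        unfolding ft_def complex_cnj_divide Bochner_Integration.integral_cnj by simp
      moreover have "G \<xi> = of_real (?e \<xi>) * cnj (ft (cr u) \<xi>)" by (simp add: G_def)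
      ultimately have "exp (- (\<i> * of_real (\<xi> * x))) * G \<xi> =
          (LINT y|lborel. exp (- (\<i> * of_real (\<xi> * x))) * of_real (?e \<xi>) * cnj (exp (- (\<i> * of_real (y * \<xi>))) * cr u y)) / ?s"
        by (simp add: mult_ac del: complex_cnj_mult of_real_mult)
      also have "(LINT y|lborel. exp (- (\<i> * of_real (\<xi> * x))) * of_real (?e \<xi>) * cnj (exp (- (\<i> * of_real (y * \<xi>))) * cr u y)) = (LINT y|lborel. ?F \<xi> y)"
      proof (rule Bochner_Integration.integral_cong[OF refl])
        fix y
        have "exp (- (\<i> * of_real (\<xi> * (x - y)))) = exp (- (\<i> * of_real (\<xi> * x))) * exp (\<i> * of_real (y * \<xi>))"
          by (simp add: exp_add[symmetric] algebra_simps)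
        moreover have "cnj (exp (- (\<i> * of_real (y * \<xi>)))) = exp (\<i> * of_real (y * \<xi>))"
          by (simp add: exp_cnj)
        ultimately show "exp (- (\<i> * of_real (\<xi> * x))) * of_real (?e \<xi>) * cnj (exp (- (\<i> * of_real (y * \<xi>))) * cr u y) = ?F \<xi> y"
          by (simp add: mult_ac)
      qed
      finally show ?thesis .
    qed
    have i2: "integrable (lborel \<Otimes>\<^sub>M lborel) (\<lambda>(\<xi>, y). norm (?e \<xi>) * norm (u y))"
      by (rule integrable_pair_mult[OF exp_int[OF t] int])
    have F: "integrable (lborel \<Otimes>\<^sub>M lborel) (\<lambda>(\<xi>, y). ?F \<xi> y)"
    proof (rule Bochner_Integration.integrable_bound[OF i2])
      show "AE p in lborel \<Otimes>\<^sub>M lborel. norm (case p of (\<xi>, y) \<Rightarrow> ?F \<xi> y) \<le> norm (case p of (\<xi>, y) \<Rightarrow> norm (?e \<xi>) * norm (u y))"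
        by (rule AE_I2) (auto simp: norm_mult norm_exp_neg_i abs_mult simp del: of_real_mult of_real_diff)
    qed measurable
    have F': "integrable (lborel \<Otimes>\<^sub>M lborel) (\<lambda>(y, \<xi>). ?F \<xi> y)"
      using lborel_pair.integrable_product_swap[OF F] by (simp add: case_prod_unfold)
    have iF: "integrable lborel (\<lambda>\<xi>. ?F \<xi> y)" for y
      by (rule Bochner_Integration.integrable_bound[OF integrable_mult_left[OF exp_int[OF t], of "u y"]])
         (auto simp: norm_mult norm_exp_neg_i abs_mult simp del: of_real_mult of_real_diff)
    have "ft G x = (LINT \<xi>|lborel. LINT y|lborel. ?F \<xi> y) / (?s * ?s)"
      unfolding ft_def inner by simp
    also have "(LINT \<xi>|lborel. LINT y|lborel. ?F \<xi> y) = (LINT y|lborel. LINT \<xi>|lborel. ?F \<xi> y)"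
      by (rule lborel_pair.Fubini_integral[OF F, symmetric])
    finally have "Re (ft G x) = Re (LINT y|lborel. LINT \<xi>|lborel. ?F \<xi> y) / (2 * pi)"
      unfolding s2 by (simp only: Re_divide_of_real)
    also have "Re (LINT y|lborel. LINT \<xi>|lborel. ?F \<xi> y) = (LINT y|lborel. Re (LINT \<xi>|lborel. ?F \<xi> y))"
      using lborel_pair.integrable_fst'[OF F'] by (intro integral_Re[symmetric]) simp
    also have "\<dots> = (LINT y|lborel. 2 * pi * heat_kernel t (x - y) * u y)"
    proof (rule Bochner_Integration.integral_cong[OF refl])
      fix y
      have "Re (LINT \<xi>|lborel. ?F \<xi> y) = (LINT \<xi>|lborel. Re (?F \<xi> y))"
        by (rule integral_Re[OF iF, symmetric])
      also have "\<dots> = (LINT \<xi>|lborel. cos ((x - y) * \<xi>) * ?e \<xi> * u y)"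
        by (intro Bochner_Integration.integral_cong refl) (simp add: Re_exp mult_ac)
      finally show "Re (LINT \<xi>|lborel. ?F \<xi> y) = 2 * pi * heat_kernel t (x - y) * u y"
        by (simp add: heat_kernel_def)
    qed
    finally show ?thesis by (simp add: mult.assoc)
  qed
  ultimately show ?thesis by (auto elim: eventually_mono)
qed

lemma indicator_Ioc_L2: "indicat_real {a<..b} \<in> L2"
proof -
  have "cr (indicat_real {a<..b}) = indicator {a<..b}" by (auto simp: indicator_def)
  then show ?thesis by (simp add: sqint_of_real sqint_indicator_Ioc)
qed

lemma indicator_Ioc_int: fixes a b :: real shows "integrable lborel (indicat_real {a<..b})"
proof -
  have "(\<lambda>x. Re (indicator {a<..b} x)) = indicat_real {a<..b}" by (auto simp: indicator_def)
  then show ?thesis using integrable_Re[OF integrable_indicator_Ioc, of a b] by simp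
qed

text \<open>A negative value persists near \<open>z\<close> by continuity. Testing the positive
  multiplier with intervals around 0 and around \<open>z\<close> would then give a negative pairing.
  Continuity is what lifts the sign to every point.\<close>

lemma heat_kernel_nonneg:
  assumes t: "0 < t" shows "0 \<le> heat_kernel t z"
proof (rule ccontr)
  assume "\<not> 0 \<le> heat_kernel t z"
  then have neg: "heat_kernel t z < 0" by simp
  then have "\<forall>\<^sub>F y in at z. heat_kernel t y < heat_kernel t z / 2"
    by (intro order_tendstoD(2)[OF heat_kernel_tendsto[OF t]]) auto
  then obtain d where d: "d > 0" "\<And>y. y \<noteq> z \<Longrightarrow> dist y z < d \<Longrightarrow> heat_kernel t y < heat_kernel t z / 2"
    unfolding eventually_at by auto
  have low: "heat_kernel t y \<le> heat_kernel t z / 2" if "\<bar>y - z\<bar> < d" for y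
    using d(2)[of y] that neg by (cases "y = z") (auto simp: dist_real_def)
  define c where "c = - heat_kernel t z / 2"
  have c: "c > 0" using neg by (simp add: c_def)
  \<comment> \<open>Half-lengths d/4 keep x - y within d/2 of \<open>z\<close>, where the kernel is
    at most -c. Each interval has length d/2, so the pairing is at most -c (d/2)^2.\<close>
  let ?u = "indicat_real {- d/4<..d/4}" and ?v = "indicat_real {z - d/4<..z + d/4}"
  have "0 \<le> Re (complex_of_real (l2_inner (T t ?u) ?v))"
    unfolding T_def l2_inner_mult[OF multiplier_semigroup[OF less_imp_le[OF t]] indicator_Ioc_L2 indicator_Ioc_L2]
    by (intro pos_multD[OF pos_mult_semigroup[OF less_imp_le[OF t]]] indicator_Ioc_L2) auto
  also have "Re (complex_of_real (l2_inner (T t ?u) ?v)) = (LINT x|lborel. T t ?u x * ?v x)"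
    by (simp add: l2_inner_def)
  also have "\<dots> \<le> (LINT x|lborel. - (c * (d/2)) * ?v x)"
  proof (rule integral_mono_AE)
    show "integrable lborel (\<lambda>x. T t ?u x * ?v x)"
    proof -
      have "integrable lborel (\<lambda>x. Re (cr (T t ?u) x * cr ?v x))"
        by (intro integrable_Re sqint_mult_integrable L2_sqint T_L2 t indicator_Ioc_L2)
      then show ?thesis by simp
    qed
    show "integrable lborel (\<lambda>x. - (c * (d/2)) * ?v x)" by (intro integrable_mult_right indicator_Ioc_int)
    show "AE x in lborel. T t ?u x * ?v x \<le> - (c * (d/2)) * ?v x"
      using T_kernel[OF t indicator_Ioc_L2[of "- d/4" "d/4"] indicator_Ioc_int]
    proof eventually_elim
      fix x assume eq: "T t ?u x = (LINT y|lborel. heat_kernel t (x - y) * ?u y)"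
      show "T t ?u x * ?v x \<le> - (c * (d/2)) * ?v x"
      proof (cases "x \<in> {z - d/4<..z + d/4}")
        case True
        have "(LINT y|lborel. heat_kernel t (x - y) * ?u y) \<le> (LINT y|lborel. - c * ?u y)"
        proof (rule integral_mono)
          show "integrable lborel (\<lambda>y. heat_kernel t (x - y) * ?u y)"
            by (rule Bochner_Integration.integrable_bound[OF integrable_mult_right[OF indicator_Ioc_int, of "heat_kernel t 0"]])
               (use heat_kernel_bound[OF t] in \<open>auto simp: abs_mult intro!: mult_right_mono order_trans[OF _ abs_ge_self]\<close>)
          show "integrable lborel (\<lambda>y. - c * ?u y)" by (intro integrable_mult_right indicator_Ioc_int)
          fix y
          show "heat_kernel t (x - y) * ?u y \<le> - c * ?u y"
          proof (cases "y \<in> {- d/4<..d/4}")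
            case y: True
            have "\<bar>x - y - z\<bar> < d" using True y d(1) by auto
            from low[OF this] show ?thesis using y by (simp add: c_def)
          qed simp
        qed
        also have "\<dots> = - (c * (d/2))" using d(1) by simp
        finally show ?thesis using True eq by simp
      qed simp
    qed
  qed
  also have "\<dots> = - (c * (d/2)) * (d/2)" using d(1) by simp
  also have "\<dots> < 0" using c d(1) by simp
  finally show False by simp
qed

definition heat_op :: "real \<Rightarrow> (real \<Rightarrow> real) \<Rightarrow> real \<Rightarrow> ennreal" where
  "heat_op t f x = (\<integral>\<^sup>+ y. ennreal (heat_kernel t (x - y)) * ennreal (f y) \<partial>lborel)"

text \<open>Nonnegativity of the kernel makes the images of the truncations increase, so monotone
  convergence applies. The formula for all truncations is first placed outside one common null
  set.\<close>

lemma semigroup_L1_T: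
  assumes t: "0 < t" and f: "integrable lborel f" "\<And>x. 0 \<le> f x"
  shows "AE x in lborel. heat_op t f x = semigroup_L1 T t f x"
proof -
  note [measurable] = borel_measurable_integrable[OF f(1)]
  define fk where "fk k y = min (f y) (real k)" for k y
  have [measurable]: "fk k \<in> borel_measurable borel" for k unfolding fk_def by measurable
  have fk0: "0 \<le> fk k y" "fk k y \<le> f y" "fk k y \<le> real k" for k y using f(2)[of y] by (auto simp: fk_def)
  have fk1: "integrable lborel (fk k)" for k
    by (rule Bochner_Integration.integrable_bound[OF f(1)]) (use fk0 f(2) in auto)
  have fk2: "fk k \<in> L2" for k
  proof -
    have "integrable lborel (\<lambda>y. (fk k y)\<^sup>2)"
      by (rule Bochner_Integration.integrable_bound[OF integrable_mult_right[OF f(1), of "real k"]])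
         (use fk0 f(2) in \<open>auto simp: power2_eq_square abs_mult intro!: mult_mono\<close>)
    then show ?thesis by (simp add: L2_def)
  qed
  have "AE x in lborel. \<forall>k. T t (fk k) x = (LINT y|lborel. heat_kernel t (x - y) * fk k y)"
    unfolding AE_all_countable using T_kernel[OF t fk2 fk1] by blast
  then show ?thesis
  proof eventually_elim
    fix x assume eq: "\<forall>k. T t (fk k) x = (LINT y|lborel. heat_kernel t (x - y) * fk k y)"
    have "ennreal (T t (fk k) x) = (\<integral>\<^sup>+ y. ennreal (heat_kernel t (x - y) * fk k y) \<partial>lborel)" for k
    proof -
      have "integrable lborel (\<lambda>y. heat_kernel t (x - y) * fk k y)"
        by (rule Bochner_Integration.integrable_bound[OF integrable_mult_right[OF fk1[of k], of "heat_kernel t 0"]])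
           (use heat_kernel_bound[OF t] fk0 in \<open>auto simp: abs_mult intro!: mult_right_mono order_trans[OF _ abs_ge_self]\<close>)
      then show ?thesis
        unfolding eq[rule_format] by (intro nn_integral_eq_integral[symmetric]) (auto simp: heat_kernel_nonneg[OF t] fk0)
    qed
    then have "semigroup_L1 T t f x = (SUP k. \<integral>\<^sup>+ y. ennreal (heat_kernel t (x - y) * fk k y) \<partial>lborel)"
      by (simp add: semigroup_L1_def fk_def[abs_def])
    also have "\<dots> = (\<integral>\<^sup>+ y. (SUP k. ennreal (heat_kernel t (x - y) * fk k y)) \<partial>lborel)"
    proof (rule nn_integral_monotone_convergence_SUP[symmetric])
      show "incseq (\<lambda>k y. ennreal (heat_kernel t (x - y) * fk k y))"
        by (intro incseq_SucI le_funI ennreal_leI mult_left_mono heat_kernel_nonneg[OF t]) (auto simp: fk_def)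
    qed measurable
    also have "\<dots> = heat_op t f x"
      unfolding heat_op_def
    proof (rule nn_integral_cong)
      fix y
      have inc: "incseq (\<lambda>k. ennreal (heat_kernel t (x - y) * fk k y))"
        by (intro incseq_SucI ennreal_leI mult_left_mono heat_kernel_nonneg[OF t]) (auto simp: fk_def)
      obtain N where N: "f y < real N" using reals_Archimedean2 by blast
      have "fk k y = f y" if "k \<ge> N" for k
        using that N of_nat_mono[OF that, where 'a=real] by (simp add: fk_def)
      then have "\<forall>\<^sub>F k in sequentially. ennreal (heat_kernel t (x - y) * f y) = ennreal (heat_kernel t (x - y) * fk k y)"
        unfolding eventually_sequentially by (intro exI[of _ N]) simp
      then have "(\<lambda>k. ennreal (heat_kernel t (x - y) * fk k y)) \<longlonglongrightarrow> ennreal (heat_kernel t (x - y) * f y)"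
        by (rule Lim_transform_eventually[OF tendsto_const])
      from LIMSEQ_unique[OF LIMSEQ_SUP[OF inc] this]
      show "(SUP k. ennreal (heat_kernel t (x - y) * fk k y)) = ennreal (heat_kernel t (x - y)) * ennreal (f y)"
        by (simp add: ennreal_mult heat_kernel_nonneg[OF t] f(2))
    qed
    finally show "heat_op t f x = semigroup_L1 T t f x" by simp
  qed
qed

definition green :: "(real \<Rightarrow> real) \<Rightarrow> real \<Rightarrow> ennreal" where
  "green f x = (\<integral>\<^sup>+ t. heat_op t f x * indicator {0<..} t \<partial>lborel)"

lemma is_green_T:
  assumes f: "integrable lborel f" "\<And>x. 0 \<le> f x"
  shows "is_green T f (green f)"
  unfolding is_green_def
proof (intro bexI[of _ "\<lambda>(t, x). heat_op t f x"] conjI allI impI)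
  note [measurable] = borel_measurable_integrable[OF f(1)]
  show "AE x in lborel. (case (t, x) of (t, x) \<Rightarrow> heat_op t f x) = semigroup_L1 T t f x" if "t > 0" for t
    using semigroup_L1_T[OF that f] by simp
  show "(\<lambda>(t, x). heat_op t f x) \<in> borel_measurable (lborel \<Otimes>\<^sub>M lborel)"
    unfolding heat_op_def by measurable
qed (simp add: green_def)

text \<open>
  The potential is tested against a Gaussian, whose characteristic function makes the integral over
  time explicit.
\<close>

theorem transient_translation_invariant:
  assumes pos: "AE \<xi> in lborel. 0 < \<phi> \<xi>"
    and fin: "(\<integral>\<^sup>+ \<xi>. ennreal (exp (- \<xi>\<^sup>2 / 2) / \<phi> \<xi>) \<partial>lborel) < \<infinity>"
  shows "transient_form (translation_invariant_form \<phi>)"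
  unfolding transient_form_def
proof (intro exI[of _ T] conjI associated_semigroup_T allI impI)
  fix f :: "real \<Rightarrow> real" assume "integrable lborel f \<and> (\<forall>x. 0 \<le> f x)"
  then have f: "integrable lborel f" "\<And>x. 0 \<le> f x" by auto
  note [measurable] = borel_measurable_integrable[OF f(1)]
  let ?\<psi> = std_normal_density
  have \<psi>0: "0 < ?\<psi> x" for x by (simp add: normal_density_pos)
  have [measurable]: "?\<psi> \<in> borel_measurable borel" by simp
  have \<psi>int: "integrable lborel ?\<psi>" by simp
  \<comment> \<open>The shift by \<open>y\<close> contributes only a phase of modulus 1, so the
    bound is uniform in \<open>y\<close> and the integral of \<open>f\<close> will factor out. The
    factor 1 / (2 pi) is estimated by 1.\<close>
  have key: "(\<integral>\<^sup>+ x. ennreal (heat_kernel t (x - y)) * ennreal (?\<psi> x) \<partial>lborel) \<le> (\<integral>\<^sup>+ \<xi>. ennreal (exp (- t * \<phi> \<xi>) * exp (- \<xi>\<^sup>2 / 2)) \<partial>lborel)"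
    if t: "0 < t" for t y
  proof -
    let ?e = "\<lambda>\<xi>. exp (- t * \<phi> \<xi>)"
    have i1: "integrable lborel (\<lambda>x. heat_kernel t (x - y) * ?\<psi> x)"
      by (rule Bochner_Integration.integrable_bound[OF integrable_mult_right[OF \<psi>int, of "heat_kernel t 0"]])
         (use heat_kernel_bound[OF t] \<psi>0 in \<open>auto simp: abs_mult intro!: mult_right_mono order_trans[OF _ abs_ge_self]\<close>)
    have i2: "integrable (lborel \<Otimes>\<^sub>M lborel) (\<lambda>(x, \<xi>). norm (?\<psi> x) * norm (?e \<xi>))"
      by (rule integrable_pair_mult[OF \<psi>int exp_int[OF t]])
    have F: "integrable (lborel \<Otimes>\<^sub>M lborel) (\<lambda>(x, \<xi>). cos ((x - y) * \<xi>) * ?e \<xi> * ?\<psi> x)"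
    proof (rule Bochner_Integration.integrable_bound[OF i2])
      show "AE p in lborel \<Otimes>\<^sub>M lborel. norm (case p of (x, \<xi>) \<Rightarrow> cos ((x - y) * \<xi>) * ?e \<xi> * ?\<psi> x) \<le> norm (case p of (x, \<xi>) \<Rightarrow> norm (?\<psi> x) * norm (?e \<xi>))"
      proof (rule AE_I2, clarsimp simp only: split_beta)
        fix x \<xi> :: real
        have "\<bar>cos ((x - y) * \<xi>)\<bar> * (?e \<xi> * ?\<psi> x) \<le> 1 * (?e \<xi> * ?\<psi> x)"
          using less_imp_le[OF \<psi>0[of x]] by (intro mult_right_mono) auto
        then show "norm (cos ((x - y) * \<xi>) * ?e \<xi> * ?\<psi> x) \<le> norm (norm (?\<psi> x) * norm (?e \<xi>))"
          using less_imp_le[OF \<psi>0[of x]] by (simp add: abs_mult mult_ac)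
      qed
    qed measurable
    have c: "\<bar>LINT x|lborel. cos ((x - y) * \<xi>) * ?\<psi> x\<bar> \<le> exp (- \<xi>\<^sup>2 / 2)" for \<xi>
    proof -
      have i: "integrable lborel (\<lambda>x. ?\<psi> x *\<^sub>R iexp (\<xi> * x))"
        by (rule Bochner_Integration.integrable_bound[OF \<psi>int]) auto
      have "char std_normal_distribution \<xi> = (LINT x|lborel. ?\<psi> x *\<^sub>R iexp (\<xi> * x))"
        unfolding char_def using \<psi>0 by (intro integral_density) (auto intro: less_imp_le)
      then have ch: "(LINT x|lborel. ?\<psi> x *\<^sub>R iexp (\<xi> * x)) = of_real (exp (- \<xi>\<^sup>2 / 2))"
        by (simp add: char_std_normal_distribution)
      have "(LINT x|lborel. cos ((x - y) * \<xi>) * ?\<psi> x) = (LINT x|lborel. Re (exp (- (\<i> * of_real (y * \<xi>))) * (?\<psi> x *\<^sub>R iexp (\<xi> * x))))"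
      proof (rule Bochner_Integration.integral_cong[OF refl])
        fix x
        have "exp (- (\<i> * of_real (y * \<xi>))) * iexp (\<xi> * x) = iexp ((x - y) * \<xi>)"
          by (simp add: exp_add[symmetric] algebra_simps)
        then have "exp (- (\<i> * of_real (y * \<xi>))) * (?\<psi> x *\<^sub>R iexp (\<xi> * x)) = ?\<psi> x *\<^sub>R iexp ((x - y) * \<xi>)"
          by (simp only: mult_scaleR_right)
        moreover have "Re (iexp ((x - y) * \<xi>)) = cos ((x - y) * \<xi>)" by (simp add: Re_exp)
        ultimately show "cos ((x - y) * \<xi>) * ?\<psi> x = Re (exp (- (\<i> * of_real (y * \<xi>))) * (?\<psi> x *\<^sub>R iexp (\<xi> * x)))"
          by (simp only: scaleR_complex.sel mult.commute)
      qed
      also have "\<dots> = Re (LINT x|lborel. exp (- (\<i> * of_real (y * \<xi>))) * (?\<psi> x *\<^sub>R iexp (\<xi> * x)))"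
        by (intro integral_Re integrable_mult_right i)
      also have "\<dots> = Re (exp (- (\<i> * of_real (y * \<xi>))) * of_real (exp (- \<xi>\<^sup>2 / 2)))"
        unfolding integral_mult_right_zero ch ..
      finally have "\<bar>LINT x|lborel. cos ((x - y) * \<xi>) * ?\<psi> x\<bar> \<le> cmod (exp (- (\<i> * of_real (y * \<xi>))) * of_real (exp (- \<xi>\<^sup>2 / 2)))"
        by (simp only: abs_Re_le_cmod)
      also have "\<dots> = exp (- \<xi>\<^sup>2 / 2)"
        unfolding norm_mult norm_exp_neg_i norm_of_real by simp
      finally show ?thesis .
    qed
    have "(LINT x|lborel. heat_kernel t (x - y) * ?\<psi> x) = (LINT x|lborel. LINT \<xi>|lborel. cos ((x - y) * \<xi>) * ?e \<xi> * ?\<psi> x) / (2 * pi)"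
      by (simp add: heat_kernel_def)
    also have "(LINT x|lborel. LINT \<xi>|lborel. cos ((x - y) * \<xi>) * ?e \<xi> * ?\<psi> x) = (LINT \<xi>|lborel. LINT x|lborel. cos ((x - y) * \<xi>) * ?e \<xi> * ?\<psi> x)"
      by (rule lborel_pair.Fubini_integral[OF F, symmetric])
    also have "\<dots> = (LINT \<xi>|lborel. ?e \<xi> * (LINT x|lborel. cos ((x - y) * \<xi>) * ?\<psi> x))"
      by (simp add: mult_ac flip: integral_mult_right_zero)
    also have "\<dots> / (2 * pi) \<le> (LINT \<xi>|lborel. ?e \<xi> * exp (- \<xi>\<^sup>2 / 2)) / 1"
    proof (rule frac_le)
      have i3: "integrable lborel (\<lambda>\<xi>. ?e \<xi> * exp (- \<xi>\<^sup>2 / 2))"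
        by (rule Bochner_Integration.integrable_bound[OF exp_int[OF t]]) auto
      show "(LINT \<xi>|lborel. ?e \<xi> * (LINT x|lborel. cos ((x - y) * \<xi>) * ?\<psi> x)) \<le> (LINT \<xi>|lborel. ?e \<xi> * exp (- \<xi>\<^sup>2 / 2))"
      proof (rule integral_mono'[OF i3])
        fix \<xi>
        show "?e \<xi> * (LINT x|lborel. cos ((x - y) * \<xi>) * ?\<psi> x) \<le> ?e \<xi> * exp (- \<xi>\<^sup>2 / 2)"
          using c[of \<xi>] by (intro mult_left_mono) (auto simp: abs_le_iff)
      qed simp
      show "0 \<le> (LINT \<xi>|lborel. ?e \<xi> * exp (- \<xi>\<^sup>2 / 2))" by (intro integral_nonneg_AE) auto
    qed (use pi_gt3 in auto)
    finally have le: "(LINT x|lborel. heat_kernel t (x - y) * ?\<psi> x) \<le> (LINT \<xi>|lborel. ?e \<xi> * exp (- \<xi>\<^sup>2 / 2))" by simp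
    have "(\<integral>\<^sup>+ x. ennreal (heat_kernel t (x - y)) * ennreal (?\<psi> x) \<partial>lborel) = (\<integral>\<^sup>+ x. ennreal (heat_kernel t (x - y) * ?\<psi> x) \<partial>lborel)"
      by (intro nn_integral_cong ennreal_mult[symmetric] heat_kernel_nonneg[OF t] less_imp_le[OF \<psi>0])
    also have "\<dots> = ennreal (LINT x|lborel. heat_kernel t (x - y) * ?\<psi> x)"
      by (intro nn_integral_eq_integral i1 AE_I2 mult_nonneg_nonneg heat_kernel_nonneg[OF t] less_imp_le[OF \<psi>0])
    also have "\<dots> \<le> ennreal (LINT \<xi>|lborel. ?e \<xi> * exp (- \<xi>\<^sup>2 / 2))" by (rule ennreal_leI[OF le])
    also have "\<dots> = (\<integral>\<^sup>+ \<xi>. ennreal (?e \<xi> * exp (- \<xi>\<^sup>2 / 2)) \<partial>lborel)"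
      by (intro nn_integral_eq_integral[symmetric] Bochner_Integration.integrable_bound[OF exp_int[OF t]]) auto
    finally show ?thesis .
  qed
  let ?G = "\<integral>\<^sup>+ \<xi>. ennreal (exp (- \<xi>\<^sup>2 / 2) / \<phi> \<xi>) \<partial>lborel"
  let ?F = "\<integral>\<^sup>+ y. ennreal (f y) \<partial>lborel"
  have "(\<integral>\<^sup>+ x. green f x * ennreal (?\<psi> x) \<partial>lborel) =
      (\<integral>\<^sup>+ x. \<integral>\<^sup>+ t. \<integral>\<^sup>+ y. ennreal (heat_kernel t (x - y)) * ennreal (?\<psi> x) * (ennreal (f y) * indicator {0<..} t) \<partial>lborel \<partial>lborel \<partial>lborel)"
  proof (rule nn_integral_cong)
    fix x
    have "green f x * ennreal (?\<psi> x) = (\<integral>\<^sup>+ t. heat_op t f x * indicator {0<..} t * ennreal (?\<psi> x) \<partial>lborel)"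
      unfolding green_def heat_op_def by (rule nn_integral_multc[symmetric]) measurable
    also have "\<dots> = (\<integral>\<^sup>+ t. \<integral>\<^sup>+ y. ennreal (heat_kernel t (x - y)) * ennreal (f y) * (indicator {0<..} t * ennreal (?\<psi> x)) \<partial>lborel \<partial>lborel)"
      unfolding heat_op_def mult.assoc[of "integral\<^sup>N _ _"] by (intro nn_integral_cong nn_integral_multc[symmetric]) measurable
    finally show "green f x * ennreal (?\<psi> x) = (\<integral>\<^sup>+ t. \<integral>\<^sup>+ y. ennreal (heat_kernel t (x - y)) * ennreal (?\<psi> x) * (ennreal (f y) * indicator {0<..} t) \<partial>lborel \<partial>lborel)"
      by (simp add: mult_ac)
  qed
  also have "\<dots> = (\<integral>\<^sup>+ t. \<integral>\<^sup>+ x. \<integral>\<^sup>+ y. ennreal (heat_kernel t (x - y)) * ennreal (?\<psi> x) * (ennreal (f y) * indicator {0<..} t) \<partial>lborel \<partial>lborel \<partial>lborel)"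
    by (rule lborel_pair.Fubini') measurable
  also have "\<dots> = (\<integral>\<^sup>+ t. \<integral>\<^sup>+ y. \<integral>\<^sup>+ x. ennreal (heat_kernel t (x - y)) * ennreal (?\<psi> x) * (ennreal (f y) * indicator {0<..} t) \<partial>lborel \<partial>lborel \<partial>lborel)"
    by (intro nn_integral_cong lborel_pair.Fubini') measurable
  also have "\<dots> = (\<integral>\<^sup>+ t. \<integral>\<^sup>+ y. (\<integral>\<^sup>+ x. ennreal (heat_kernel t (x - y)) * ennreal (?\<psi> x) \<partial>lborel) * (ennreal (f y) * indicator {0<..} t) \<partial>lborel \<partial>lborel)"
    by (intro nn_integral_cong nn_integral_multc) measurable
  also have "\<dots> \<le> (\<integral>\<^sup>+ t. \<integral>\<^sup>+ y. (\<integral>\<^sup>+ \<xi>. ennreal (exp (- t * \<phi> \<xi>) * exp (- \<xi>\<^sup>2 / 2)) \<partial>lborel) * (ennreal (f y) * indicator {0<..} t) \<partial>lborel \<partial>lborel)"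
  proof (intro nn_integral_mono)
    fix t y :: real
    show "(\<integral>\<^sup>+ x. ennreal (heat_kernel t (x - y)) * ennreal (?\<psi> x) \<partial>lborel) * (ennreal (f y) * indicator {0<..} t)
        \<le> (\<integral>\<^sup>+ \<xi>. ennreal (exp (- t * \<phi> \<xi>) * exp (- \<xi>\<^sup>2 / 2)) \<partial>lborel) * (ennreal (f y) * indicator {0<..} t)"
    proof (cases "0 < t")
      case True
      show ?thesis by (rule mult_right_mono[OF key[OF True]]) simp
    qed simp
  qed
  also have "\<dots> = (\<integral>\<^sup>+ t. \<integral>\<^sup>+ \<xi>. ?F * (ennreal (exp (- t * \<phi> \<xi>) * exp (- \<xi>\<^sup>2 / 2)) * indicator {0<..} t) \<partial>lborel \<partial>lborel)"
    by (simp add: nn_integral_cmult nn_integral_multc mult_ac)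
  also have "\<dots> = (\<integral>\<^sup>+ \<xi>. \<integral>\<^sup>+ t. ?F * (ennreal (exp (- t * \<phi> \<xi>) * exp (- \<xi>\<^sup>2 / 2)) * indicator {0<..} t) \<partial>lborel \<partial>lborel)"
    by (rule lborel_pair.Fubini') measurable
  also have "\<dots> \<le> (\<integral>\<^sup>+ \<xi>. ?F * ennreal (exp (- \<xi>\<^sup>2 / 2) / \<phi> \<xi>) \<partial>lborel)"
  proof (rule nn_integral_mono_AE, use pos in eventually_elim)
    fix \<xi> assume p: "0 < \<phi> \<xi>"
    have "(\<integral>\<^sup>+ t. ?F * (ennreal (exp (- t * \<phi> \<xi>) * exp (- \<xi>\<^sup>2 / 2)) * indicator {0<..} t) \<partial>lborel)
        \<le> (\<integral>\<^sup>+ t. ?F * ennreal (exp (- \<xi>\<^sup>2 / 2)) * (ennreal (exp (- t * \<phi> \<xi>)) * indicator {0..} t) \<partial>lborel)"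
      by (intro nn_integral_mono) (auto simp: ennreal_mult mult_ac split: split_indicator)
    also have "\<dots> = ?F * ennreal (exp (- \<xi>\<^sup>2 / 2)) * ennreal (exp (- 0 * \<phi> \<xi>) / \<phi> \<xi>)"
      by (subst nn_integral_cmult) (simp_all only: nn_integral_exp_atLeast[OF p], measurable)
    also have "\<dots> = ?F * ennreal (exp (- \<xi>\<^sup>2 / 2) / \<phi> \<xi>)"
      using p by (simp add: mult.assoc ennreal_mult[symmetric])
    finally show "(\<integral>\<^sup>+ t. ?F * (ennreal (exp (- t * \<phi> \<xi>) * exp (- \<xi>\<^sup>2 / 2)) * indicator {0<..} t) \<partial>lborel)
        \<le> ?F * ennreal (exp (- \<xi>\<^sup>2 / 2) / \<phi> \<xi>)" .
  qed
  also have "\<dots> = ?F * ?G" by (simp add: nn_integral_cmult)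
  also have "\<dots> < \<infinity>"
    using fin f by (simp add: ennreal_mult_less_top nn_integral_eq_integral[OF f(1)])
  finally have lt: "(\<integral>\<^sup>+ x. green f x * ennreal (?\<psi> x) \<partial>lborel) < \<infinity>" .
  have gm: "green f \<in> borel_measurable borel" unfolding green_def heat_op_def by measurable
  have "AE x in lborel. green f x * ennreal (?\<psi> x) \<noteq> \<infinity>"
    by (rule nn_integral_PInf_AE) (use gm lt in \<open>auto simp: less_top\<close>)
  \<comment> \<open>The Gaussian is positive everywhere, so finiteness of the product passes to the
    potential.\<close>
  then have "AE x in lborel. green f x < \<infinity>"
  proof eventually_elim
    fix x assume *: "green f x * ennreal (?\<psi> x) \<noteq> \<infinity>"
    then show "green f x < \<infinity>"
      using \<psi>0[of x] by (cases "green f x") (auto simp: ennreal_top_mult ennreal_eq_0_iff)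
  qed
  then show "\<exists>g. is_green T f g \<and> (AE x in lborel. g x < \<infinity>)"
    using is_green_T[OF f] by blast
qed

text \<open>
  Only times \<open>t \<ge> 1\<close> are used: then \<open>heat_kernel t 0 - heat_kernel t z\<close> is integrable in time, whereas
  \<open>heat_kernel t 0\<close> is not. This makes the potential infinite at every point, and not only almost
  everywhere. Restricting to \<open>t \<ge> 1\<close> is essential, since \<open>1 / \<phi>\<close> need not be integrable at infinity.
\<close>

theorem recurrent_translation_invariant:
  assumes pos: "AE \<xi> in lborel. 0 < \<phi> \<xi>"
    and inf: "(\<integral>\<^sup>+ \<xi>. ennreal (exp (- \<phi> \<xi>) / \<phi> \<xi>) \<partial>lborel) = \<infinity>"
    and fin: "\<And>z. (\<integral>\<^sup>+ \<xi>. ennreal ((1 - cos (z * \<xi>)) * (exp (- \<phi> \<xi>) / \<phi> \<xi>)) \<partial>lborel) < \<infinity>"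
  shows "recurrent_form (translation_invariant_form \<phi>)"
  unfolding recurrent_form_def
proof (intro exI[of _ T] conjI associated_semigroup_T allI impI)
  \<comment> \<open>Integrating \<open>exp (- t * \<phi> \<xi>)\<close> over t \<ge> 1 is the origin
    of the quotient in the hypotheses. The weight \<open>c\<close> will be 1 and 1 - cos.\<close>
  have time: "(\<integral>\<^sup>+ t. (\<integral>\<^sup>+ \<xi>. ennreal (c \<xi> * exp (- t * \<phi> \<xi>)) \<partial>lborel) * indicator {1..} t \<partial>lborel) = (\<integral>\<^sup>+ \<xi>. ennreal (c \<xi> * (exp (- \<phi> \<xi>) / \<phi> \<xi>)) \<partial>lborel)"
    if [measurable]: "c \<in> borel_measurable borel" and c: "\<And>\<xi>. 0 \<le> c \<xi>" for c
  proof -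
    have "(\<integral>\<^sup>+ t. (\<integral>\<^sup>+ \<xi>. ennreal (c \<xi> * exp (- t * \<phi> \<xi>)) \<partial>lborel) * indicator {1..} t \<partial>lborel)
        = (\<integral>\<^sup>+ t. \<integral>\<^sup>+ \<xi>. ennreal (c \<xi>) * (ennreal (exp (- t * \<phi> \<xi>)) * indicator {1..} t) \<partial>lborel \<partial>lborel)"
      by (subst nn_integral_multc[symmetric]) (auto simp: ennreal_mult c mult_ac)
    also have "\<dots> = (\<integral>\<^sup>+ \<xi>. \<integral>\<^sup>+ t. ennreal (c \<xi>) * (ennreal (exp (- t * \<phi> \<xi>)) * indicator {1..} t) \<partial>lborel \<partial>lborel)"
      by (rule lborel_pair.Fubini') measurable
    also have "\<dots> = (\<integral>\<^sup>+ \<xi>. ennreal (c \<xi> * (exp (- \<phi> \<xi>) / \<phi> \<xi>)) \<partial>lborel)"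
    proof (rule nn_integral_cong_AE, use pos in eventually_elim)
      fix \<xi> assume p: "0 < \<phi> \<xi>"
      have "(\<integral>\<^sup>+ t. ennreal (c \<xi>) * (ennreal (exp (- t * \<phi> \<xi>)) * indicator {1..} t) \<partial>lborel) = ennreal (c \<xi>) * ennreal (exp (- 1 * \<phi> \<xi>) / \<phi> \<xi>)"
        by (subst nn_integral_cmult) (simp_all only: nn_integral_exp_atLeast[OF p], measurable)
      then show "(\<integral>\<^sup>+ t. ennreal (c \<xi>) * (ennreal (exp (- t * \<phi> \<xi>)) * indicator {1..} t) \<partial>lborel) = ennreal (c \<xi> * (exp (- \<phi> \<xi>) / \<phi> \<xi>))"
        using p c[of \<xi>] by (simp add: ennreal_mult[symmetric])
    qed
    finally show ?thesis .
  qed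
  have pot: "(\<integral>\<^sup>+ t. ennreal (heat_kernel t z) * indicator {0<..} t \<partial>lborel) = \<infinity>" for z
  proof -
    \<comment> \<open>Written as a sum to avoid subtraction in \<open>ennreal\<close>. After
      integration in time the left side is infinite and the last term finite, so the kernel term is
      infinite.\<close>
    have split: "(\<integral>\<^sup>+ \<xi>. ennreal (1 * exp (- t * \<phi> \<xi>)) \<partial>lborel) = ennreal (2 * pi) * ennreal (heat_kernel t z) + (\<integral>\<^sup>+ \<xi>. ennreal ((1 - cos (z * \<xi>)) * exp (- t * \<phi> \<xi>)) \<partial>lborel)"
      if t: "0 < t" for t
    proof -
      have i: "integrable lborel (\<lambda>\<xi>. (1 - cos (z * \<xi>)) * exp (- t * \<phi> \<xi>))"
        using Bochner_Integration.integrable_diff[OF exp_int[OF t] cos_exp_int[OF t, of z]] by (simp add: left_diff_distrib)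
      have "(LINT \<xi>|lborel. exp (- t * \<phi> \<xi>)) = 2 * pi * heat_kernel t z + (LINT \<xi>|lborel. (1 - cos (z * \<xi>)) * exp (- t * \<phi> \<xi>))"
        using exp_int[OF t] cos_exp_int[OF t, of z] by (simp add: left_diff_distrib heat_kernel_def)
      moreover have "(\<integral>\<^sup>+ \<xi>. ennreal (1 * exp (- t * \<phi> \<xi>)) \<partial>lborel) = ennreal (LINT \<xi>|lborel. exp (- t * \<phi> \<xi>))"
        using exp_int[OF t] by (simp add: nn_integral_eq_integral)
      moreover have "(\<integral>\<^sup>+ \<xi>. ennreal ((1 - cos (z * \<xi>)) * exp (- t * \<phi> \<xi>)) \<partial>lborel) = ennreal (LINT \<xi>|lborel. (1 - cos (z * \<xi>)) * exp (- t * \<phi> \<xi>))"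
        by (intro nn_integral_eq_integral i AE_I2 mult_nonneg_nonneg) auto
      moreover have "0 \<le> (LINT \<xi>|lborel. (1 - cos (z * \<xi>)) * exp (- t * \<phi> \<xi>))"
        by (intro integral_nonneg_AE AE_I2 mult_nonneg_nonneg) auto
      ultimately show ?thesis using heat_kernel_nonneg[OF t, of z] by (simp add: ennreal_mult)
    qed
    have "\<infinity> = (\<integral>\<^sup>+ t. (\<integral>\<^sup>+ \<xi>. ennreal (1 * exp (- t * \<phi> \<xi>)) \<partial>lborel) * indicator {1..} t \<partial>lborel)"
      by (subst time) (use inf in simp_all)
    also have "\<dots> = (\<integral>\<^sup>+ t. ennreal (2 * pi) * (ennreal (heat_kernel t z) * indicator {1..} t) + (\<integral>\<^sup>+ \<xi>. ennreal ((1 - cos (z * \<xi>)) * exp (- t * \<phi> \<xi>)) \<partial>lborel) * indicator {1..} t \<partial>lborel)"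
    proof (rule nn_integral_cong)
      fix t :: real
      show "(\<integral>\<^sup>+ \<xi>. ennreal (1 * exp (- t * \<phi> \<xi>)) \<partial>lborel) * indicator {1..} t = ennreal (2 * pi) * (ennreal (heat_kernel t z) * indicator {1..} t) + (\<integral>\<^sup>+ \<xi>. ennreal ((1 - cos (z * \<xi>)) * exp (- t * \<phi> \<xi>)) \<partial>lborel) * indicator {1..} t"
        using split[of t] by (cases "1 \<le> t") auto
    qed
    also have "\<dots> = ennreal (2 * pi) * (\<integral>\<^sup>+ t. ennreal (heat_kernel t z) * indicator {1..} t \<partial>lborel) + (\<integral>\<^sup>+ t. (\<integral>\<^sup>+ \<xi>. ennreal ((1 - cos (z * \<xi>)) * exp (- t * \<phi> \<xi>)) \<partial>lborel) * indicator {1..} t \<partial>lborel)"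
      by (subst nn_integral_add, measurable) (subst nn_integral_cmult, measurable)
    also have "(\<integral>\<^sup>+ t. (\<integral>\<^sup>+ \<xi>. ennreal ((1 - cos (z * \<xi>)) * exp (- t * \<phi> \<xi>)) \<partial>lborel) * indicator {1..} t \<partial>lborel) = (\<integral>\<^sup>+ \<xi>. ennreal ((1 - cos (z * \<xi>)) * (exp (- \<phi> \<xi>) / \<phi> \<xi>)) \<partial>lborel)"
      by (rule time) auto
    finally have "(\<integral>\<^sup>+ t. ennreal (heat_kernel t z) * indicator {1..} t \<partial>lborel) = \<infinity>"
      using fin[of z] by (auto simp: ennreal_mult_eq_top_iff ennreal_add_eq_top less_top[symmetric] dest!: sym[of top])
    moreover have "(\<integral>\<^sup>+ t. ennreal (heat_kernel t z) * indicator {1..} t \<partial>lborel) \<le> (\<integral>\<^sup>+ t. ennreal (heat_kernel t z) * indicator {0<..} t \<partial>lborel)"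
      by (intro nn_integral_mono) (auto split: split_indicator)
    ultimately show ?thesis by (simp add: top_unique)
  qed
  fix f :: "real \<Rightarrow> real" assume "integrable lborel f \<and> (\<forall>x. 0 \<le> f x)"
  then have f: "integrable lborel f" "\<And>x. 0 \<le> f x" by auto
  note [measurable] = borel_measurable_integrable[OF f(1)]
  have "green f x = 0 \<or> green f x = \<infinity>" for x
  proof -
    have "green f x = (\<integral>\<^sup>+ t. \<integral>\<^sup>+ y. (ennreal (heat_kernel t (x - y)) * indicator {0<..} t) * ennreal (f y) \<partial>lborel \<partial>lborel)"
    proof -
      have "green f x = (\<integral>\<^sup>+ t. \<integral>\<^sup>+ y. ennreal (heat_kernel t (x - y)) * ennreal (f y) * indicator {0<..} t \<partial>lborel \<partial>lborel)"
        unfolding green_def heat_op_def by (intro nn_integral_cong nn_integral_multc[symmetric]) measurable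
      then show ?thesis by (simp add: mult_ac)
    qed
    also have "\<dots> = (\<integral>\<^sup>+ y. \<integral>\<^sup>+ t. (ennreal (heat_kernel t (x - y)) * indicator {0<..} t) * ennreal (f y) \<partial>lborel \<partial>lborel)"
      by (rule lborel_pair.Fubini') measurable
    also have "\<dots> = (\<integral>\<^sup>+ y. \<infinity> * ennreal (f y) \<partial>lborel)"
      by (intro nn_integral_cong) (subst nn_integral_multc, measurable, simp add: pot)
    \<comment> \<open>Since \<infinity> * 0 = 0 in \<open>ennreal\<close>, the two alternatives are
      that \<open>f\<close> vanishes almost everywhere or not.\<close>
    also have "\<dots> = \<infinity> * (\<integral>\<^sup>+ y. ennreal (f y) \<partial>lborel)" by (rule nn_integral_cmult) measurable
    finally show ?thesis by (auto simp: ennreal_top_mult)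
  qed
  then show "\<exists>g. is_green T f g \<and> (AE x in lborel. g x = 0 \<or> g x = \<infinity>)"
    using is_green_T[OF f] by blast
qed

end

subsection \<open>Stable-like exponents\<close>

lemma integrable_even:
  assumes [measurable]: "g \<in> borel_measurable borel" and g: "\<And>x. 0 \<le> g x"
    and fin: "(\<integral>\<^sup>+ x. ennreal (g x) * indicator {0..} x \<partial>lborel) < \<infinity>"
  shows "integrable lborel (\<lambda>x::real. g \<bar>x\<bar>)"
proof (rule integrableI_nonneg)
  have "(\<integral>\<^sup>+ x. ennreal (g \<bar>x\<bar>) \<partial>lborel) \<le> (\<integral>\<^sup>+ x. ennreal (g x) * indicator {0..} x + ennreal (g (- x)) * indicator {0..} (- x) \<partial>lborel)"
    by (intro nn_integral_mono) (auto simp: indicator_def abs_if)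
  also have "\<dots> = (\<integral>\<^sup>+ x. ennreal (g x) * indicator {0..} x \<partial>lborel) + (\<integral>\<^sup>+ x. ennreal (g (- x)) * indicator {0..} (- x) \<partial>lborel)"
    by (intro nn_integral_add) measurable
  also have "(\<integral>\<^sup>+ x. ennreal (g (- x)) * indicator {0..} (- x) \<partial>lborel) = (\<integral>\<^sup>+ x. ennreal (g x) * indicator {0..} x \<partial>lborel)"
    by (subst nn_integral_real_affine[of "\<lambda>x. ennreal (g x) * indicator {0..} x" "-1" 0]) simp_all
  finally show "(\<integral>\<^sup>+ x. ennreal (g \<bar>x\<bar>) \<partial>lborel) < \<infinity>"
    using fin by (auto simp: less_top ennreal_add_eq_top intro: le_less_trans)
qed (use g in auto)

text \<open>Majorant of all densities of a family: up to 1 the largest index gives the largest power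
  of \<open>x\<close>, beyond 1 the smallest one does.\<close>

definition stable_bound :: "real \<Rightarrow> real \<Rightarrow> real \<Rightarrow> real" where
  "stable_bound a b x = (if x \<le> 1 then x powr (- 1 - b) else x powr (- 1 - a))"

text \<open>Near 0 the factor x^2 leaves \<open>x powr (1 - b)\<close>, integrable for b < 2; at
  infinity \<open>x powr (- 1 - a)\<close> is integrable for a > 0.\<close>

lemma stable_bound_integrable:
  assumes a: "0 < a" and b: "b < 2"
  shows "integrable lborel (\<lambda>x. min 1 (\<bar>x\<bar>\<^sup>2) * stable_bound a b \<bar>x\<bar>)"
proof (rule integrable_even)
  show "(\<lambda>x. min 1 (x\<^sup>2) * stable_bound a b x) \<in> borel_measurable borel"
    unfolding stable_bound_def by measurable
  show "0 \<le> min 1 (x\<^sup>2) * stable_bound a b x" for x by (simp add: stable_bound_def)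
  let ?p = "\<lambda>x. if x \<in> {0..1} then x powr (1 - b) else 0" and ?q = "\<lambda>x. if x \<in> {1..} then x powr (- 1 - a) else (0::real)"
  have p: "(\<integral>\<^sup>+ x. ennreal (?p x) \<partial>lborel) < \<infinity>"
  proof -
    have "(?p has_integral (1 powr (1 - b + 1) / (1 - b + 1))) UNIV"
      using has_integral_powr_from_0[of "1 - b" 1] b by (subst has_integral_restrict_UNIV) simp
    then have "(\<integral>\<^sup>+ x. ennreal (?p x) \<partial>lborel) = ennreal (1 powr (1 - b + 1) / (1 - b + 1))"
      by (intro nn_integral_has_integral_lborel) auto
    then show ?thesis by simp
  qed
  have q: "(\<integral>\<^sup>+ x. ennreal (?q x) \<partial>lborel) < \<infinity>"
  proof -
    have "(?q has_integral (- (1 powr (- 1 - a + 1)) / (- 1 - a + 1))) UNIV"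
      using has_integral_powr_to_inf[of "- 1 - a" 1] a by (subst has_integral_restrict_UNIV) simp
    then have "(\<integral>\<^sup>+ x. ennreal (?q x) \<partial>lborel) = ennreal (- (1 powr (- 1 - a + 1)) / (- 1 - a + 1))"
      by (intro nn_integral_has_integral_lborel) auto
    then show ?thesis by simp
  qed
  have "(\<integral>\<^sup>+ x. ennreal (min 1 (x\<^sup>2) * stable_bound a b x) * indicator {0..} x \<partial>lborel) \<le> (\<integral>\<^sup>+ x. ennreal (?p x) + ennreal (?q x) \<partial>lborel)"
  proof (rule nn_integral_mono)
    fix x :: real
    show "ennreal (min 1 (x\<^sup>2) * stable_bound a b x) * indicator {0..} x \<le> ennreal (?p x) + ennreal (?q x)"
    proof (cases "x < 0")
      case False
      have "min 1 (x\<^sup>2) * stable_bound a b x \<le> ?p x + ?q x"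
      proof (cases "x \<le> 1")
        case True
        have "min 1 (x\<^sup>2) * stable_bound a b x \<le> x\<^sup>2 * x powr (- 1 - b)"
          using True by (intro mult_mono) (auto simp: stable_bound_def)
        also have "\<dots> = x powr (1 - b)"
          using False powr_add[of x 2 "- 1 - b"] by (cases "x = 0") auto
        finally show ?thesis using True False by (auto intro: order_trans)
      next
        case g: False
        have "min 1 (x\<^sup>2) * stable_bound a b x \<le> 1 * x powr (- 1 - a)"
          using g by (intro mult_mono) (auto simp: stable_bound_def)
        then show ?thesis using g by simp
      qed
      then have "ennreal (min 1 (x\<^sup>2) * stable_bound a b x) \<le> ennreal (?p x + ?q x)" by (rule ennreal_leI)
      also have "\<dots> = ennreal (?p x) + ennreal (?q x)" by (intro ennreal_plus) auto
      finally show ?thesis using False by simp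
    qed simp
  qed
  also have "\<dots> = (\<integral>\<^sup>+ x. ennreal (?p x) \<partial>lborel) + (\<integral>\<^sup>+ x. ennreal (?q x) \<partial>lborel)"
    by (intro nn_integral_add) measurable
  also have "\<dots> < \<infinity>" using p q by (simp add: less_top ennreal_add_eq_top)
  finally show "(\<integral>\<^sup>+ x. ennreal (min 1 (x\<^sup>2) * stable_bound a b x) * indicator {0..} x \<partial>lborel) < \<infinity>" .
qed

definition stable_density :: "(real \<Rightarrow> real) \<Rightarrow> real \<Rightarrow> real" where
  "stable_density \<alpha> x = \<bar>x\<bar> powr (- 1 - \<alpha> \<bar>x\<bar>)"

lemma stretched_exp_decay:
  fixes k a :: real assumes "0 < k" "0 < a"
  shows "((\<lambda>x. (1 + x\<^sup>2) * exp (- k * x powr a)) \<longlongrightarrow> 0) at_top"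
  using assms by real_asymp

lemma cos1: "0 < 1 - cos (1::real)"
  using cos_monotone_0_pi[of 0 1] pi_gt3 by simp

text \<open>The bound \<open>a\<close> controls large jumps and the growth of \<phi> at infinity;
  \<open>b\<close> controls small jumps. It is required on [0, 1] only because the first index of
  the recurrent family tends to 2 at infinity. The bound 2 everywhere keeps the tail from being too
  thin. Measurability concerns \<bar>x\<bar> since \<alpha> is prescribed on nonnegative arguments
  only.\<close>

locale alpha_density =
  fixes \<alpha> :: "real \<Rightarrow> real" and a b :: real
  assumes \<alpha>_meas [measurable]: "(\<lambda>x. \<alpha> \<bar>x\<bar>) \<in> borel_measurable borel"
    and a_pos: "0 < a" and b_less: "b < 2"
    and \<alpha>_ge: "\<And>u. 0 \<le> u \<Longrightarrow> a \<le> \<alpha> u" and \<alpha>_le: "\<And>u. 0 \<le> u \<Longrightarrow> u \<le> 1 \<Longrightarrow> \<alpha> u \<le> b"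
    and \<alpha>_le2: "\<And>u. 0 \<le> u \<Longrightarrow> \<alpha> u \<le> 2"
begin

abbreviation "h \<equiv> stable_density \<alpha>"

lemma h_le_stable_bound: "h x \<le> stable_bound a b \<bar>x\<bar>"
  unfolding stable_density_def stable_bound_def using \<alpha>_ge[of "\<bar>x\<bar>"] \<alpha>_le[of "\<bar>x\<bar>"]
  by (auto intro: powr_mono powr_mono')

lemma h_measurable [measurable]: "h \<in> borel_measurable borel"
  unfolding stable_density_def by measurable

lemma h_integrable: "integrable lborel (\<lambda>x. min 1 (x\<^sup>2) * h x)"
proof (rule Bochner_Integration.integrable_bound[OF stable_bound_integrable[OF a_pos b_less]])
  show "AE x in lborel. norm (min 1 (x\<^sup>2) * h x) \<le> norm (min 1 (\<bar>x\<bar>\<^sup>2) * stable_bound a b \<bar>x\<bar>)"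
    using h_le_stable_bound by (intro AE_I2) (auto simp: abs_mult stable_density_def intro!: mult_left_mono order_trans[OF _ abs_ge_self])
qed measurable

sublocale levy_density h
  by unfold_locales (use h_integrable in \<open>auto simp: stable_density_def\<close>)

lemma char_exponent_eq: "char_exponent (levy_measure \<alpha>) = \<phi>"
proof
  fix \<xi>
  have "char_exponent (levy_measure \<alpha>) \<xi> = (LINT x|density lborel (\<lambda>x. ennreal (h x)). 1 - cos (\<xi> * x))"
    by (simp add: char_exponent_def levy_measure_def stable_density_def)
  also have "\<dots> = (LINT x|lborel. h x *\<^sub>R (1 - cos (\<xi> * x)))"
    by (intro integral_density) (auto simp: stable_density_def)
  finally show "char_exponent (levy_measure \<alpha>) \<xi> = \<phi> \<xi>" by (simp add: \<phi>_def mult.commute)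
qed

text \<open>On the window 1 \<le> |\<xi>| x \<le> 2 the cosine is at most \<open>cos 1\<close>, and
  the window has length 1 / |\<xi>|. Every lower bound on \<phi> below comes from bounding the
  density on this window.\<close>

lemma \<phi>_lower:
  assumes k: "0 \<le> k" "\<And>x. 1 / \<bar>\<xi>\<bar> \<le> x \<Longrightarrow> x \<le> 2 / \<bar>\<xi>\<bar> \<Longrightarrow> k \<le> h x" and \<xi>: "\<xi> \<noteq> 0"
  shows "(1 - cos 1) * k / \<bar>\<xi>\<bar> \<le> \<phi> \<xi>"
proof -
  let ?A = "{1 / \<bar>\<xi>\<bar>..2 / \<bar>\<xi>\<bar>}"
  have "(LINT x|lborel. (1 - cos 1) * k * indicator ?A x) \<le> \<phi> \<xi>"
    unfolding \<phi>_def
  proof (rule integral_mono)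
    show "integrable lborel (\<lambda>x. (1 - cos 1) * k * indicator ?A x)"
      by (intro integrable_mult_right integrable_real_indicator) (auto simp: emeasure_lborel_Icc_eq)
    show "integrable lborel (\<lambda>x. (1 - cos (\<xi> * x)) * h x)" by (rule integrand_integrable)
    fix x
    show "(1 - cos 1) * k * indicator ?A x \<le> (1 - cos (\<xi> * x)) * h x"
    proof (cases "x \<in> ?A")
      case True
      then have x: "1 / \<bar>\<xi>\<bar> \<le> x" "x \<le> 2 / \<bar>\<xi>\<bar>" by auto
      have y: "1 \<le> \<bar>\<xi>\<bar> * x" "\<bar>\<xi>\<bar> * x \<le> 2" using x \<xi> by (auto simp: field_simps)
      have "cos (\<bar>\<xi>\<bar> * x) \<le> cos 1" using y pi_gt3 by (intro cos_monotone_0_pi_le) auto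
      moreover have "cos (\<bar>\<xi>\<bar> * x) = cos (\<xi> * x)" by (cases "0 \<le> \<xi>") (auto simp: abs_if)
      ultimately show ?thesis
        using True k(1) k(2)[OF x] by (auto intro!: mult_mono)
    qed (auto simp: h_nonneg)
  qed
  also have "(LINT x|lborel. (1 - cos 1) * k * indicator ?A x) = (1 - cos 1) * k / \<bar>\<xi>\<bar>"
    using \<xi> by (simp add: field_simps)
  finally show ?thesis .
qed

lemma h_ge_near_0: "0 < x \<Longrightarrow> x \<le> 1 \<Longrightarrow> x powr (- 1 - a) \<le> h x"
  unfolding stable_density_def using \<alpha>_ge[of x] by (auto intro: powr_mono')

definition c0 :: real where "c0 = (1 - cos 1) * 2 powr (- 1 - a)"

lemma c0_pos: "0 < c0" using cos1 by (simp add: c0_def)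

text \<open>For such \<xi> the window of \<open>\<phi>_lower\<close> lies in (0, 1], where the
  density is at least \<open>x powr (- 1 - a)\<close>; the right endpoint 2 / |\<xi>| gives the
  smallest value and \<open>c0\<close>.\<close>

lemma \<phi>_lower_at_infinity:
  assumes "2 \<le> \<bar>\<xi>\<bar>" shows "c0 * \<bar>\<xi>\<bar> powr a \<le> \<phi> \<xi>"
proof -
  let ?r = "\<bar>\<xi>\<bar>"
  have "(1 - cos 1) * (2 / ?r) powr (- 1 - a) / ?r \<le> \<phi> \<xi>"
  proof (rule \<phi>_lower)
    fix x assume x: "1 / ?r \<le> x" "x \<le> 2 / ?r"
    have "0 < 1 / ?r" "2 / ?r \<le> 1" using assms by (auto simp: field_simps)
    then have x': "0 < x" "x \<le> 1" using x by linarith+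
    have "(2 / ?r) powr (- 1 - a) \<le> x powr (- 1 - a)"
      using x x' a_pos by (intro powr_mono2') auto
    then show "(2 / ?r) powr (- 1 - a) \<le> h x" using h_ge_near_0[OF x'] by linarith
  qed (use assms in auto)
  moreover have "(2 / ?r) powr (- 1 - a) / ?r = 2 powr (- 1 - a) * ?r powr a"
  proof -
    have "(2 / ?r) powr (- 1 - a) = 2 powr (- 1 - a) * ?r powr (1 + a)"
      using assms powr_minus[of ?r "1 + a"] powr_divide[of 2 ?r "- 1 - a"]
      by (simp only: divide_inverse inverse_inverse_eq minus_add_distrib abs_ge_zero zero_le_numeral diff_conv_add_uminus)
    then show ?thesis using assms by (simp add: powr_add)
  qed
  ultimately show ?thesis by (simp only: c0_def mult.assoc times_divide_eq_right[symmetric])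
qed

text \<open>Beyond 1 the index bound 2 gives a density of at least x^(-3), hence at least |\<xi>|^3
  / 8 on the window; up to 1 the density is at least 1, which suffices as |\<xi>| \<le> 2. This
  crude bound handles 1 / \<phi> where no sharp rate is wanted.\<close>

lemma \<phi>_lower_quadratic:
  assumes "\<bar>\<xi>\<bar> \<le> 2" shows "(1 - cos 1) / 8 * \<xi>\<^sup>2 \<le> \<phi> \<xi>"
proof (cases "\<xi> = 0")
  case False
  let ?r = "\<bar>\<xi>\<bar>"
  have r: "0 < ?r" using False by simp
  have "(1 - cos 1) * (?r ^ 3 / 8) / ?r \<le> \<phi> \<xi>"
  proof (rule \<phi>_lower[OF _ _ False])
    fix x assume x: "1 / ?r \<le> x" "x \<le> 2 / ?r"
    have x0: "0 < x" using x(1) r by (meson divide_pos_pos less_le_trans zero_less_one)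
    show "?r ^ 3 / 8 \<le> h x"
    proof (cases "x \<le> 1")
      case True
      have "?r ^ 3 \<le> 2 ^ 3" using assms by (intro power_mono) auto
      moreover have "1 \<le> h x"
        using powr_mono'[of "- 1 - \<alpha> x" 0 x] \<alpha>_ge[of x] a_pos x0 True by (simp add: stable_density_def)
      ultimately show ?thesis by simp
    next
      case xg: False
      have "x ^ 3 \<le> (2 / ?r) ^ 3" using x x0 by (intro power_mono) auto
      then have "?r ^ 3 / 8 \<le> 1 / x ^ 3"
        using x0 r by (simp add: power_divide field_simps)
      also have "\<dots> = x powr (- 3)" using x0 by (simp add: powr_minus_divide)
      also have "\<dots> \<le> h x"
        unfolding stable_density_def using \<alpha>_le2[of x] x0 xg by (auto intro: powr_mono)
      finally show ?thesis .
    qed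
  qed simp
  moreover have "(1 - cos 1) * (?r ^ 3 / 8) / ?r = (1 - cos 1) / 8 * \<xi>\<^sup>2"
    using r by (simp add: power3_eq_cube power2_eq_square flip: abs_mult)
  ultimately show ?thesis by simp
qed (use \<phi>_nonneg in simp)

lemma \<phi>_pos: "\<xi> \<noteq> 0 \<Longrightarrow> 0 < \<phi> \<xi>"
proof (cases "\<bar>\<xi>\<bar> \<le> 2")
  case True
  assume "\<xi> \<noteq> 0"
  then have "0 < (1 - cos 1) / 8 * \<xi>\<^sup>2" using cos1 by simp
  with \<phi>_lower_quadratic[OF True] show ?thesis by linarith
next
  case False
  then have "0 < c0 * \<bar>\<xi>\<bar> powr a" using c0_pos by simp
  with \<phi>_lower_at_infinity[of \<xi>] False show ?thesis by linarith
qed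

lemma AE_\<phi>_pos: "AE \<xi> in lborel. 0 < \<phi> \<xi>"
  using AE_lborel_singleton[of 0] by eventually_elim (rule \<phi>_pos)

lemma \<phi>_ge_c0: "2 \<le> \<bar>\<xi>\<bar> \<Longrightarrow> c0 \<le> \<phi> \<xi>"
proof -
  assume g: "2 \<le> \<bar>\<xi>\<bar>"
  have "c0 * 1 \<le> c0 * \<bar>\<xi>\<bar> powr a"
    using g a_pos c0_pos by (intro mult_left_mono ge_one_powr_ge_zero) auto
  with \<phi>_lower_at_infinity[OF g] show ?thesis by linarith
qed

lemma exp_\<phi>_integrable:
  assumes t: "0 < t" shows "integrable lborel (\<lambda>\<xi>. exp (- t * \<phi> \<xi>))"
proof -
  have "((\<lambda>x. (1 + x\<^sup>2) * exp (- (t * c0) * x powr a)) \<longlongrightarrow> 0) at_top"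
    using t c0_pos a_pos by (intro stretched_exp_decay) auto
  then have "\<forall>\<^sub>F x in at_top. (1 + x\<^sup>2) * exp (- (t * c0) * x powr a) < 1"
    by (rule order_tendstoD) simp
  then obtain X where X: "\<And>x. x \<ge> X \<Longrightarrow> (1 + x\<^sup>2) * exp (- (t * c0) * x powr a) < 1"
    by (auto simp: eventually_at_top_linorder)
  define Y where "Y = max 2 X"
  \<comment> \<open>Up to \<open>Y\<close> the exponential is estimated by 1; beyond it the
    stretched exponential decay beats 1 + \<xi>^2.\<close>
  have "exp (- t * \<phi> \<xi>) \<le> (1 + Y\<^sup>2) * inverse (1 + \<xi>\<^sup>2)" for \<xi>
  proof -
    have "(1 + \<xi>\<^sup>2) * exp (- t * \<phi> \<xi>) \<le> 1 + Y\<^sup>2"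
    proof (cases "\<bar>\<xi>\<bar> \<le> Y")
      case True
      then have "\<xi>\<^sup>2 \<le> Y\<^sup>2" by (metis abs_le_square_iff abs_of_nonneg Y_def max.coboundedI1 zero_le_numeral)
      moreover have "exp (- t * \<phi> \<xi>) \<le> 1" using t \<phi>_nonneg by simp
      ultimately have "(1 + \<xi>\<^sup>2) * exp (- t * \<phi> \<xi>) \<le> (1 + Y\<^sup>2) * 1" by (intro mult_mono) auto
      then show ?thesis by simp
    next
      case False
      then have "- t * \<phi> \<xi> \<le> - (t * c0) * \<bar>\<xi>\<bar> powr a"
        using mult_left_mono[OF \<phi>_lower_at_infinity[of \<xi>], of t] t by (simp add: Y_def)
      then have "(1 + \<xi>\<^sup>2) * exp (- t * \<phi> \<xi>) \<le> (1 + \<bar>\<xi>\<bar>\<^sup>2) * exp (- (t * c0) * \<bar>\<xi>\<bar> powr a)"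
        by (intro mult_mono) auto
      also have "\<dots> < 1" using False by (intro X) (simp add: Y_def)
      finally show ?thesis using zero_le_power2[of Y] by linarith
    qed
    moreover have "0 < 1 + \<xi>\<^sup>2" by (simp add: add_pos_nonneg)
    ultimately show ?thesis by (simp add: field_simps)
  qed
  then show ?thesis
    by (intro Bochner_Integration.integrable_bound[OF integrable_mult_right[OF integrable_inverse_1_plus_square_lborel, of "1 + Y\<^sup>2"]])
       (auto intro!: AE_I2 order_trans[OF _ abs_ge_self])
qed

sublocale levy_kernel h
  by unfold_locales (rule exp_\<phi>_integrable)

lemma stable_like_form_eq: "stable_like_form \<alpha> = translation_invariant_form \<phi>"
  by (simp add: stable_like_form_def char_exponent_eq)

text \<open>On the window of \<open>\<phi>_lower\<close> the density is at least a multiple of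
  \<xi>^2 (1 - ln |\<xi>|)^2, so 1 / \<phi> is at most a multiple of 1 / (r (1 - ln r)^2) with r =
  |\<xi>|. That function is the derivative of 1 / (1 - ln r), which stays bounded at 0.\<close>

theorem transient_stable_like:
  assumes K: "0 < K" and ev: "\<forall>\<^sub>F x in at_top. K * (1 + ln x)\<^sup>2 \<le> x powr (1 - \<alpha> x)"
  shows "transient_form (stable_like_form \<alpha>)"
  unfolding stable_like_form_eq
proof (rule transient_translation_invariant[OF AE_\<phi>_pos])
  obtain X0 where X0: "\<And>x. x \<ge> X0 \<Longrightarrow> K * (1 + ln x)\<^sup>2 \<le> x powr (1 - \<alpha> x)"
    using ev by (auto simp: eventually_at_top_linorder)
  \<comment> \<open>For |\<xi>| \<le> r0 the whole window lies beyond \<open>X0\<close>, and the 2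
    keeps \<open>r0\<close> below 1, where the logarithm is negative.\<close>
  define r0 where "r0 = 1 / max 2 X0"
  have r0: "0 < r0" "r0 < 1" "X0 \<le> 1 / r0" by (auto simp: r0_def field_simps)
  \<comment> \<open>The 4 comes from x^(-2) at the far end 2 / |\<xi>| of the window.\<close>
  define C where "C = 4 / ((1 - cos 1) * K)"
  have C: "0 < C" using cos1 K by (simp add: C_def)
  have near: "1 / \<phi> \<xi> \<le> C * (1 / (\<bar>\<xi>\<bar> * (1 - ln \<bar>\<xi>\<bar>)\<^sup>2))" if "\<xi> \<noteq> 0" "\<bar>\<xi>\<bar> \<le> r0" for \<xi>
  proof -
    let ?r = "\<bar>\<xi>\<bar>"
    have r: "0 < ?r" "?r < 1" using that r0 by auto
    have lr: "0 \<le> - ln ?r" using r by simp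
    then have ln1: "ln ?r \<noteq> 1" by linarith
    have "(1 - cos 1) * (K * (1 - ln ?r)\<^sup>2 * (?r\<^sup>2 / 4)) / ?r \<le> \<phi> \<xi>"
    proof (rule \<phi>_lower[OF _ _ that(1)])
      fix x assume x: "1 / ?r \<le> x" "x \<le> 2 / ?r"
      have "1 / r0 \<le> 1 / ?r" using that r0 by (intro divide_left_mono) auto
      moreover have "1 \<le> 1 / r0" using r0 by simp
      ultimately have xX: "X0 \<le> x" and x1: "1 \<le> x" using r0(3) x(1) by linarith+
      have "- ln ?r = ln (1 / ?r)" using r by (simp add: ln_div)
      also have "\<dots> \<le> ln x" using x r x1 by (subst ln_le_cancel_iff) auto
      finally have "(1 - ln ?r)\<^sup>2 \<le> (1 + ln x)\<^sup>2" using lr by (intro power_mono) auto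
      then have "K * (1 - ln ?r)\<^sup>2 \<le> K * (1 + ln x)\<^sup>2" using K by (intro mult_left_mono) auto
      also have "\<dots> \<le> x powr (1 - \<alpha> x)" by (rule X0[OF xX])
      finally have 1: "K * (1 - ln ?r)\<^sup>2 \<le> x powr (1 - \<alpha> x)" .
      have "x\<^sup>2 \<le> (2 / ?r)\<^sup>2" using x x1 by (intro power_mono) auto
      then have 2: "?r\<^sup>2 / 4 \<le> x powr (- 2)"
        using r x1 by (simp add: powr_minus_divide power_divide field_simps)
      have "K * (1 - ln ?r)\<^sup>2 * (?r\<^sup>2 / 4) \<le> x powr (1 - \<alpha> x) * x powr (- 2)"
        using 1 2 by (intro mult_mono) auto
      also have "\<dots> = h x" using x1 by (simp add: stable_density_def flip: powr_add)
      finally show "K * (1 - ln ?r)\<^sup>2 * (?r\<^sup>2 / 4) \<le> h x" .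
    qed (use K in simp)
    moreover have "0 < (1 - cos 1) * (K * (1 - ln ?r)\<^sup>2 * (?r\<^sup>2 / 4)) / ?r"
      using r ln1 K cos1 by (intro divide_pos_pos mult_pos_pos zero_less_power2[THEN iffD2]) linarith+
    ultimately have "1 / \<phi> \<xi> \<le> 1 / ((1 - cos 1) * (K * (1 - ln ?r)\<^sup>2 * (?r\<^sup>2 / 4)) / ?r)"
      by (intro divide_left_mono mult_pos_pos \<phi>_pos that) auto
    also have "(1 - cos 1) * (K * (1 - ln ?r)\<^sup>2 * (?r\<^sup>2 / 4)) / ?r = ((1 - cos 1) * K / 4) * (?r * (1 - ln ?r)\<^sup>2)"
      using r by (simp only: power2_eq_square[of ?r]) (simp add: field_simps)
    also have "1 / \<dots> = C * (1 / (?r * (1 - ln ?r)\<^sup>2))"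
      by (simp add: C_def)
    finally show ?thesis .
  qed
  \<comment> \<open>Away from 0 boundedness of 1 / \<phi> is enough, because the Gaussian weight
    supplies integrability.\<close>
  have far: "\<exists>D>0. \<forall>\<xi>. r0 < \<bar>\<xi>\<bar> \<longrightarrow> 1 / \<phi> \<xi> \<le> D"
  proof (intro exI[of _ "max (1 / c0) (1 / ((1 - cos 1) / 8 * r0\<^sup>2))"] conjI allI impI)
    show "0 < max (1 / c0) (1 / ((1 - cos 1) / 8 * r0\<^sup>2))" using c0_pos by (simp add: less_max_iff_disj)
    fix \<xi> assume g: "r0 < \<bar>\<xi>\<bar>"
    show "1 / \<phi> \<xi> \<le> max (1 / c0) (1 / ((1 - cos 1) / 8 * r0\<^sup>2))"
    proof (cases "\<bar>\<xi>\<bar> \<le> 2")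
      case True
      have "r0\<^sup>2 \<le> \<xi>\<^sup>2" using g r0 by (metis abs_le_square_iff abs_of_pos less_imp_le)
      then have "(1 - cos 1) / 8 * r0\<^sup>2 \<le> (1 - cos 1) / 8 * \<xi>\<^sup>2" using cos1 by (intro mult_left_mono) auto
      with \<phi>_lower_quadratic[OF True] have "(1 - cos 1) / 8 * r0\<^sup>2 \<le> \<phi> \<xi>" by linarith
      moreover have "0 < (1 - cos 1) / 8 * r0\<^sup>2" using cos1 r0 by simp
      ultimately have "1 / \<phi> \<xi> \<le> 1 / ((1 - cos 1) / 8 * r0\<^sup>2)"
        using cos1 by (intro divide_left_mono mult_pos_pos) auto
      then show ?thesis by simp
    next
      case False
      then have "c0 \<le> \<phi> \<xi>" by (intro \<phi>_ge_c0) simp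
      then have "1 / \<phi> \<xi> \<le> 1 / c0" using c0_pos by (intro divide_left_mono mult_pos_pos) auto
      then show ?thesis by simp
    qed
  qed
  then obtain D where D: "0 < D" "\<And>\<xi>. r0 < \<bar>\<xi>\<bar> \<Longrightarrow> 1 / \<phi> \<xi> \<le> D" by blast
  define g where "g r = indicator {0<..<1} r * (1 / (r * (1 - ln r)\<^sup>2))" for r :: real
  have g0: "0 \<le> g r" for r by (auto simp: g_def indicator_def)
  have gm [measurable]: "g \<in> borel_measurable borel" unfolding g_def by measurable
  have "set_integrable lborel (einterval 0 1) (\<lambda>r. 1 / (r * (1 - ln r)\<^sup>2))"
  proof (rule interval_integral_FTC_nonneg(1)[where F="\<lambda>r. 1 / (1 - ln r)" and A=0 and B=1])
    fix r :: real assume r: "0 < ereal r" "ereal r < 1"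
    then have r': "0 < r" "r < 1" by (auto simp: one_ereal_def)
    then have l: "ln r \<noteq> 1" using ln_less_zero[of r] by linarith
    show "((\<lambda>r. 1 / (1 - ln r)) has_real_derivative 1 / (r * (1 - ln r)\<^sup>2)) (at r)"
      using r' l by (auto intro!: derivative_eq_intros simp: power2_eq_square field_simps)
    show "isCont (\<lambda>r. 1 / (r * (1 - ln r)\<^sup>2)) r"
      using r' l by (auto intro!: continuous_intros)
  next
    show "AE r in lborel. 0 < ereal r \<longrightarrow> ereal r < 1 \<longrightarrow> 0 \<le> 1 / (r * (1 - ln r)\<^sup>2)"
      by (rule AE_I2) auto
    have "((\<lambda>r. 1 / (1 - ln r)) \<longlongrightarrow> 0) (at_right (0::real))" by real_asymp
    then show "(((\<lambda>r. 1 / (1 - ln r)) \<circ> real_of_ereal) \<longlongrightarrow> 0) (at_right 0)"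
      by (simp add: zero_ereal_def ereal_tendsto_simps)
    have "((\<lambda>r. 1 / (1 - ln r)) \<longlongrightarrow> 1) (at_left (1::real))" by real_asymp
    then show "(((\<lambda>r. 1 / (1 - ln r)) \<circ> real_of_ereal) \<longlongrightarrow> 1) (at_left 1)"
      by (simp add: one_ereal_def ereal_tendsto_simps)
  qed simp
  then have "integrable lborel g"
    by (simp add: set_integrable_def g_def[abs_def] zero_ereal_def one_ereal_def)
  then have "(\<integral>\<^sup>+ x. ennreal (g x) \<partial>lborel) < \<infinity>"
    using g0 by (simp add: integrable_iff_bounded)
  moreover have "(\<integral>\<^sup>+ x. ennreal (g x) * indicator {0..} x \<partial>lborel) \<le> (\<integral>\<^sup>+ x. ennreal (g x) \<partial>lborel)"
    by (intro nn_integral_mono) (auto simp: indicator_def)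
  ultimately have g_int: "integrable lborel (\<lambda>x. g \<bar>x\<bar>)"
    by (intro integrable_even gm g0) (rule le_less_trans)
  have e_int: "integrable lborel (\<lambda>\<xi>::real. exp (- \<xi>\<^sup>2 / 2))"
  proof -
    have "integrable lborel (\<lambda>\<xi>. sqrt (2 * pi) * std_normal_density \<xi>)" by (intro integrable_mult_right) simp
    then show ?thesis by (simp add: std_normal_density_def del: real_sqrt_mult)
  qed
  have tot: "integrable lborel (\<lambda>\<xi>. C * g \<bar>\<xi>\<bar> + D * exp (- \<xi>\<^sup>2 / 2))"
    by (intro Bochner_Integration.integrable_add integrable_mult_right g_int e_int)
  have "(\<integral>\<^sup>+ \<xi>. ennreal (exp (- \<xi>\<^sup>2 / 2) / \<phi> \<xi>) \<partial>lborel) \<le> (\<integral>\<^sup>+ \<xi>. ennreal (C * g \<bar>\<xi>\<bar> + D * exp (- \<xi>\<^sup>2 / 2)) \<partial>lborel)"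
  proof (rule nn_integral_mono_AE, use AE_lborel_singleton[of 0] in eventually_elim)
    fix \<xi> :: real assume x: "\<xi> \<noteq> 0"
    have "exp (- \<xi>\<^sup>2 / 2) / \<phi> \<xi> \<le> C * g \<bar>\<xi>\<bar> + D * exp (- \<xi>\<^sup>2 / 2)"
    proof (cases "\<bar>\<xi>\<bar> \<le> r0")
      case True
      have "exp (- \<xi>\<^sup>2 / 2) / \<phi> \<xi> \<le> 1 / \<phi> \<xi>" using \<phi>_nonneg by (intro divide_right_mono) auto
      also have "\<dots> \<le> C * g \<bar>\<xi>\<bar>" using near[OF x True] True r0 x by (simp add: g_def)
      finally show ?thesis using D(1) by (simp add: add_increasing2)
    next
      case False
      have "exp (- \<xi>\<^sup>2 / 2) * (1 / \<phi> \<xi>) \<le> exp (- \<xi>\<^sup>2 / 2) * D"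
        using D(2)[of \<xi>] False by (intro mult_left_mono) auto
      moreover have "0 \<le> C * g \<bar>\<xi>\<bar>" using C g0 by simp
      ultimately show ?thesis by (simp add: mult.commute)
    qed
    then show "ennreal (exp (- \<xi>\<^sup>2 / 2) / \<phi> \<xi>) \<le> ennreal (C * g \<bar>\<xi>\<bar> + D * exp (- \<xi>\<^sup>2 / 2))" by (rule ennreal_leI)
  qed
  also have "\<dots> < \<infinity>"
    using nn_integral_eq_integral[OF tot] C D(1) g0 by simp
  finally show "(\<integral>\<^sup>+ \<xi>. ennreal (exp (- \<xi>\<^sup>2 / 2) / \<phi> \<xi>) \<partial>lborel) < \<infinity>" .
qed

text \<open>The density is at most a multiple of x^(-2) beyond 1, as for the Cauchy process, so
  \<phi> is at most linear near 0 and the integral of 1 / \<phi> diverges logarithmically.\<close>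

theorem recurrent_stable_like:
  assumes ev: "\<forall>\<^sub>F x in at_top. x powr (1 - \<alpha> x) \<le> C0"
  shows "recurrent_form (stable_like_form \<alpha>)"
  unfolding stable_like_form_eq
proof (rule recurrent_translation_invariant[OF AE_\<phi>_pos])
  obtain X0 where X0: "\<And>x. x \<ge> X0 \<Longrightarrow> x powr (1 - \<alpha> x) \<le> C0"
    using ev by (auto simp: eventually_at_top_linorder)
  \<comment> \<open>\<open>X0\<close> covers 1 \<le> x < X0, where \<alpha> > 0 gives
    \<open>x powr (1 - \<alpha> x)\<close> \<le> x < X0; the 1 ensures that \<open>C\<close> is
    positive.\<close>
  define C where "C = max (max C0 X0) 1"
  have hC: "h x \<le> C * x powr (- 2)" if "1 \<le> x" for x
  proof -
    have "x powr (1 - \<alpha> x) \<le> C"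
    proof (cases "X0 \<le> x")
      case False
      have "x powr (1 - \<alpha> x) \<le> x powr 1" using that \<alpha>_ge[of x] a_pos by (intro powr_mono) auto
      then show ?thesis using that False by (simp add: C_def)
    qed (use X0[of x] in \<open>simp add: C_def\<close>)
    then have "x powr (1 - \<alpha> x) * x powr (- 2) \<le> C * x powr (- 2)" by (intro mult_right_mono) auto
    then show ?thesis using that by (simp add: stable_density_def flip: powr_add)
  qed
  define M where "M = (LINT x|lborel. min 1 (x\<^sup>2) * h x)"
  define Q where "Q = (LINT x|(lborel::real measure). inverse (1 + x\<^sup>2))"
  have M: "0 \<le> M" unfolding M_def by (intro integral_nonneg_AE AE_I2 mult_nonneg_nonneg h_nonneg) auto
  have Q: "0 \<le> Q" unfolding Q_def by (intro integral_nonneg_AE AE_I2) auto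
  have C1: "1 \<le> C" by (simp add: C_def)
  \<comment> \<open>\<open>M\<close> accounts for small jumps and the term with \<open>Q\<close> for
    large ones after rescaling x by \<xi>; the 1 makes \<open>B\<close> positive for the later
    divisions.\<close>
  define B where "B = M + 5/2 * C * Q + 1"
  have B: "0 < B" using M Q C1 by (simp add: B_def add_nonneg_pos)
  have up: "\<phi> \<xi> \<le> B * \<bar>\<xi>\<bar>" if "\<bar>\<xi>\<bar> \<le> 1" "\<xi> \<noteq> 0" for \<xi>
  proof -
    have i1: "integrable lborel (\<lambda>x. inverse (1 + (\<xi> * x)\<^sup>2))"
      using lborel_integrable_real_affine[OF integrable_inverse_1_plus_square_lborel that(2), of 0] by simp
    have Qr: "(LINT x|lborel. inverse (1 + (\<xi> * x)\<^sup>2)) = Q / \<bar>\<xi>\<bar>"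
      using lborel_integral_real_affine[OF that(2), of "\<lambda>x. inverse (1 + x\<^sup>2)" 0] that(2) by (simp add: Q_def field_simps)
    have "\<phi> \<xi> \<le> (LINT x|lborel. \<xi>\<^sup>2 * (min 1 (x\<^sup>2) * h x) + 5/2 * C * \<xi>\<^sup>2 * inverse (1 + (\<xi> * x)\<^sup>2))"
      unfolding \<phi>_def
    proof (rule integral_mono)
      show "integrable lborel (\<lambda>x. \<xi>\<^sup>2 * (min 1 (x\<^sup>2) * h x) + 5/2 * C * \<xi>\<^sup>2 * inverse (1 + (\<xi> * x)\<^sup>2))"
        by (intro Bochner_Integration.integrable_add integrable_mult_right h_int i1)
      fix x
      have c2: "1 - cos (\<xi> * x) \<le> 2" and cq: "1 - cos (\<xi> * x) \<le> (\<xi> * x)\<^sup>2 / 2"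
        using one_minus_cos_bound[of "\<xi> * x"] by auto
      show "(1 - cos (\<xi> * x)) * h x \<le> \<xi>\<^sup>2 * (min 1 (x\<^sup>2) * h x) + 5/2 * C * \<xi>\<^sup>2 * inverse (1 + (\<xi> * x)\<^sup>2)"
      proof (cases "\<bar>x\<bar> \<le> 1")
        case True
        then have x2: "x\<^sup>2 \<le> 1" by (simp add: abs_square_le_1)
        have "(\<xi> * x)\<^sup>2 / 2 \<le> \<xi>\<^sup>2 * x\<^sup>2" by (simp add: power_mult_distrib)
        then have "1 - cos (\<xi> * x) \<le> \<xi>\<^sup>2 * x\<^sup>2" using cq by linarith
        then have "1 - cos (\<xi> * x) \<le> \<xi>\<^sup>2 * min 1 (x\<^sup>2)" using x2 by (simp add: min_def)
        then have "(1 - cos (\<xi> * x)) * h x \<le> \<xi>\<^sup>2 * min 1 (x\<^sup>2) * h x" by (rule mult_right_mono[OF _ h_nonneg])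
        moreover have "0 \<le> 5/2 * C * \<xi>\<^sup>2 * inverse (1 + (\<xi> * x)\<^sup>2)"
          using C1 by (intro mult_nonneg_nonneg) auto
        ultimately show ?thesis by (simp add: mult.assoc)
      next
        case False
        then have x0: "x\<^sup>2 > 0" by auto
        let ?y = "(\<xi> * x)\<^sup>2"
        have y: "0 \<le> ?y" by simp
        \<comment> \<open>The two bounds y/2 and 2 on 1 - cos meet at y = 4, and 5/2 is the constant
          that both produce there. The resulting majorant y / (1 + y) has an explicit scaling in
          \<xi>.\<close>
        have "(1 - cos (\<xi> * x)) * (1 + ?y) \<le> 5/2 * ?y"
        proof (cases "?y \<le> 4")
          case True
          have "(1 - cos (\<xi> * x)) * (1 + ?y) \<le> ?y / 2 * (1 + 4)" using cq True by (intro mult_mono) auto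
          then show ?thesis by simp
        next
          case False
          have "(1 - cos (\<xi> * x)) * (1 + ?y) \<le> 2 * (1 + ?y)" using c2 by (intro mult_right_mono) auto
          then show ?thesis using False by simp
        qed
        then have "(1 - cos (\<xi> * x)) \<le> 5/2 * ?y * inverse (1 + ?y)"
          using add_pos_nonneg[OF zero_less_one y] by (simp add: field_simps)
        then have 1: "1 - cos (\<xi> * x) \<le> 5/2 * \<xi>\<^sup>2 * x\<^sup>2 * inverse (1 + ?y)" by (simp add: power_mult_distrib mult.assoc)
        have "h x = h \<bar>x\<bar>" by (simp add: stable_density_def)
        also have "\<dots> \<le> C * \<bar>x\<bar> powr (- 2)" using False by (intro hC) simp
        also have "\<dots> = C / x\<^sup>2" using False by (simp add: powr_minus_divide)
        finally have 2: "h x \<le> C / x\<^sup>2" .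
        have "(1 - cos (\<xi> * x)) * h x \<le> (5/2 * \<xi>\<^sup>2 * x\<^sup>2 * inverse (1 + ?y)) * (C / x\<^sup>2)"
          using 1 2 h_nonneg[of x] by (intro mult_mono) auto
        also have "\<dots> = 5/2 * C * \<xi>\<^sup>2 * inverse (1 + ?y)" using x0 by (simp add: field_simps)
        finally show ?thesis using h_nonneg[of x] by (simp add: add_increasing)
      qed
    qed (rule integrand_integrable)
    also have "\<dots> = \<xi>\<^sup>2 * M + 5/2 * C * \<xi>\<^sup>2 * (Q / \<bar>\<xi>\<bar>)"
      unfolding M_def Qr[symmetric] using h_int i1 by (subst Bochner_Integration.integral_add) auto
    also have "\<dots> = \<bar>\<xi>\<bar> * (\<bar>\<xi>\<bar> * M + 5/2 * C * Q)"
      using that(2) by (simp add: power2_eq_square field_simps flip: abs_mult)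
    also have "\<dots> \<le> \<bar>\<xi>\<bar> * B"
      using mult_right_mono[OF that(1) M] by (intro mult_left_mono) (auto simp: B_def)
    finally show ?thesis by (simp add: mult.commute)
  qed
  show "(\<integral>\<^sup>+ \<xi>. ennreal (exp (- \<phi> \<xi>) / \<phi> \<xi>) \<partial>lborel) = \<infinity>"
  proof -
    \<comment> \<open>On the interval from 1 / (n + 1) to 1 the integrand is at least exp (-B) / (B
      x), and the integral of 1/x there is ln (n + 1), which is unbounded.\<close>
    have "ennreal (exp (- B) / B) * ennreal (ln (real (Suc n))) \<le> (\<integral>\<^sup>+ \<xi>. ennreal (exp (- \<phi> \<xi>) / \<phi> \<xi>) \<partial>lborel)" for n
    proof -
      have "ennreal (ln (real (Suc n))) = ennreal (ln 1 - ln (1 / real (Suc n)))" by (simp add: ln_div)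
      also have "\<dots> = (\<integral>\<^sup>+ x. ennreal (1 / x) * indicator {1 / real (Suc n)..1} x \<partial>lborel)"
      proof (rule nn_integral_FTC_Icc[symmetric])
        fix x :: real assume "x \<in> {1 / real (Suc n)..1}"
        then have "1 / real (Suc n) \<le> x" by simp
        then have x: "0 < x" by (rule less_le_trans[rotated]) simp
        then show "DERIV ln x :> 1 / x" "0 \<le> 1 / x" by (auto intro: DERIV_ln_divide)
      qed auto
      finally have "ennreal (exp (- B) / B) * ennreal (ln (real (Suc n))) =
          (\<integral>\<^sup>+ x. ennreal (exp (- B) / B) * (ennreal (1 / x) * indicator {1 / real (Suc n)..1} x) \<partial>lborel)"
        by (simp add: nn_integral_cmult)
      also have "\<dots> \<le> (\<integral>\<^sup>+ \<xi>. ennreal (exp (- \<phi> \<xi>) / \<phi> \<xi>) \<partial>lborel)"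
      proof (rule nn_integral_mono)
        fix x :: real
        show "ennreal (exp (- B) / B) * (ennreal (1 / x) * indicator {1 / real (Suc n)..1} x) \<le> ennreal (exp (- \<phi> x) / \<phi> x)"
        proof (cases "x \<in> {1 / real (Suc n)..1}")
          case True
          have x: "0 < x" "x \<le> 1" using True by (auto intro: less_le_trans[of _ "1 / real (Suc n)"])
          have p: "\<phi> x \<le> B * x" "0 < \<phi> x" using up[of x] \<phi>_pos[of x] x by auto
          have "B * x \<le> B" using x B by simp
          then have "exp (- B) / (B * x) \<le> exp (- \<phi> x) / \<phi> x" using p by (intro frac_le) auto
          then show ?thesis using True x B by (simp add: ennreal_mult[symmetric] ennreal_leI)
        qed simp
      qed
      finally show ?thesis .
    qed
    moreover have "(\<lambda>n. ennreal (exp (- B) / B) * ennreal (ln (real (Suc n)))) \<longlonglongrightarrow> \<infinity>"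
    proof -
      have "(\<lambda>n. ennreal (exp (- B) / B * ln (real (Suc n)))) \<longlonglongrightarrow> \<infinity>"
        unfolding infinity_ennreal_def
      proof (rule ennreal_tendsto_top_eq_at_top[THEN iffD2])
        have "0 < exp (- B) / B" using B by simp
        then show "filterlim (\<lambda>n. exp (- B) / B * ln (real (Suc n))) at_top sequentially" by real_asymp
      qed
      then show ?thesis using B by (simp add: ennreal_mult[symmetric])
    qed
    ultimately have "\<infinity> \<le> (\<integral>\<^sup>+ \<xi>. ennreal (exp (- \<phi> \<xi>) / \<phi> \<xi>) \<partial>lborel)"
      by (intro LIMSEQ_le_const2) auto
    then show ?thesis by (simp add: top_unique)
  qed
  fix z :: real
  \<comment> \<open>For |\<xi>| \<le> 2 the factor \<xi>^2 from 1 - cos cancels the one in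
    \<open>\<phi>_lower_quadratic\<close>, leaving this constant. For larger |\<xi>| the exponential
    is integrable and \<phi> \<ge> c0.\<close>
  define k where "k = z\<^sup>2 / 2 * (8 / (1 - cos 1))"
  have k: "0 \<le> k" using cos1 by (simp add: k_def)
  have i: "integrable lborel (\<lambda>\<xi>. k * indicator {-2..2} \<xi> + 2 / c0 * exp (- 1 * \<phi> \<xi>))"
    by (intro Bochner_Integration.integrable_add integrable_mult_right exp_int) auto
  have "(\<integral>\<^sup>+ \<xi>. ennreal ((1 - cos (z * \<xi>)) * (exp (- \<phi> \<xi>) / \<phi> \<xi>)) \<partial>lborel) \<le> (\<integral>\<^sup>+ \<xi>. ennreal (k * indicator {-2..2} \<xi> + 2 / c0 * exp (- 1 * \<phi> \<xi>)) \<partial>lborel)"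
  proof (rule nn_integral_mono_AE, use AE_lborel_singleton[of 0] in eventually_elim)
    fix \<xi> :: real assume x: "\<xi> \<noteq> 0"
    note p = \<phi>_pos[OF x]
    have "(1 - cos (z * \<xi>)) * (exp (- \<phi> \<xi>) / \<phi> \<xi>) \<le> k * indicator {-2..2} \<xi> + 2 / c0 * exp (- 1 * \<phi> \<xi>)"
    proof (cases "\<bar>\<xi>\<bar> \<le> 2")
      case True
      have "(1 - cos (z * \<xi>)) * (exp (- \<phi> \<xi>) / \<phi> \<xi>) \<le> ((z * \<xi>)\<^sup>2 / 2) * (1 / ((1 - cos 1) / 8 * \<xi>\<^sup>2))"
        using one_minus_cos_bound(2)[of "z * \<xi>"] \<phi>_lower_quadratic[OF True] p cos1 x
        by (intro mult_mono frac_le) (auto simp: less_imp_le)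
      also have "\<dots> = k" using x cos1 by (simp add: k_def power_mult_distrib field_simps)
      finally show ?thesis using True c0_pos by (auto simp: abs_le_iff intro!: add_increasing2)
    next
      case False
      have "(1 - cos (z * \<xi>)) * (exp (- \<phi> \<xi>) / \<phi> \<xi>) \<le> 2 * (exp (- \<phi> \<xi>) / c0)"
        using one_minus_cos_bound(1)[of "z * \<xi>"] \<phi>_ge_c0[of \<xi>] c0_pos p False
        by (intro mult_mono frac_le) (auto simp: less_imp_le)
      then show ?thesis using k by (simp add: add_increasing)
    qed
    then show "ennreal ((1 - cos (z * \<xi>)) * (exp (- \<phi> \<xi>) / \<phi> \<xi>)) \<le> ennreal (k * indicator {-2..2} \<xi> + 2 / c0 * exp (- 1 * \<phi> \<xi>))"
      by (rule ennreal_leI)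
  qed
  also have "\<dots> < \<infinity>" using nn_integral_eq_integral[OF i] k c0_pos by simp
  finally show "(\<integral>\<^sup>+ \<xi>. ennreal ((1 - cos (z * \<xi>)) * (exp (- \<phi> \<xi>) / \<phi> \<xi>)) \<partial>lborel) < \<infinity>" .
qed

end

text \<open>Sharing the same \<open>a\<close> and \<open>b\<close> gives all densities the
  integrable majorant built from \<open>stable_bound\<close>, so pointwise convergence of the
  indices yields that of the exponents.\<close>

theorem mosco_converges_stable_like:
  assumes n: "\<And>n. n \<ge> N0 \<Longrightarrow> alpha_density (\<alpha>n n) a b" and \<alpha>: "alpha_density \<alpha> a b"
    and lim: "\<And>u. 0 \<le> u \<Longrightarrow> (\<lambda>n. \<alpha>n n u) \<longlonglongrightarrow> \<alpha> u"
  shows "mosco_converges (\<lambda>n. stable_like_form (\<alpha>n n)) (stable_like_form \<alpha>)"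
  unfolding stable_like_form_def
proof (rule mosco_converges_translation_invariant[where ?N0.0=N0])
  interpret A: alpha_density \<alpha> a b by (rule \<alpha>)
  let ?\<phi>n = "\<lambda>n. char_exponent (levy_measure (\<alpha>n n))" and ?\<phi> = "char_exponent (levy_measure \<alpha>)"
  show "?\<phi>n n \<in> borel_measurable borel" "0 \<le> ?\<phi>n n x" "?\<phi>n n (- x) = ?\<phi>n n x" if "n \<ge> N0" for n x
  proof -
    interpret An: alpha_density "\<alpha>n n" a b by (rule n[OF that])
    show "?\<phi>n n \<in> borel_measurable borel" "0 \<le> ?\<phi>n n x" "?\<phi>n n (- x) = ?\<phi>n n x"
      unfolding An.char_exponent_eq by (rule An.\<phi>_meas An.\<phi>_nonneg An.\<phi>_even)+
  qed
  show "?\<phi> \<in> borel_measurable borel" "0 \<le> ?\<phi> x" "?\<phi> (- x) = ?\<phi> x" for x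
    unfolding A.char_exponent_eq by (rule A.\<phi>_meas A.\<phi>_nonneg A.\<phi>_even)+
  show "AE x in lborel. 0 < ?\<phi> x" unfolding A.char_exponent_eq by (rule A.AE_\<phi>_pos)
  fix \<xi>
  let ?I = "\<lambda>\<alpha> x. (1 - cos (\<xi> * x)) * stable_density \<alpha> x"
  \<comment> \<open>The shift by \<open>N0\<close> is needed since dominated convergence wants
    measurability and the majorant for every index.\<close>
  have "(\<lambda>n. LINT x|lborel. ?I (\<alpha>n (n + N0)) x) \<longlonglongrightarrow> (LINT x|lborel. ?I \<alpha> x)"
  proof (rule integral_dominated_convergence[where w="\<lambda>x. (2 + \<xi>\<^sup>2) * (min 1 (\<bar>x\<bar>\<^sup>2) * stable_bound a b \<bar>x\<bar>)"])
    show "integrable lborel (\<lambda>x. (2 + \<xi>\<^sup>2) * (min 1 (\<bar>x\<bar>\<^sup>2) * stable_bound a b \<bar>x\<bar>))"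
      by (intro integrable_mult_right stable_bound_integrable A.a_pos A.b_less)
    show "AE x in lborel. (\<lambda>n. ?I (\<alpha>n (n + N0)) x) \<longlonglongrightarrow> ?I \<alpha> x"
      using AE_lborel_singleton[of 0]
    proof eventually_elim
      fix x :: real assume "x \<noteq> 0"
      then show "(\<lambda>n. ?I (\<alpha>n (n + N0)) x) \<longlonglongrightarrow> ?I \<alpha> x"
        unfolding stable_density_def by (intro tendsto_intros LIMSEQ_ignore_initial_segment[OF lim]) auto
    qed
    fix n
    interpret An: alpha_density "\<alpha>n (n + N0)" a b by (rule n) simp
    show "?I (\<alpha>n (n + N0)) \<in> borel_measurable lborel" by measurable
    show "AE x in lborel. norm (?I (\<alpha>n (n + N0)) x) \<le> (2 + \<xi>\<^sup>2) * (min 1 (\<bar>x\<bar>\<^sup>2) * stable_bound a b \<bar>x\<bar>)"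
    proof (rule AE_I2)
      fix x
      have "norm (?I (\<alpha>n (n + N0)) x) \<le> (2 + \<xi>\<^sup>2) * (min 1 (x\<^sup>2) * stable_density (\<alpha>n (n + N0)) x)"
        using An.integrand_bound by simp
      also have "\<dots> \<le> (2 + \<xi>\<^sup>2) * (min 1 (\<bar>x\<bar>\<^sup>2) * stable_bound a b \<bar>x\<bar>)"
        unfolding power2_abs using An.h_le_stable_bound[of x] by (intro mult_left_mono) auto
      finally show "norm (?I (\<alpha>n (n + N0)) x) \<le> (2 + \<xi>\<^sup>2) * (min 1 (\<bar>x\<bar>\<^sup>2) * stable_bound a b \<bar>x\<bar>)" .
    qed
  qed measurable
  moreover have "?\<phi>n (n + N0) \<xi> = (LINT x|lborel. ?I (\<alpha>n (n + N0)) x)" for n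
  proof -
    interpret An: alpha_density "\<alpha>n (n + N0)" a b by (rule n) simp
    show ?thesis unfolding An.char_exponent_eq An.\<phi>_def ..
  qed
  moreover have "?\<phi> \<xi> = (LINT x|lborel. ?I \<alpha> x)" unfolding A.char_exponent_eq A.\<phi>_def ..
  ultimately have "(\<lambda>n. ?\<phi>n (n + N0) \<xi>) \<longlonglongrightarrow> ?\<phi> \<xi>" by simp
  then show "(\<lambda>n. ?\<phi>n n \<xi>) \<longlonglongrightarrow> ?\<phi> \<xi>" by (rule LIMSEQ_offset)
qed

section \<open>The logarithmic indices and the two families\<close>

lemma ln_exp2_ge:
  fixes u :: real assumes "0 \<le> u" shows "2 \<le> ln (u + (exp 1)\<^sup>2)"
proof -
  have "ln ((exp 1)\<^sup>2) \<le> ln (u + (exp (1::real))\<^sup>2)" using assms by (subst ln_le_cancel_iff) (auto simp: add_nonneg_pos)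
  then show ?thesis by (simp add: ln_realpow)
qed

text \<open>With L \<ge> 2 and \<beta> \<ge> 1/2 the subtracted power is at most 2^(-1/2). On
  [0, 1], L is at most its value at 1 and \<beta> \<le> 1, so that power is at least the reciprocal
  of this value. The range of \<open>c\<close> and \<beta> lets one pair of constants serve both
  families and both limits.\<close>

lemma alpha_density_log:
  assumes c: "1 \<le> c" "c \<le> 2" and \<beta>: "1 / 2 \<le> \<beta>" "\<beta> \<le> 1"
    and \<alpha>: "\<And>u. 0 \<le> u \<Longrightarrow> \<alpha> u = c - (ln (u + (exp 1)\<^sup>2)) powr (- \<beta>)"
  shows "alpha_density \<alpha> (1 - 2 powr (- (1 / 2))) (2 - 1 / ln (1 + (exp 1)\<^sup>2))"
proof
  have "(\<lambda>x. \<alpha> \<bar>x\<bar>) = (\<lambda>x. c - (ln (\<bar>x\<bar> + (exp 1)\<^sup>2)) powr (- \<beta>))" by (simp add: \<alpha> fun_eq_iff)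
  then show "(\<lambda>x. \<alpha> \<bar>x\<bar>) \<in> borel_measurable borel" by simp
  show "0 < 1 - 2 powr (- (1 / 2) :: real)" by (simp add: powr_minus_divide powr_half_sqrt)
  have e: "2 \<le> ln (1 + (exp (1::real))\<^sup>2)" by (rule ln_exp2_ge) simp
  then show "2 - 1 / ln (1 + (exp (1::real))\<^sup>2) < 2" by simp
  fix u :: real assume u: "0 \<le> u"
  let ?L = "ln (u + (exp 1)\<^sup>2)"
  note L = ln_exp2_ge[OF u]
  have "?L powr (- \<beta>) \<le> ?L powr (- (1/2))" using L \<beta> by (intro powr_mono) auto
  also have "\<dots> \<le> 2 powr (- (1/2))" using L by (intro powr_mono2') auto
  finally show "1 - 2 powr (- (1 / 2)) \<le> \<alpha> u" using c by (simp add: \<alpha>[OF u])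
  show "\<alpha> u \<le> 2" using c powr_ge_zero[of ?L "- \<beta>"] unfolding \<alpha>[OF u] by linarith
  assume u1: "u \<le> 1"
  have "?L \<le> ln (1 + (exp 1)\<^sup>2)" using u u1 by (subst ln_le_cancel_iff) (auto simp: add_nonneg_pos)
  then have "1 / ln (1 + (exp 1)\<^sup>2) \<le> 1 / ?L" using L by (intro divide_left_mono) auto
  also have "\<dots> = ?L powr (- 1)" using L by (simp add: powr_minus_divide)
  also have "\<dots> \<le> ?L powr (- \<beta>)" using L \<beta> by (intro powr_mono) auto
  finally show "\<alpha> u \<le> 2 - 1 / ln (1 + (exp 1)\<^sup>2)" using c by (simp add: \<alpha>[OF u])
qed

text \<open>The factor behaves like an exponential of a positive power of \<open>ln x\<close>. The
  range of \<beta> includes 1/2, the limit of the first family, and 1 - 1/n for n \<ge> 2, the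
  second family.\<close>

lemma transient_log:
  assumes \<beta>: "1 / 2 \<le> \<beta>" "\<beta> < 1" and \<alpha>: "\<And>u. 0 \<le> u \<Longrightarrow> \<alpha> u = 1 - (ln (u + (exp 1)\<^sup>2)) powr (- \<beta>)"
  shows "transient_form (stable_like_form \<alpha>)"
proof -
  interpret alpha_density \<alpha> "1 - 2 powr (- (1 / 2))" "2 - 1 / ln (1 + (exp 1)\<^sup>2)"
    by (rule alpha_density_log[of 1 \<beta>]) (use \<beta> \<alpha> in auto)
  have "\<forall>\<^sub>F x::real in at_top. 1 * (1 + ln x)\<^sup>2 \<le> x powr (ln (x + (exp 1)\<^sup>2) powr (- \<beta>))"
    using \<beta> by real_asymp
  then have "\<forall>\<^sub>F x in at_top. 1 * (1 + ln x)\<^sup>2 \<le> x powr (1 - \<alpha> x)"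
    using eventually_ge_at_top[of 0] by eventually_elim (simp add: \<alpha>)
  from transient_stable_like[OF _ this] show ?thesis by simp
qed

theorem proposition1p6:
  fixes \<alpha>n :: "nat \<Rightarrow> real \<Rightarrow> real" and \<alpha> :: "real \<Rightarrow> real"
  shows
    "((\<forall>n\<ge>1. \<forall>u\<ge>0. \<alpha>n n u = 1 + 1 / real n - (ln (u + (exp 1)\<^sup>2)) powr (- (1 / 2))) \<and>
      (\<forall>u\<ge>0. \<alpha> u = 1 - (ln (u + (exp 1)\<^sup>2)) powr (- (1 / 2)))
      \<longrightarrow>
      (\<forall>n\<ge>1. recurrent_form (stable_like_form (\<alpha>n n))) \<and>
      mosco_converges (\<lambda>n. stable_like_form (\<alpha>n n)) (stable_like_form \<alpha>) \<and>
      transient_form (stable_like_form \<alpha>))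
     \<and>
     ((\<forall>n\<ge>2. \<forall>u\<ge>0. \<alpha>n n u = 1 - (ln (u + (exp 1)\<^sup>2)) powr (- (1 - 1 / real n))) \<and>
      (\<forall>u\<ge>0. \<alpha> u = 1 - (ln (u + (exp 1)\<^sup>2)) powr (- 1))
      \<longrightarrow>
      (\<forall>n\<ge>2. transient_form (stable_like_form (\<alpha>n n))) \<and>
      mosco_converges (\<lambda>n. stable_like_form (\<alpha>n n)) (stable_like_form \<alpha>) \<and>
      recurrent_form (stable_like_form \<alpha>))"
proof (intro conjI impI; elim conjE)
  assume \<alpha>n: "\<forall>n\<ge>1. \<forall>u\<ge>0. \<alpha>n n u = 1 + 1 / real n - (ln (u + (exp 1)\<^sup>2)) powr (- (1 / 2))"
    and \<alpha>: "\<forall>u\<ge>0. \<alpha> u = 1 - (ln (u + (exp 1)\<^sup>2)) powr (- (1 / 2))"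
  let ?a = "1 - 2 powr (- (1 / 2)) :: real" and ?b = "2 - 1 / ln (1 + (exp 1)\<^sup>2) :: real"
  have dn: "alpha_density (\<alpha>n n) ?a ?b" if "n \<ge> 1" for n
    by (rule alpha_density_log[of "1 + 1 / real n" "1 / 2"]) (use \<alpha>n that in auto)
  have d: "alpha_density \<alpha> ?a ?b"
    by (rule alpha_density_log[of 1 "1 / 2"]) (use \<alpha> in auto)
  show "\<forall>n\<ge>1. recurrent_form (stable_like_form (\<alpha>n n))"
  proof (intro allI impI)
    fix n :: nat assume n: "1 \<le> n"
    interpret alpha_density "\<alpha>n n" ?a ?b by (rule dn[OF n])
    define e where "e = 1 / real n"
    have "0 < e" using n by (simp add: e_def)
    \<comment> \<open>For fixed \<open>n\<close> the logarithmic term tends to 0, so the exponent is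
      eventually negative.\<close>
    then have "\<forall>\<^sub>F x::real in at_top. x powr (ln (x + (exp 1)\<^sup>2) powr (- (1 / 2)) - e) \<le> 1"
      by real_asymp
    then have "\<forall>\<^sub>F x in at_top. x powr (1 - \<alpha>n n x) \<le> 1"
      using eventually_ge_at_top[of 0] by eventually_elim (use \<alpha>n n in \<open>simp add: e_def\<close>)
    then show "recurrent_form (stable_like_form (\<alpha>n n))" by (rule recurrent_stable_like)
  qed
  show "mosco_converges (\<lambda>n. stable_like_form (\<alpha>n n)) (stable_like_form \<alpha>)"
  proof (rule mosco_converges_stable_like[OF dn d])
    fix u :: real assume u: "0 \<le> u"
    have "(\<lambda>n. 1 + 1 / real n - (ln (u + (exp 1)\<^sup>2)) powr (- (1 / 2))) \<longlonglongrightarrow> 1 + 0 - (ln (u + (exp 1)\<^sup>2)) powr (- (1 / 2))"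
      by (intro tendsto_intros lim_1_over_n)
    moreover have "\<forall>\<^sub>F n in sequentially. 1 + 1 / real n - (ln (u + (exp 1)\<^sup>2)) powr (- (1 / 2)) = \<alpha>n n u"
      using eventually_ge_at_top[of 1] by eventually_elim (use \<alpha>n u in simp)
    ultimately show "(\<lambda>n. \<alpha>n n u) \<longlonglongrightarrow> \<alpha> u"
      using \<alpha> u by (auto dest: Lim_transform_eventually)
  qed
  show "transient_form (stable_like_form \<alpha>)"
    by (rule transient_log[of "1 / 2"]) (use \<alpha> in auto)
next
  assume \<alpha>n: "\<forall>n\<ge>2. \<forall>u\<ge>0. \<alpha>n n u = 1 - (ln (u + (exp 1)\<^sup>2)) powr (- (1 - 1 / real n))"
    and \<alpha>: "\<forall>u\<ge>0. \<alpha> u = 1 - (ln (u + (exp 1)\<^sup>2)) powr (- 1)"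
  let ?a = "1 - 2 powr (- (1 / 2)) :: real" and ?b = "2 - 1 / ln (1 + (exp 1)\<^sup>2) :: real"
  have half: "1 / 2 \<le> 1 - 1 / real n" if "n \<ge> 2" for n using that by (simp add: field_simps)
  have dn: "alpha_density (\<alpha>n n) ?a ?b" if "n \<ge> 2" for n
    by (rule alpha_density_log[of 1 "1 - 1 / real n"]) (use \<alpha>n that half[OF that] in auto)
  have d: "alpha_density \<alpha> ?a ?b"
    by (rule alpha_density_log[of 1 1]) (use \<alpha> in auto)
  show "\<forall>n\<ge>2. transient_form (stable_like_form (\<alpha>n n))"
  proof (intro allI impI)
    fix n :: nat assume n: "2 \<le> n"
    show "transient_form (stable_like_form (\<alpha>n n))"
      by (rule transient_log[OF half[OF n]]) (use \<alpha>n n in auto)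
  qed
  show "mosco_converges (\<lambda>n. stable_like_form (\<alpha>n n)) (stable_like_form \<alpha>)"
  proof (rule mosco_converges_stable_like[OF dn d])
    fix u :: real assume u: "0 \<le> u"
    have "(\<lambda>n. 1 - (ln (u + (exp 1)\<^sup>2)) powr (- (1 - 1 / real n))) \<longlonglongrightarrow> 1 - (ln (u + (exp 1)\<^sup>2)) powr (- (1 - 0))"
      using ln_exp2_ge[OF u] by (intro tendsto_intros lim_1_over_n) auto
    moreover have "\<forall>\<^sub>F n in sequentially. 1 - (ln (u + (exp 1)\<^sup>2)) powr (- (1 - 1 / real n)) = \<alpha>n n u"
      using eventually_ge_at_top[of 2] by eventually_elim (use \<alpha>n u in simp)
    ultimately show "(\<lambda>n. \<alpha>n n u) \<longlonglongrightarrow> \<alpha> u"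
      using \<alpha> u by (auto dest: Lim_transform_eventually)
  qed
  show "recurrent_form (stable_like_form \<alpha>)"
  proof -
    interpret alpha_density \<alpha> ?a ?b by (rule d)
    \<comment> \<open>At \<beta> = 1 the factor is the exponential of
      \<open>ln x / ln (x + (exp 1)\<^sup>2)\<close>, a quotient that is at most 1: the borderline
      case.\<close>
    have "\<forall>\<^sub>F x in at_top. x powr (1 - \<alpha> x) \<le> exp 1"
      using eventually_ge_at_top[of 1]
    proof eventually_elim
      fix x :: real assume x: "1 \<le> x"
      have L: "2 \<le> ln (x + (exp 1)\<^sup>2)" using x by (intro ln_exp2_ge) simp
      have "ln x \<le> ln (x + (exp 1)\<^sup>2)" using x by (subst ln_le_cancel_iff) (auto simp: add_pos_nonneg)
      then have "ln x / ln (x + (exp 1)\<^sup>2) \<le> 1" using L by simp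
      moreover have "x powr (1 - \<alpha> x) = exp (ln x / ln (x + (exp 1)\<^sup>2))"
        using x L \<alpha> by (simp add: powr_minus_divide powr_def[of x])
      ultimately show "x powr (1 - \<alpha> x) \<le> exp 1" by simp
    qed
    then show ?thesis by (rule recurrent_stable_like)
  qed
qed

end
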